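(* Let $\lambda>0$ and $\ell>0$. (i) If $0<\lambda\ell^2\le\hat\lambda$, then $\gamma_{\rm larc}^{\lambda,\ell,1}$ is the unique minimizer of $\mathcal{E}_\lambda$ among nontrivial (i.e. not the line segment) penalized pinned elasticae, up to reflection across the $x$-axis and reparametrization. (ii) If $\lambda\ell^2>\hat\lambda$, then $\gamma_{\rm loop}^{\lambda,\ell,1}$ is the unique minimizer of $\mathcal{E}_\lambda$ among nontrivial penalized pinned elasticae, up to reflection across the $x$-axis and reparametrization.
   Context: Elliptic functions: for $q\in[0,1)$, $x\in\mathbb{R}$, $\mathrm{F}(x,q)=\int_0^x(1-q^2\sin^2\theta)^{-1/2}\,d\theta$, $\mathrm{E}(x,q)=\int_0^x(1-q^2\sin^2\theta)^{1/2}\,d\theta$, $\mathrm{K}(q)=\mathrm{F}(\pi/2,q)$, $\mathrm{E}(q)=\mathrm{E}(\pi/2,q)$; $\mathrm{am}(\cdot,q)$ is the inverse of $x\mapsto\mathrm{F}(x,q)$, $\mathrm{cn}(x,q)=\cos\mathrm{am}(x,q)$. The function $q\mapsto2\mathrm{E}(q)-\mathrm{K}(q)$ is strictly decreasing on $[0,1)$ with unique zero $q_*\in(0,1)$. On $[1/\sqrt2,1)$ let $f(q)=(4q^4-5q^2+1)\mathrm{K}(q)+(-8q^4+8q^2-1)\mathrm{E}(q)$ and $g(q)=8(2\mathrm{E}(q)-\mathrm{K}(q))^2(2q^2-1)$. $f$ has a unique zero $\hat q\in[1/\sqrt2,1)$ (in $(1/\sqrt2,q_* )$); $\hat\lambda:=g(\hat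 q)\approx0.70107$. $g(1/\sqrt2)=0$, $g$ is strictly increasing on $[1/\sqrt2,\hat q]$, strictly decreasing on $[\hat q,q_*]$ with $g(q_* )=0$, strictly increasing on $[q_*,1)$ with $g\to\infty$ at $1$. For $c\in(0,\hat\lambda]$ let $q_2(c)$ be the solution of $g(q)=c$ in $[\hat q,q_* )$; for every $c>0$ let $q_3(c)$ be the unique solution of $g(q)=c$ in $(q_*,1)$. Setting: $A_\ell=\{\gamma\in W^{2,2}(0,1;\mathbb{R}^2): |\gamma'|\neq0$ on $[0,1]$, $\gamma(0)=(0,0),\ \gamma(1)=(\ell,0)\}$; $\mathcal{E}_\lambda[\gamma]=\int_\gamma k^2\,ds+\lambda L[\gamma]$ with $k$ signed curvature, $s$ arclength, $L$ length. A penalized pinned elastica is $\gamma\in A_\ell$ with $\frac{d}{d\varepsilon}\mathcal{E}_\lambda[\gamma+\varepsilon\eta]|_{\varepsilon=0}=0$ for all $\eta\in W^{2,2}(0,1;\mathbb{R}^2)\cap W^{1,2}_0(0,1;\mathbb{R}^2)$. Curves (arclength parametrized on $[0,2\mathrm{K}(q)/\alpha]$): for $\lambda\ell^2\le\hat\lambda$, $\gamma_{\rm larc}^{\lambda,\ell,1}(s)=\frac1\alpha\big(2\mathrm{E}(\mathrm{am}(\alpha s-\mathrm{K}(q),q),q)+2\mathrm{E}(q)-\alpha s,\ 2q\,\mathrm{cn}(\alpha s-\mathrm{K}(q),q)\big)$ with $q=q_2(\lambda\ell^2)$, $\alpha=\frac{2}{\ell}(2\mathrm{E}(q)-\mathrm{K}(q))$;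 $\gamma_{\rm loop}^{\lambda,\ell,1}(s)=\frac1\alpha\big(-2\mathrm{E}(\mathrm{am}(\alpha s-\mathrm{K}(q),q),q)-2\mathrm{E}(q)+\alpha s,\ 2q\,\mathrm{cn}(\alpha s-\mathrm{K}(q),q)\big)$ with $q=q_3(\lambda\ell^2)$, $\alpha=\frac{2}{\ell}(\mathrm{K}(q)-2\mathrm{E}(q))$. *)

theory Defs
  imports "HOL-Analysis.Analysis"
begin

definition ellF :: "real \<Rightarrow> real \<Rightarrow> real" where
  "ellF x q = (let h = (\<lambda>\<theta>. 1 / sqrt (1 - q\<^sup>2 * (sin \<theta>)\<^sup>2)) in
     if 0 \<le> x then integral {0..x} h else - integral {x..0} h)"

definition ellE :: "real \<Rightarrow> real \<Rightarrow> real" where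
  "ellE x q = (let h = (\<lambda>\<theta>. sqrt (1 - q\<^sup>2 * (sin \<theta>)\<^sup>2)) in
     if 0 \<le> x then integral {0..x} h else - integral {x..0} h)"

definition compK :: "real \<Rightarrow> real" where "compK q = ellF (pi/2) q"
definition compE :: "real \<Rightarrow> real" where "compE q = ellE (pi/2) q"

definition am :: "real \<Rightarrow> real \<Rightarrow> real" where "am u q = (THE x. ellF x q = u)"
definition cn :: "real \<Rightarrow> real \<Rightarrow> real" where "cn u q = cos (am u q)"

definition q_star :: real where
  "q_star = (THE q. 0 < q \<and> q < 1 \<and> 2 * compE q - compK q = 0)"

definition fpar :: "real \<Rightarrow> real" where
  "fpar q = (4*q^4 - 5*q\<^sup>2 + 1) * compK q + (-8*q^4 + 8*q\<^sup>2 - 1) * compE q"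

definition gpar :: "real \<Rightarrow> real" where
  "gpar q = 8 * (2 * compE q - compK q)\<^sup>2 * (2*q\<^sup>2 - 1)"

definition q_hat :: real where
  "q_hat = (THE q. 1 / sqrt 2 \<le> q \<and> q < 1 \<and> fpar q = 0)"

definition lambda_hat :: real where "lambda_hat = gpar q_hat"

definition q2 :: "real \<Rightarrow> real" where
  "q2 c = (THE q. q_hat \<le> q \<and> q < q_star \<and> gpar q = c)"

definition q3 :: "real \<Rightarrow> real" where
  "q3 c = (THE q. q_star < q \<and> q < 1 \<and> gpar q = c)"

text \<open>Planar curves are maps real \<Rightarrow> real \<times> real; only their values on [0,1] matter.
  W^{2,2}(0,1) (continuous representative): gamma(t) = gamma(0) + t v + int_0^t int_0^s g
  with g \<in> L^2(0,1).\<close>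
definition W22 :: "(real \<Rightarrow> real \<times> real) \<Rightarrow> bool" where
  "W22 \<gamma> \<longleftrightarrow> (\<exists>v g. g measurable_on {0..1} \<and> (\<lambda>t. (norm (g t))\<^sup>2) integrable_on {0..1} \<and>
      (\<forall>t\<in>{0..1}. \<gamma> t = \<gamma> 0 + t *\<^sub>R v + integral {0..t} (\<lambda>s. integral {0..s} g)))"

definition d1 :: "(real \<Rightarrow> real \<times> real) \<Rightarrow> real \<Rightarrow> real \<times> real" where
  "d1 \<gamma> t = vector_derivative \<gamma> (at t within {0..1})"

definition d2 :: "(real \<Rightarrow> real \<times> real) \<Rightarrow> real \<Rightarrow> real \<times> real" where
  "d2 \<gamma> t = vector_derivative (d1 \<gamma>) (at t within {0..1})"

definition admissible :: "real \<Rightarrow> (real \<Rightarrow> real \<times> real) \<Rightarrow> bool" where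
  "admissible l \<gamma> \<longleftrightarrow> W22 \<gamma> \<and> (\<forall>t\<in>{0..1}. d1 \<gamma> t \<noteq> 0) \<and> \<gamma> 0 = (0,0) \<and> \<gamma> 1 = (l,0)"

definition cross2 :: "real \<times> real \<Rightarrow> real \<times> real \<Rightarrow> real" where
  "cross2 a b = fst a * snd b - snd a * fst b"

text \<open>int_gamma k^2 ds, with k = (x'y''-y'x'')/|gamma'|^3 and ds = |gamma'| dt.\<close>
definition bending :: "(real \<Rightarrow> real \<times> real) \<Rightarrow> real" where
  "bending \<gamma> = integral {0..1} (\<lambda>t. (cross2 (d1 \<gamma> t) (d2 \<gamma> t))\<^sup>2 / (norm (d1 \<gamma> t)) ^ 5)"

definition curve_length :: "(real \<Rightarrow> real \<times> real) \<Rightarrow> real" where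
  "curve_length \<gamma> = integral {0..1} (\<lambda>t. norm (d1 \<gamma> t))"

definition energy :: "real \<Rightarrow> (real \<Rightarrow> real \<times> real) \<Rightarrow> real" where
  "energy lam \<gamma> = bending \<gamma> + lam * curve_length \<gamma>"

definition pinned_elastica :: "real \<Rightarrow> real \<Rightarrow> (real \<Rightarrow> real \<times> real) \<Rightarrow> bool" where
  "pinned_elastica lam l \<gamma> \<longleftrightarrow> admissible l \<gamma> \<and>
     (\<forall>\<eta>. W22 \<eta> \<and> \<eta> 0 = 0 \<and> \<eta> 1 = 0 \<longrightarrow>
        ((\<lambda>\<epsilon>. energy lam (\<lambda>t. \<gamma> t + \<epsilon> *\<^sub>R \<eta> t)) has_real_derivative 0) (at 0))"

definition reparam_of :: "(real \<Rightarrow> real \<times> real) \<Rightarrow> (real \<Rightarrow> real \<times> real) \<Rightarrow> bool" where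
  "reparam_of \<gamma> \<sigma> \<longleftrightarrow> (\<exists>\<phi>. continuous_on {0..1} \<phi> \<and> strict_mono_on {0..1} \<phi> \<and>
      \<phi> 0 = 0 \<and> \<phi> 1 = 1 \<and> (\<forall>t\<in>{0..1}. \<gamma> t = \<sigma> (\<phi> t)))"

definition reflect_x :: "real \<times> real \<Rightarrow> real \<times> real" where
  "reflect_x p = (fst p, - snd p)"

definition segment_curve :: "real \<Rightarrow> real \<Rightarrow> real \<times> real" where
  "segment_curve l t = (t * l, 0)"

definition nontrivial :: "real \<Rightarrow> (real \<Rightarrow> real \<times> real) \<Rightarrow> bool" where
  "nontrivial l \<gamma> \<longleftrightarrow> \<not> reparam_of \<gamma> (segment_curve l)"

section \<open>The explicit curves, rescaled from arclength on [0, 2K(q)/alpha] to [0,1]\<close>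

definition larc_arcl :: "real \<Rightarrow> real \<Rightarrow> real \<Rightarrow> real \<times> real" where
  "larc_arcl lam l s = (let q = q2 (lam * l\<^sup>2); al = 2 / l * (2 * compE q - compK q) in
     ((2 * ellE (am (al * s - compK q) q) q + 2 * compE q - al * s) / al,
      (2 * q * cn (al * s - compK q) q) / al))"

definition loop_arcl :: "real \<Rightarrow> real \<Rightarrow> real \<Rightarrow> real \<times> real" where
  "loop_arcl lam l s = (let q = q3 (lam * l\<^sup>2); al = 2 / l * (compK q - 2 * compE q) in
     ((- 2 * ellE (am (al * s - compK q) q) q - 2 * compE q + al * s) / al,
      (2 * q * cn (al * s - compK q) q) / al))"

definition larc :: "real \<Rightarrow> real \<Rightarrow> real \<Rightarrow> real \<times> real" where
  "larc lam l t = (let q = q2 (lam * l\<^sup>2); al = 2 / l * (2 * compE q - compK q) in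
     larc_arcl lam l (t * (2 * compK q / al)))"

definition loop :: "real \<Rightarrow> real \<Rightarrow> real \<Rightarrow> real \<times> real" where
  "loop lam l t = (let q = q3 (lam * l\<^sup>2); al = 2 / l * (compK q - 2 * compE q) in
     loop_arcl lam l (t * (2 * compK q / al)))"

definition unique_min_nontrivial :: "real \<Rightarrow> real \<Rightarrow> (real \<Rightarrow> real \<times> real) \<Rightarrow> bool" where
  "unique_min_nontrivial lam l \<gamma>0 \<longleftrightarrow>
     pinned_elastica lam l \<gamma>0 \<and> nontrivial l \<gamma>0 \<and>
     (\<forall>\<gamma>. pinned_elastica lam l \<gamma> \<and> nontrivial l \<gamma> \<longrightarrow>
        energy lam \<gamma>0 \<le> energy lam \<gamma> \<and>
        (energy lam \<gamma> = energy lam \<gamma>0 \<longrightarrow>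
           reparam_of \<gamma> \<gamma>0 \<or> reparam_of \<gamma> (reflect_x \<circ> \<gamma>0)))"

end

theory Submission
  imports Defs
begin

text \<open>The du Bois-Reymond lemma turns criticality into a first integral \<open>F\<close>; the natural boundary conditions make
  \<open>F\<close> horizontal, so that the curvature is \<open>F y / 2\<close> and the energy is \<open>2 lam L - F l\<close>. A Gronwall argument then
  identifies the curve with \<open>n\<close> consecutive half-periods of a wavelike elastica of modulus \<open>q\<close>, where
  \<open>n * \<bar>G q\<bar> = sqrt lam * l\<close> and the energy is \<open>n * sqrt lam * H q\<close>. What remains is to minimize \<open>n * H q\<close> under
  this constraint. Everything there follows from \<open>H' = - G' / w\<close> with \<open>w = 2 q^2 - 1\<close>, the sign change of \<open>G'\<close> at
  \<open>q_hat\<close>, and the bounds \<open>sqrt (1 - q^2) K \<le> E \<le> (1 - q^2/2) K\<close>.\<close>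

section \<open>Primitives of integrable functions\<close>

text \<open>The curves are only W^{2,2}: \<open>d2\<close> exists almost everywhere and criticality
  is an integrated identity. Hence the calculus of \<open>ac_primitive\<close>, which is left behind
  once the sine of the tangent angle is known to have a continuous derivative. Curves are not
  reparametrized by arclength; the speed stays as a factor in the equations. Three conservation laws
  are at work: translation invariance gives the constant force F, rotation invariance makes the
  curvature affine in the position, and invariance under reparametrization gives a speed identity.
  The moment vanishes at both pinned ends, which is why F is horizontal. At t = 0 the laws read
  (lam/F)^2 + s(0)^2 = 1, with s the sine of the tangent angle, so the curve is straight or |F| >
  lam; since lam > 0, only moduli with 2 q^2 > 1 remain. The relation between H' and G' is the
  envelope principle: when an end point moves, the energy of an elastica changes at the rate given
  by the end force. It permits comparisons by tangent lines, H + G/w0 with w0 frozen, in place of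
  numerical values of elliptic integrals.\<close>

lemmas hk_integral_cong = Henstock_Kurzweil_Integration.integral_cong
lemmas hk_integral_combine = Henstock_Kurzweil_Integration.integral_combine

abbreviation at01 :: "real \<Rightarrow> real filter" where "at01 t \<equiv> at t within {0..1}"

text \<open>Absolute continuity on [0,1] expressed by the integral alone, so that \<open>df\<close>
  may be changed on a null set and no pointwise derivative of \<open>f\<close> has to exist.\<close>

definition ac_primitive :: "(real \<Rightarrow> 'a::euclidean_space) \<Rightarrow> (real \<Rightarrow> 'a) \<Rightarrow> bool" where
  "ac_primitive f df \<longleftrightarrow> df absolutely_integrable_on {0..1} \<and>
     (\<forall>t\<in>{0..1}. integral {0..t} df = f t - f 0)"

lemma ac_primitive_integrable:
  assumes "ac_primitive f df" "0 \<le> a" "b \<le> 1"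
  shows "df absolutely_integrable_on {a..b}"
  by (rule absolutely_integrable_on_subinterval[where S = "{0..1}"]) (use assms in \<open>auto simp: ac_primitive_def\<close>)

lemma ac_primitive_increment:
  assumes "ac_primitive f df" "0 \<le> a" "a \<le> b" "b \<le> 1"
  shows "f b - f a = integral {a..b} df"
proof -
  have "df integrable_on {0..b}"
    using ac_primitive_integrable[OF assms(1), of 0 b] assms
    by (auto simp: absolutely_integrable_on_def)
  then have "integral {0..a} df + integral {a..b} df = integral {0..b} df"
    using assms by (intro hk_integral_combine) auto
  then have "f a - f 0 + integral {a..b} df = f b - f 0"
    using assms by (auto simp: ac_primitive_def)
  then show ?thesis by (simp add: algebra_simps)
qed

lemma ac_primitive_continuous:
  assumes "ac_primitive f df"
  shows "continuous_on {0..1} f"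
proof -
  have "continuous_on {0..1} (\<lambda>t. f 0 + integral {0..t} df)"
    using assms unfolding ac_primitive_def absolutely_integrable_on_def
    by (intro continuous_intros indefinite_integral_continuous_1) auto
  then show ?thesis
    by (rule continuous_on_eq) (use assms in \<open>auto simp: ac_primitive_def\<close>)
qed

lemma ac_primitive_cong:
  assumes "ac_primitive f df" "negligible N"
    and "\<And>t. t \<in> {0..1} \<Longrightarrow> g t = f t"
    and "\<And>t. t \<in> {0..1} - N \<Longrightarrow> dg t = df t"
  shows "ac_primitive g dg"
  unfolding ac_primitive_def
proof (intro conjI ballI)
  show "dg absolutely_integrable_on {0..1}"
    by (rule absolutely_integrable_spike[where f = df and S = N]) (use assms in \<open>auto simp: ac_primitive_def\<close>)
  fix t :: real assume t: "t \<in> {0..1}"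
  have "integral {0..t} dg = integral {0..t} df"
    by (rule integral_spike[OF assms(2)]) (use assms(4) t in auto)
  then show "integral {0..t} dg = g t - g 0"
    using assms(1,3) t by (auto simp: ac_primitive_def)
qed

lemma ac_primitive_indefinite:
  assumes "df absolutely_integrable_on {0..1}"
  shows "ac_primitive (\<lambda>t. c + integral {0..t} df) df"
  using assms by (auto simp: ac_primitive_def)

lemma ac_primitive_of_derivative:
  fixes f :: "real \<Rightarrow> 'a::euclidean_space"
  assumes "\<And>t. t \<in> {0..1} \<Longrightarrow> (f has_vector_derivative f' t) (at01 t)"
    and "continuous_on {0..1} f'"
  shows "ac_primitive f f'"
  unfolding ac_primitive_def
proof (intro conjI ballI)
  show "f' absolutely_integrable_on {0..1}"
    using absolutely_integrable_continuous[of 0 1 f'] assms(2) by (simp add: cbox_interval)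
  fix t :: real assume t: "t \<in> {0..1}"
  have "(f' has_integral f t - f 0) {0..t}"
    using t by (intro fundamental_theorem_of_calculus)
      (auto intro: has_vector_derivative_within_subset[OF assms(1)])
  then show "integral {0..t} f' = f t - f 0" by (simp add: integral_unique)
qed

lemma ac_primitive_has_derivative:
  assumes "ac_primitive f df" "continuous_on {0..1} df" "t \<in> {0..1}"
  shows "(f has_vector_derivative df t) (at01 t)"
proof -
  have "((\<lambda>u. integral {0..u} df) has_vector_derivative df t) (at01 t)"
    by (rule integral_has_vector_derivative[OF assms(2,3)])
  then have "((\<lambda>u. f 0 + integral {0..u} df) has_vector_derivative df t) (at01 t)"
    by (auto intro!: derivative_eq_intros)
  then show ?thesis
    by (rule has_vector_derivative_transform[rotated 2]) (use assms in \<open>auto simp: ac_primitive_def\<close>)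
qed

lemma ac_primitive_linear:
  assumes "ac_primitive f df" "bounded_linear h"
  shows "ac_primitive (\<lambda>t. h (f t)) (\<lambda>t. h (df t))"
  unfolding ac_primitive_def
proof (intro conjI ballI)
  interpret h: bounded_linear h by fact
  show "(\<lambda>t. h (df t)) absolutely_integrable_on {0..1}"
    using absolutely_integrable_linear[OF _ assms(2), where f = df and s = "{0..1}"] assms(1)
    by (auto simp: ac_primitive_def o_def)
  fix t :: real assume t: "t \<in> {0..1}"
  have "df integrable_on {0..t}"
    using ac_primitive_integrable[OF assms(1), of 0 t] t by (auto simp: absolutely_integrable_on_def)
  then have "integral {0..t} (\<lambda>t. h (df t)) = h (integral {0..t} df)"
    using integral_linear[OF _ assms(2), of df "{0..t}"] by (simp add: o_def)
  then show "integral {0..t} (\<lambda>t. h (df t)) = h (f t) - h (f 0)"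
    using assms(1) t by (simp add: ac_primitive_def h.diff)
qed

lemmas ac_primitive_fst = ac_primitive_linear[OF _ bounded_linear_fst]
lemmas ac_primitive_snd = ac_primitive_linear[OF _ bounded_linear_snd]
lemmas ac_primitive_cmult = ac_primitive_linear[OF _ bounded_linear_mult_right]

lemma ac_primitive_add:
  assumes "ac_primitive f df" "ac_primitive g dg"
  shows "ac_primitive (\<lambda>t. f t + g t) (\<lambda>t. df t + dg t)"
  unfolding ac_primitive_def
proof (intro conjI ballI)
  show "(\<lambda>t. df t + dg t) absolutely_integrable_on {0..1}"
    using assms by (auto simp: ac_primitive_def intro: set_integral_add)
  fix t :: real assume t: "t \<in> {0..1}"
  have "df integrable_on {0..t}" "dg integrable_on {0..t}"
    using ac_primitive_integrable[OF assms(1), of 0 t] ac_primitive_integrable[OF assms(2), of 0 t] t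
    by (auto simp: absolutely_integrable_on_def)
  then have "integral {0..t} (\<lambda>t. df t + dg t) = integral {0..t} df + integral {0..t} dg"
    by (rule integral_add)
  then show "integral {0..t} (\<lambda>t. df t + dg t) = f t + g t - (f 0 + g 0)"
    using assms t by (simp add: ac_primitive_def)
qed

lemma ac_primitive_diff:
  fixes f g :: "real \<Rightarrow> 'a::euclidean_space"
  assumes "ac_primitive f df" "ac_primitive g dg"
  shows "ac_primitive (\<lambda>t. f t - g t) (\<lambda>t. df t - dg t)"
  using ac_primitive_add[OF assms(1) ac_primitive_linear[OF assms(2) bounded_linear_minus[OF bounded_linear_ident]]]
  by simp

lemma integrable_continuous_times:
  fixes f g :: "real \<Rightarrow> real"
  assumes "continuous_on {a..b} f" "g absolutely_integrable_on {a..b}"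
  shows "(\<lambda>t. f t * g t) absolutely_integrable_on {a..b}"
proof (rule absolutely_integrable_bounded_measurable_product_real)
  show "f \<in> borel_measurable (lebesgue_on {a..b})"
    using assms(1) by (intro continuous_imp_measurable_on_sets_lebesgue) auto
  show "bounded (f ` {a..b})"
    using assms(1) compact_continuous_image compact_imp_bounded by blast
qed (use assms in auto)

text \<open>On a short interval the mean value theorem and the intermediate value theorem give
  \<open>F (f b) - F (f a) = F' (f t0) * (f b - f a)\<close> for some \<open>t0\<close> in the interval;
  the local estimates are then glued by bisection.\<close>

lemma ac_primitive_chain:
  fixes f df F F' :: "real \<Rightarrow> real"
  assumes f: "ac_primitive f df"
    and F: "\<And>t. t \<in> {0..1} \<Longrightarrow> (F has_real_derivative F' (f t)) (at (f t))"
    and cF: "continuous_on {0..1} (\<lambda>t. F' (f t))"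
  shows "ac_primitive (\<lambda>t. F (f t)) (\<lambda>t. F' (f t) * df t)"
proof -
  let ?h = "(\<lambda>t. F' (f t) * df t)"
  let ?v = "(\<lambda>t. \<bar>df t\<bar>)"
  have cf: "continuous_on {0..1} f" using ac_primitive_continuous[OF f] .
  have int: "?h absolutely_integrable_on {a..b}" if "0 \<le> a" "b \<le> 1" for a b
    using ac_primitive_integrable[OF f that] that continuous_on_subset[OF cF, of "{a..b}"]
    by (intro integrable_continuous_times) auto
  have mv: "\<exists>t0\<in>{a..b}. F (f b) - F (f a) = F' (f t0) * (f b - f a)"
    if ab: "0 \<le> a" "a \<le> b" "b \<le> 1" for a b
  proof -
    have c: "continuous_on {a..b} f" using cf ab by (auto intro: continuous_on_subset)
    have *: "\<exists>t0\<in>{a..b}. F v - F u = F' (f t0) * (v - u)"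
      if uv: "u \<le> v" "u \<in> f ` {a..b}" "v \<in> f ` {a..b}" for u v
    proof -
      have "is_interval (f ` {a..b})"
        unfolding is_interval_connected_1 by (intro connected_continuous_image c) auto
      then have sub: "{u..v} \<subseteq> f ` {a..b}" using uv by (auto intro: mem_is_interval_1_I)
      have "\<exists>z\<in>{u..v}. F v - F u = F' z * (v - u)"
      proof (rule mvt_very_simple[OF uv(1)])
        fix z assume "u \<le> z" "z \<le> v"
        then have "z \<in> f ` {a..b}" using sub by auto
        then have "(F has_real_derivative F' z) (at z)" using F ab by auto
        then show "(F has_derivative (*) (F' z)) (at z within {u..v})"
          using has_field_derivative_at_within[of F "F' z" z] by (simp add: has_field_derivative_def)
      qed
      then show ?thesis using sub by blast
    qed
    have ends: "f a \<in> f ` {a..b}" "f b \<in> f ` {a..b}" using ab by auto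
    show ?thesis
    proof (cases "f a \<le> f b")
      case False
      then obtain t0 where "t0 \<in> {a..b}" "F (f a) - F (f b) = F' (f t0) * (f a - f b)"
        using *[OF _ ends(2,1)] by auto
      then show ?thesis by (intro bexI[of _ t0]) (auto simp: algebra_simps)
    qed (use *[OF _ ends] in auto)
  qed
  have key: "\<bar>F (f b) - F (f a) - integral {a..b} ?h\<bar>
      \<le> e * integral {a..b} ?v"
    if ab: "0 \<le> a" "a \<le> b" "b \<le> 1" and e: "e > 0" for a b e
  proof -
    define P where "P a b \<longleftrightarrow> 0 \<le> a \<longrightarrow> a \<le> b \<longrightarrow> b \<le> 1 \<longrightarrow>
      \<bar>F (f b) - F (f a) - integral {a..b} ?h\<bar>
      \<le> e * integral {a..b} ?v" for a b
    from \<open>a \<le> b\<close> have "P a b"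
    proof (induction rule: Bolzano)
      case (trans a b c)
      show ?case unfolding P_def
      proof (intro impI)
        assume "0 \<le> a" "a \<le> c" "c \<le> 1"
        have i1: "integral {a..b} ?h + integral {b..c} ?h
            = integral {a..c} ?h"
          using int[OF \<open>0\<le>a\<close> \<open>c\<le>1\<close>] trans
          by (intro hk_integral_combine) (auto simp: absolutely_integrable_on_def)
        have i2: "integral {a..b} ?v + integral {b..c} ?v = integral {a..c} ?v"
          using ac_primitive_integrable[OF f \<open>0\<le>a\<close> \<open>c\<le>1\<close>] trans
          by (intro hk_integral_combine) (auto simp: absolutely_integrable_on_def)
        have "P a b" "P b c" "0 \<le> b" "b \<le> 1" using trans \<open>0 \<le> a\<close> \<open>c \<le> 1\<close> by auto
        then show "\<bar>F (f c) - F (f a) - integral {a..c} ?h\<bar>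
          \<le> e * integral {a..c} ?v"
          using trans \<open>0 \<le> a\<close> \<open>c \<le> 1\<close> unfolding P_def i1[symmetric] i2[symmetric] ring_distribs
          by linarith
      qed
    next
      case (local x)
      then have x: "x \<in> {0..1}" using ab by auto
      with cF obtain d where d: "d > 0"
        "\<And>t. t \<in> {0..1} \<Longrightarrow> dist t x < d \<Longrightarrow> dist (F' (f t)) (F' (f x)) < e/2"
        unfolding continuous_on_iff using e by (metis half_gt_zero)
      show ?case
      proof (intro exI[of _ d] conjI allI impI)
        fix a b assume *: "a \<le> x \<and> x \<le> b \<and> b - a < d"
        show "P a b" unfolding P_def
        proof (intro impI)
          assume ab: "0 \<le> a" "a \<le> b" "b \<le> 1"
          obtain t0 where t0: "t0 \<in> {a..b}" "F (f b) - F (f a) = F' (f t0) * (f b - f a)"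
            using mv[OF ab] by blast
          have idf: "df absolutely_integrable_on {a..b}" using ac_primitive_integrable[OF f] ab by auto
          have "F (f b) - F (f a) = integral {a..b} (\<lambda>t. F' (f t0) * df t)"
            using t0 ac_primitive_increment[OF f ab] by simp
          then have "F (f b) - F (f a) - integral {a..b} ?h
            = integral {a..b} (\<lambda>t. F' (f t0) * df t - F' (f t) * df t)"
            using int[OF ab(1,3)] idf
            by (subst integral_diff) (auto simp: absolutely_integrable_on_def intro!: integrable_on_mult_right)
          also have "\<bar>\<dots>\<bar> \<le> integral {a..b} (\<lambda>t. e * \<bar>df t\<bar>)"
            unfolding real_norm_def[symmetric]
          proof (rule integral_norm_bound_integral)
            fix t assume t: "t \<in> {a..b}"
            have "dist (F' (f t)) (F' (f x)) < e/2" "dist (F' (f t0)) (F' (f x)) < e/2"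
              by (rule d(2); use * t t0 ab in \<open>auto simp: dist_real_def\<close>)+
            then have "\<bar>F' (f t0) - F' (f t)\<bar> \<le> e" unfolding dist_real_def by linarith
            then have "\<bar>F' (f t0) - F' (f t)\<bar> * \<bar>df t\<bar> \<le> e * \<bar>df t\<bar>" by (intro mult_right_mono) auto
            then show "norm (F' (f t0) * df t - F' (f t) * df t) \<le> e * norm (df t)"
              by (simp add: abs_mult left_diff_distrib[symmetric])
          qed (use int[OF ab(1,3)] idf in \<open>auto simp: absolutely_integrable_on_def intro!: integrable_diff integrable_on_mult_right\<close>)
          finally show "\<bar>F (f b) - F (f a) - integral {a..b} ?h\<bar>
            \<le> e * integral {a..b} ?v" by simp
        qed
      qed (rule d)
    qed
    then show ?thesis using ab by (auto simp: P_def)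
  qed
  have "F (f t) - F (f 0) - integral {0..t} ?h = 0" if t: "t \<in> {0..1}" for t
  proof -
    let ?A = "\<bar>F (f t) - F (f 0) - integral {0..t} ?h\<bar>"
    let ?B = "integral {0..t} ?v"
    have "((\<lambda>e. e * ?B) \<longlongrightarrow> 0 * ?B) (at_right 0)" by (intro tendsto_intros)
    moreover have "\<forall>\<^sub>F e in at_right 0. ?A \<le> e * ?B"
      using key[of 0 t] t by (auto simp: eventually_at_right_less intro: eventually_mono[OF eventually_at_right_less])
    ultimately have "?A \<le> 0 * ?B"
      by (intro tendsto_le[OF _ _ tendsto_const]) auto
    then show ?thesis by simp
  qed
  then have "integral {0..t} ?h = F (f t) - F (f 0)" if "t \<in> {0..1}" for t
    using that by fastforce
  then show ?thesis unfolding ac_primitive_def using int[of 0 1] by blast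
qed

text \<open>Polarization: a product is a combination of squares, and squares are covered by the
  chain rule. No interchange of integrals is needed.\<close>

lemma ac_primitive_mult:
  fixes f g :: "real \<Rightarrow> real"
  assumes "ac_primitive f df" "ac_primitive g dg"
  shows "ac_primitive (\<lambda>t. f t * g t) (\<lambda>t. df t * g t + f t * dg t)"
proof -
  have sq: "ac_primitive (\<lambda>t. (h t)^2) (\<lambda>t. 2 * h t * \<omega> t)" if "ac_primitive h \<omega>" for h \<omega> :: "real \<Rightarrow> real"
    by (rule ac_primitive_chain[OF that])
      (auto intro!: derivative_eq_intros continuous_intros ac_primitive_continuous[OF that])
  have "ac_primitive (\<lambda>t. (1/2) * ((f t + g t)^2 - (f t)^2 - (g t)^2))
     (\<lambda>t. (1/2) * (2 * (f t + g t) * (df t + dg t) - 2 * f t * df t - 2 * g t * dg t))"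
    by (intro ac_primitive_cmult ac_primitive_diff sq ac_primitive_add assms)
  then show ?thesis
    by (rule ac_primitive_cong[OF _ negligible_empty]) (auto simp: power2_eq_square algebra_simps)
qed

text \<open>Lebesgue differentiation. The averages used are those over boxes with left corner at the
  point, which give the derivative from the right; the derivative from the left comes from the same
  fact for the reflected function, so its exceptional set is reflected back. Extension by zero to
  \<open>dg\<close> makes the integrand integrable on every box.\<close>

lemma indefinite_integral_has_derivative_ae:
  fixes df :: "real \<Rightarrow> 'a::euclidean_space"
  assumes "df integrable_on {0..1}"
  obtains N where "negligible N"
    "\<And>t. t \<in> {0..1} - N \<Longrightarrow>
      ((\<lambda>t. integral {0..t} df) has_vector_derivative df t) (at01 t)"
proof -
  define dg where "dg x = (if x \<in> {0..1} then df x else 0)" for x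
  have "dg integrable_on UNIV"
    using assms unfolding dg_def integrable_restrict_UNIV .
  then have i1: "dg integrable_on cbox a b" for a b
    by (rule integrable_on_subcbox) simp
  have i2: "(\<lambda>x. dg (- x)) integrable_on cbox a b" for a b
    using i1[of "-b" "-a"] Henstock_Kurzweil_Integration.integrable_reflect_real[where f = dg and a = "-b" and b = "-a"] by (simp add: cbox_interval)
  obtain N1 where N1: "negligible N1"
    "\<And>x e. \<lbrakk>x \<notin> N1; 0 < e\<rbrakk> \<Longrightarrow> \<exists>d>0. \<forall>h. 0 < h \<and> h < d \<longrightarrow>
       norm (integral (cbox x (x + h *\<^sub>R One)) dg /\<^sub>R h ^ DIM(real) - dg x) < e"
    using integrable_ccontinuous_explicit[OF i1] by blast
  obtain N2 where N2: "negligible N2"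
    "\<And>x e. \<lbrakk>x \<notin> N2; 0 < e\<rbrakk> \<Longrightarrow> \<exists>d>0. \<forall>h. 0 < h \<and> h < d \<longrightarrow>
       norm (integral (cbox x (x + h *\<^sub>R One)) (\<lambda>x. dg (- x)) /\<^sub>R h ^ DIM(real) - dg (- x)) < e"
    using integrable_ccontinuous_explicit[OF i2] by blast
  show thesis
  proof
    show "negligible (N1 \<union> uminus ` N2)"
      using N1(1) N2(1)
      by (intro negligible_Un negligible_differentiable_image_negligible)
        (auto intro!: derivative_intros simp: differentiable_on_def)
    fix t assume t: "t \<in> {0..1} - (N1 \<union> uminus ` N2)"
    then have tN: "t \<notin> N1" "- t \<notin> N2" "t \<in> {0..1}"
      by (auto simp: image_iff)
    have inc: "integral {0..y} df - integral {0..x} df = integral {x..y} dg"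
      if "0 \<le> x" "x \<le> y" "y \<le> 1" for x y
    proof -
      have "integral {x..y} dg = integral {x..y} df"
        by (rule hk_integral_cong) (use that in \<open>auto simp: dg_def\<close>)
      moreover have "df integrable_on {0..y}"
        by (rule integrable_subinterval_real[OF assms]) (use that in auto)
      then have "integral {0..x} df + integral {x..y} df = integral {0..y} df"
        by (intro hk_integral_combine) (use that in auto)
      ultimately show ?thesis by (simp add: algebra_simps)
    qed
    show "((\<lambda>t. integral {0..t} df) has_vector_derivative df t) (at01 t)"
      unfolding has_vector_derivative_def has_derivative_within_alt
    proof (intro conjI allI impI)
      show "bounded_linear (\<lambda>x. x *\<^sub>R df t)" by (rule bounded_linear_scaleR_left)
      fix e :: real assume e: "0 < e"
      obtain da where da: "da > 0" "\<And>h. 0 < h \<Longrightarrow> h < da \<Longrightarrow>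
          norm (integral {t..t+h} dg /\<^sub>R h - df t) < e"
        using N1(2)[OF tN(1) e] tN(3) by (auto simp: cbox_interval dg_def)
      obtain db where db: "db > 0" "\<And>h. 0 < h \<Longrightarrow> h < db \<Longrightarrow>
          norm (integral {-t..-t+h} (\<lambda>x. dg (- x)) /\<^sub>R h - df t) < e"
        using N2(2)[OF tN(2) e] tN(3) by (auto simp: cbox_interval dg_def)
      have scale: "norm (w - h *\<^sub>R v) \<le> e * h" if "0 < h" "norm (w /\<^sub>R h - v) < e" for w v :: 'a and h
      proof -
        have "w - h *\<^sub>R v = h *\<^sub>R (w /\<^sub>R h - v)" using that by (simp add: scaleR_diff_right)
        then have "norm (w - h *\<^sub>R v) = h * norm (w /\<^sub>R h - v)" using that by simp
        then show ?thesis using that by (simp add: mult.commute)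
      qed
      show "\<exists>d>0. \<forall>y\<in>{0..1}. norm (y - t) < d \<longrightarrow>
         norm (integral {0..y} df - integral {0..t} df - (y - t) *\<^sub>R df t) \<le> e * norm (y - t)"
      proof (intro exI[of _ "min da db"] conjI ballI impI)
        fix y :: real assume y: "y \<in> {0..1}" "norm (y - t) < min da db"
        consider "y = t" | "t < y" | "y < t" by linarith
        then show "norm (integral {0..y} df - integral {0..t} df - (y - t) *\<^sub>R df t) \<le> e * norm (y - t)"
        proof cases
          case 2
          then show ?thesis
            using scale[OF _ da(2)[of "y - t"]] y tN inc[of t y] by auto
        next
          case 3
          have "integral {-t..-y} (\<lambda>x. dg (- x)) = integral {y..t} dg"
            by (rule Henstock_Kurzweil_Integration.integral_reflect_real)
          then have "norm (integral {0..t} df - integral {0..y} df - (t - y) *\<^sub>R df t) \<le> e * (t - y)"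
            using scale[OF _ db(2)[of "t - y"]] y tN inc[of y t] 3 by auto
          moreover have "integral {0..y} df - integral {0..t} df - (y - t) *\<^sub>R df t =
             - (integral {0..t} df - integral {0..y} df - (t - y) *\<^sub>R df t)"
            by (simp add: algebra_simps)
          ultimately show ?thesis using 3 by (metis abs_minus_commute abs_of_pos diff_gt_0_iff_gt norm_minus_cancel real_norm_def)
        qed auto
      qed (use da db in auto)
    qed
  qed
qed

section \<open>Sobolev curves and their first two derivatives\<close>

lemma square_integrable_imp_absolutely_integrable:
  fixes g :: "real \<Rightarrow> 'a::euclidean_space"
  assumes "g measurable_on {0..1}" "(\<lambda>t. (norm (g t))^2) integrable_on {0..1}"
  shows "g absolutely_integrable_on {0..1}"
proof (rule measurable_bounded_by_integrable_imp_absolutely_integrable)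
  show "g \<in> borel_measurable (lebesgue_on {0..1})"
    using assms(1) by (simp add: measurable_on_iff_borel_measurable)
  show "(\<lambda>t. 1 + (norm (g t))^2) integrable_on {0..1}"
    using assms(2) by (intro integrable_add) auto
  show "norm (g t) \<le> 1 + (norm (g t))^2" for t
    using sum_squares_bound[of "norm (g t)" 1] zero_le_power2[of "norm (g t)"]
    by (smt (verit) mult_cancel_left1 norm_ge_zero one_power2)
qed auto

lemma has_vector_derivative_d1:
  assumes "(\<gamma> has_vector_derivative v) (at01 t)" "t \<in> {0..1}"
  shows "d1 \<gamma> t = v"
  unfolding d1_def using assms by (intro vector_derivative_within_closed_interval) auto

lemma has_vector_derivative_d2:
  assumes "(d1 \<gamma> has_vector_derivative v) (at01 t)" "t \<in> {0..1}"
  shows "d2 \<gamma> t = v"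
  unfolding d2_def using assms by (intro vector_derivative_within_closed_interval) auto

definition square_integrable :: "(real \<Rightarrow> 'a::euclidean_space) \<Rightarrow> bool" where
  "square_integrable g \<longleftrightarrow> g measurable_on {0..1} \<and> (\<lambda>t. (norm (g t))^2) integrable_on {0..1}"

lemma square_integrable_spike:
  fixes f g :: "real \<Rightarrow> 'a::euclidean_space"
  assumes "square_integrable f" "negligible N" "\<And>t. t \<in> {0..1} - N \<Longrightarrow> g t = f t"
  shows "square_integrable g"
proof -
  have "(\<lambda>t. if t \<in> {0..1} then f t else 0) measurable_on UNIV"
    using assms(1) unfolding square_integrable_def measurable_on_UNIV by blast
  then have "(\<lambda>t. if t \<in> {0..1} then g t else 0) measurable_on UNIV"
    by (rule measurable_on_spike[OF _ assms(2)]) (use assms(3) in auto)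
  moreover have "(\<lambda>t. (norm (g t))^2) integrable_on {0..1}"
    by (rule integrable_spike[OF _ assms(2), of "\<lambda>t. (norm (f t))^2"])
      (use assms in \<open>auto simp: square_integrable_def\<close>)
  ultimately show ?thesis unfolding square_integrable_def measurable_on_UNIV by blast
qed

text \<open>\<open>d2\<close> is a pointwise \<open>vector_derivative\<close>, arbitrary where
  \<open>d1\<close> fails to be differentiable. Off a null set it equals the L^2 density hidden in
  \<open>W22\<close>, so it may be treated as that density everywhere below.\<close>

lemma W22_derivatives:
  assumes "W22 \<gamma>"
  shows "\<And>t. t \<in> {0..1} \<Longrightarrow> (\<gamma> has_vector_derivative d1 \<gamma> t) (at01 t)"
    and "ac_primitive (d1 \<gamma>) (d2 \<gamma>)"
    and "square_integrable (d2 \<gamma>)"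
    and "\<exists>N. negligible N \<and> (\<forall>t\<in>{0..1} - N. (d1 \<gamma> has_vector_derivative d2 \<gamma> t) (at01 t))"
proof -
  obtain v g where g: "g measurable_on {0..1}" "(\<lambda>t. (norm (g t))^2) integrable_on {0..1}"
    and eq: "\<And>t. t \<in> {0..1} \<Longrightarrow> \<gamma> t = \<gamma> 0 + t *\<^sub>R v + integral {0..t} (\<lambda>s. integral {0..s} g)"
    using assms unfolding W22_def by blast
  have gi: "g absolutely_integrable_on {0..1}"
    by (rule square_integrable_imp_absolutely_integrable[OF g])
  then have gi': "g integrable_on {0..1}" by (auto simp: absolutely_integrable_on_def)
  define G where "G t = v + integral {0..t} g" for t
  have G: "ac_primitive G g" unfolding G_def by (rule ac_primitive_indefinite[OF gi])
  have der: "(\<gamma> has_vector_derivative G t) (at01 t)" if t: "t \<in> {0..1}" for t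
  proof -
    have "((\<lambda>u. integral {0..u} (\<lambda>s. integral {0..s} g)) has_vector_derivative integral {0..t} g)
       (at01 t)"
      by (intro integral_has_vector_derivative[OF _ t] indefinite_integral_continuous_1 gi')
    then have "((\<lambda>t. \<gamma> 0 + t *\<^sub>R v + integral {0..t} (\<lambda>s. integral {0..s} g)) has_vector_derivative G t)
       (at01 t)"
      by (auto intro!: derivative_eq_intros simp: G_def)
    then show ?thesis
      by (rule has_vector_derivative_transform[rotated 2]) (use t in \<open>auto intro: eq\<close>)
  qed
  have d1: "d1 \<gamma> t = G t" if "t \<in> {0..1}" for t
    by (rule has_vector_derivative_d1[OF der that]) (rule that)
  show "(\<gamma> has_vector_derivative d1 \<gamma> t) (at01 t)" if "t \<in> {0..1}" for t
    using der[OF that] d1[OF that] by simp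
  obtain N where N: "negligible N"
    "\<And>t. t \<in> {0..1} - N \<Longrightarrow> ((\<lambda>t. integral {0..t} g) has_vector_derivative g t) (at01 t)"
    using indefinite_integral_has_derivative_ae[OF gi'] by blast
  have der2: "(d1 \<gamma> has_vector_derivative g t) (at01 t)" if "t \<in> {0..1} - N" for t
  proof -
    have "((\<lambda>t. v + integral {0..t} g) has_vector_derivative g t) (at01 t)"
      using N(2)[OF that] by (auto intro!: derivative_eq_intros)
    then show ?thesis
      by (rule has_vector_derivative_transform[rotated 2]) (use that in \<open>auto simp: d1 G_def\<close>)
  qed
  have d2: "d2 \<gamma> t = g t" if "t \<in> {0..1} - N" for t
    using has_vector_derivative_d2[OF der2[OF that]] that by auto
  show "ac_primitive (d1 \<gamma>) (d2 \<gamma>)"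
    by (rule ac_primitive_cong[OF G N(1) d1 d2])
  show "square_integrable (d2 \<gamma>)"
    using g by (intro square_integrable_spike[OF _ N(1) d2]) (auto simp: square_integrable_def)
  show "\<exists>N. negligible N \<and> (\<forall>t\<in>{0..1} - N. (d1 \<gamma> has_vector_derivative d2 \<gamma> t) (at01 t))"
    using N(1) der2 d2 by metis
qed

lemma W22_of_ac_primitive:
  assumes "\<And>t. t \<in> {0..1} \<Longrightarrow> (\<gamma> has_vector_derivative p t) (at01 t)"
    and "ac_primitive p a" "square_integrable a"
  shows "W22 \<gamma>"
  unfolding W22_def
proof (intro exI[of _ "p 0"] exI[of _ a] conjI ballI)
  fix t :: real assume t: "t \<in> {0..1}"
  have "ac_primitive \<gamma> p"
    by (rule ac_primitive_of_derivative[OF assms(1) ac_primitive_continuous[OF assms(2)]])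
  then have "\<gamma> t - \<gamma> 0 = integral {0..t} p" using t by (auto simp: ac_primitive_def)
  also have "\<dots> = integral {0..t} (\<lambda>s. p 0 + integral {0..s} a)"
    by (rule hk_integral_cong)
      (use assms(2) t in \<open>auto simp: ac_primitive_def\<close>)
  also have "\<dots> = integral {0..t} (\<lambda>s. p 0) + integral {0..t} (\<lambda>s. integral {0..s} a)"
  proof (intro integral_add)
    have "a integrable_on {0..t}"
      using ac_primitive_integrable[OF assms(2), of 0 t] t by (auto simp: absolutely_integrable_on_def)
    then show "(\<lambda>s. integral {0..s} a) integrable_on {0..t}"
      using integrable_continuous_real indefinite_integral_continuous_1 by blast
  qed auto
  also have "integral {0..t} (\<lambda>s. p 0) = t *\<^sub>R p 0"
    using t by simp
  finally show "\<gamma> t = \<gamma> 0 + t *\<^sub>R p 0 + integral {0..t} (\<lambda>s. integral {0..s} a)"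
    by (simp add: algebra_simps)
qed (use assms(3) in \<open>auto simp: square_integrable_def\<close>)

section \<open>The first variation\<close>

lemma square_integrable_iff:
  "square_integrable g \<longleftrightarrow> g \<in> borel_measurable (lebesgue_on {0..1}) \<and>
     (\<lambda>t. (norm (g t))^2) integrable_on {0..1}"
  by (simp add: square_integrable_def measurable_on_iff_borel_measurable)

lemma square_integrable_dominated:
  fixes f :: "real \<Rightarrow> 'a::euclidean_space"
  assumes "f \<in> borel_measurable (lebesgue_on {0..1})" "h integrable_on {0..1}"
    and "\<And>t. t \<in> {0..1} \<Longrightarrow> (norm (f t))^2 \<le> h t"
  shows "square_integrable f"
proof -
  have "(\<lambda>t. (norm (f t))^2) absolutely_integrable_on {0..1}"
    by (rule measurable_bounded_by_integrable_imp_absolutely_integrable[OF _ _ assms(2)])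
      (use assms in \<open>auto intro!: borel_measurable_power borel_measurable_norm\<close>)
  then show ?thesis using assms(1) by (simp add: square_integrable_iff absolutely_integrable_on_def)
qed

lemma square_integrable_imp_abs:
  "square_integrable g \<Longrightarrow> g absolutely_integrable_on {0..1}"
  by (simp add: square_integrable_def square_integrable_imp_absolutely_integrable)

lemma square_integrable_mult:
  fixes f g :: "real \<Rightarrow> real"
  assumes "square_integrable f" "square_integrable g"
  shows "(\<lambda>t. f t * g t) absolutely_integrable_on {0..1}"
proof (rule measurable_bounded_by_integrable_imp_absolutely_integrable)
  show "(\<lambda>t. (norm (f t))^2 + (norm (g t))^2) integrable_on {0..1}"
    using assms by (intro integrable_add) (auto simp: square_integrable_def)
  show "norm (f t * g t) \<le> (norm (f t))^2 + (norm (g t))^2" for t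
  proof -
    have "2 * \<bar>f t\<bar> * \<bar>g t\<bar> \<le> \<bar>f t\<bar>^2 + \<bar>g t\<bar>^2" by (rule sum_squares_bound)
    moreover have "0 \<le> \<bar>f t\<bar> * \<bar>g t\<bar>" by simp
    ultimately show ?thesis unfolding real_norm_def abs_mult by linarith
  qed
qed (use assms in \<open>auto simp: square_integrable_iff\<close>)

lemma square_integrable_continuous:
  fixes f :: "real \<Rightarrow> 'a::euclidean_space"
  assumes "continuous_on {0..1} f"
  shows "square_integrable f"
  unfolding square_integrable_iff using assms
  by (auto intro!: continuous_imp_measurable_on_sets_lebesgue integrable_continuous_real continuous_intros)

lemma square_integrable_continuous_mult:
  fixes f g :: "real \<Rightarrow> real"
  assumes "continuous_on {0..1} f" "square_integrable g"
  shows "square_integrable (\<lambda>t. f t * g t)"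
proof -
  have "bounded (f ` {0..1})"
    using assms(1) compact_continuous_image compact_imp_bounded by blast
  then obtain C where C: "\<And>t. t \<in> {0..1} \<Longrightarrow> \<bar>f t\<bar> \<le> C"
    unfolding bounded_iff real_norm_def by (metis imageI)
  show ?thesis
  proof (rule square_integrable_dominated)
    show "(\<lambda>t. f t * g t) \<in> borel_measurable (lebesgue_on {0..1})"
      using assms continuous_imp_measurable_on_sets_lebesgue[OF assms(1)]
      by (auto simp: square_integrable_iff intro!: borel_measurable_times)
    show "(\<lambda>t. C^2 * (norm (g t))^2) integrable_on {0..1}"
      using assms(2) by (auto simp: square_integrable_iff intro!: integrable_on_mult_right)
    show "(norm (f t * g t))^2 \<le> C^2 * (norm (g t))^2" if "t \<in> {0..1}" for t
    proof -
      have "(f t)^2 \<le> C^2" using C[OF that] by (simp add: abs_le_square_iff[symmetric])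
      then show ?thesis by (simp add: power_mult_distrib abs_mult mult_right_mono)
    qed
  qed
qed

lemma square_integrable_add:
  fixes f g :: "real \<Rightarrow> 'a::euclidean_space"
  assumes "square_integrable f" "square_integrable g"
  shows "square_integrable (\<lambda>t. f t + g t)"
proof (rule square_integrable_dominated)
  show "(\<lambda>t. 2 * (norm (f t))^2 + 2 * (norm (g t))^2) integrable_on {0..1}"
    using assms by (intro integrable_add integrable_on_mult_right) (auto simp: square_integrable_iff)
  show "(norm (f t + g t))^2 \<le> 2 * (norm (f t))^2 + 2 * (norm (g t))^2" for t
  proof -
    have "(norm (f t + g t))^2 \<le> (norm (f t) + norm (g t))^2"
      by (intro power_mono norm_triangle_ineq) auto
    then show ?thesis using sum_squares_bound[of "norm (f t)" "norm (g t)"]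
      by (simp add: power2_sum)
  qed
qed (use assms in \<open>auto simp: square_integrable_iff\<close>)

lemma square_integrable_linear:
  fixes f :: "real \<Rightarrow> 'a::euclidean_space" and h :: "'a \<Rightarrow> 'b::euclidean_space"
  assumes "square_integrable f" "bounded_linear h"
  shows "square_integrable (\<lambda>t. h (f t))"
proof -
  obtain K where K: "\<And>x. norm (h x) \<le> norm x * K"
    using bounded_linear.bounded[OF assms(2)] by blast
  show ?thesis
  proof (rule square_integrable_dominated)
    have "h \<in> borel_measurable borel"
      using assms(2) by (intro borel_measurable_continuous_onI linear_continuous_on)
    then show "(\<lambda>t. h (f t)) \<in> borel_measurable (lebesgue_on {0..1})"
      using assms(1) by (auto simp: square_integrable_iff intro: measurable_compose)
    show "(\<lambda>t. K^2 * (norm (f t))^2) integrable_on {0..1}"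
      using assms(1) by (auto simp: square_integrable_iff intro!: integrable_on_mult_right)
    show "(norm (h (f t)))^2 \<le> K^2 * (norm (f t))^2" for t
      using power_mono[OF K[of "f t"], of 2] by (simp add: power_mult_distrib mult.commute)
  qed
qed

lemmas square_integrable_fst = square_integrable_linear[OF _ bounded_linear_fst]
lemmas square_integrable_snd = square_integrable_linear[OF _ bounded_linear_snd]
lemmas square_integrable_cmult = square_integrable_linear[OF _ bounded_linear_mult_right]

lemma square_integrable_diff:
  fixes f g :: "real \<Rightarrow> 'a::euclidean_space"
  assumes "square_integrable f" "square_integrable g"
  shows "square_integrable (\<lambda>t. f t - g t)"
  using square_integrable_add[OF assms(1) square_integrable_linear[OF assms(2) bounded_linear_minus[OF bounded_linear_ident]]]
  by simp

text \<open>The weight \<open>D\<close> is merely integrable, since it will be quadratic in second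
  derivatives. All dependence on the parameter sits in the continuous factor, whose derivative is
  uniformly continuous on the compact rectangle; the error is then at most a small multiple of the
  L^1 norm of \<open>D\<close>.\<close>

lemma leibniz_rule_weighted:
  fixes D :: "real \<Rightarrow> real" and \<rho> \<rho>' :: "real \<Rightarrow> real \<Rightarrow> real"
  assumes D: "D absolutely_integrable_on {0..1}" and e0: "e0 > 0"
    and der: "\<And>x t. \<lbrakk>x \<in> {-e0..e0}; t \<in> {0..1}\<rbrakk> \<Longrightarrow> ((\<lambda>x. \<rho> x t) has_real_derivative \<rho>' x t) (at x)"
    and cont': "continuous_on ({-e0..e0} \<times> {0..1}) (\<lambda>(x,t). \<rho>' x t)"
    and cont: "\<And>x. x \<in> {-e0..e0} \<Longrightarrow> continuous_on {0..1} (\<rho> x)"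
  shows "((\<lambda>x. integral {0..1} (\<lambda>t. \<rho> x t * D t)) has_real_derivative
      integral {0..1} (\<lambda>t. \<rho>' 0 t * D t)) (at 0)"
  unfolding has_field_derivative_def has_derivative_at_alt
proof (intro conjI allI impI)
  fix e :: real assume e: "0 < e"
  \<comment> \<open>The summand 1 keeps \<open>A\<close> positive when \<open>D\<close> vanishes
    almost everywhere.\<close>
  define A where "A = 1 + integral {0..1} (\<lambda>t. \<bar>D t\<bar>)"
  have Dabs: "(\<lambda>t. \<bar>D t\<bar>) integrable_on {0..1}"
    using D by (auto simp: absolutely_integrable_on_def)
  have A: "A > 0" "integral {0..1} (\<lambda>t. \<bar>D t\<bar>) \<le> A"
    unfolding A_def using Henstock_Kurzweil_Integration.integral_nonneg[OF Dabs] by auto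
  have "uniformly_continuous_on ({-e0..e0} \<times> {0..1}) (\<lambda>(x,t). \<rho>' x t)"
    by (intro compact_uniformly_continuous cont' compact_Times) auto
  then obtain d where d: "d > 0" and du: "\<And>z w. \<lbrakk>z \<in> {-e0..e0} \<times> {0..1}; w \<in> {-e0..e0} \<times> {0..1}; dist w z < d\<rbrakk> \<Longrightarrow>
      dist ((\<lambda>(x,t). \<rho>' x t) w) ((\<lambda>(x,t). \<rho>' x t) z) < e / A"
    by (rule uniformly_continuous_onE[OF _ divide_pos_pos[OF e A(1)]]) auto
  have dd: "dist (\<rho>' x t) (\<rho>' 0 t) < e / A" if "x \<in> {-e0..e0}" "t \<in> {0..1}" "\<bar>x\<bar> < d" for x t
    using du[of "(0,t)" "(x,t)"] that e0 by (simp add: dist_Pair_Pair dist_real_def)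
  have c0': "continuous_on {0..1} (\<rho>' 0)"
  proof -
    have "continuous_on {0..1} (\<lambda>t. (\<lambda>(x,t). \<rho>' x t) (0, t))"
      by (rule continuous_on_compose2[OF cont' continuous_on_Pair[OF continuous_on_const continuous_on_id]])
        (use e0 in auto)
    then show ?thesis by simp
  qed
  have int: "(\<lambda>t. \<rho> x t * D t) integrable_on {0..1}" if "x \<in> {-e0..e0}" for x
    using integrable_continuous_times[OF cont[OF that] D] by (auto simp: absolutely_integrable_on_def)
  have int': "(\<lambda>t. \<rho>' 0 t * D t) integrable_on {0..1}"
    using integrable_continuous_times[OF c0' D] by (auto simp: absolutely_integrable_on_def)
  show "\<exists>d>0. \<forall>y. norm (y - 0) < d \<longrightarrow>
      norm (integral {0..1} (\<lambda>t. \<rho> y t * D t) - integral {0..1} (\<lambda>t. \<rho> 0 t * D t) -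
        integral {0..1} (\<lambda>t. \<rho>' 0 t * D t) * (y - 0)) \<le> e * norm (y - 0)"
  proof (intro exI[of _ "min d e0"] conjI allI impI)
    fix h :: real assume h: "norm (h - 0) < min d e0"
    then have hin: "h \<in> {-e0..e0}" by auto
    have z: "0 \<in> {-e0..e0}" using e0 by auto
    have est: "\<bar>\<rho> h t - \<rho> 0 t - h * \<rho>' 0 t\<bar> \<le> e / A * \<bar>h\<bar>" if t: "t \<in> {0..1}" for t
    proof -
      have "norm ((\<rho> h t - \<rho>' 0 t * h) - (\<rho> 0 t - \<rho>' 0 t * 0)) \<le> e / A * norm (h - 0)"
      proof (rule field_differentiable_bound[where S = "closed_segment 0 h"])
        fix x assume "x \<in> closed_segment 0 h"
        then have x: "x \<in> {-e0..e0}" "\<bar>x\<bar> < d" using h by (auto simp: closed_segment_eq_real_ivl split: if_splits)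
        show "((\<lambda>x. \<rho> x t - \<rho>' 0 t * x) has_field_derivative (\<rho>' x t - \<rho>' 0 t)) (at x within closed_segment 0 h)"
          by (auto intro!: derivative_eq_intros has_field_derivative_at_within[OF der[OF x(1) t]])
        show "norm (\<rho>' x t - \<rho>' 0 t) \<le> e / A"
          using dd[OF x(1) t x(2)] by (simp add: dist_real_def)
      qed auto
      then show ?thesis by (simp add: algebra_simps)
    qed
    have "integral {0..1} (\<lambda>t. \<rho> h t * D t) - integral {0..1} (\<lambda>t. \<rho> 0 t * D t) -
        integral {0..1} (\<lambda>t. \<rho>' 0 t * D t) * (h - 0) =
        integral {0..1} (\<lambda>t. \<rho> h t * D t - \<rho> 0 t * D t - \<rho>' 0 t * D t * h)"
      using int[OF hin] int[OF z] int'
      by (simp add: integral_diff integrable_diff integrable_on_mult_left)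
    also have "\<bar>\<dots>\<bar> \<le> integral {0..1} (\<lambda>t. e / A * \<bar>h\<bar> * \<bar>D t\<bar>)"
      unfolding real_norm_def[symmetric]
    proof (rule integral_norm_bound_integral)
      fix t :: real assume t: "t \<in> {0..1}"
      have "\<rho> h t * D t - \<rho> 0 t * D t - \<rho>' 0 t * D t * h = (\<rho> h t - \<rho> 0 t - h * \<rho>' 0 t) * D t"
        by (simp add: algebra_simps)
      then show "norm (\<rho> h t * D t - \<rho> 0 t * D t - \<rho>' 0 t * D t * h) \<le> e / A * norm h * norm (D t)"
        using mult_right_mono[OF est[OF t] abs_ge_zero[of "D t"]] by (simp add: abs_mult)
    qed (intro integrable_diff integrable_on_mult_right integrable_on_mult_left int[OF hin] int[OF z] int'
        Dabs[folded real_norm_def])+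
    also have "\<dots> = e * \<bar>h\<bar> * (integral {0..1} (\<lambda>t. \<bar>D t\<bar>) / A)" by simp
    also have "\<dots> \<le> e * \<bar>h\<bar> * 1" using A e by (intro mult_left_mono) auto
    finally show "norm (integral {0..1} (\<lambda>t. \<rho> h t * D t) - integral {0..1} (\<lambda>t. \<rho> 0 t * D t) -
        integral {0..1} (\<lambda>t. \<rho>' 0 t * D t) * (h - 0)) \<le> e * norm (h - 0)" by simp
  qed (use d e0 in auto)
qed (rule bounded_linear_mult_right)

section \<open>Variation of the bending energy and of the length\<close>

lemma cross2_affine:
  "cross2 (p + x *\<^sub>R u) (a + x *\<^sub>R b) = cross2 p a + x * (cross2 u a + cross2 p b) + x^2 * cross2 u b"
  by (simp add: cross2_def algebra_simps power2_eq_square)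

lemma square_integrable_cross2:
  assumes "continuous_on {0..1} p" "square_integrable a"
  shows "square_integrable (\<lambda>t. cross2 (p t) (a t))"
  unfolding cross2_def using assms
  by (intro square_integrable_diff square_integrable_continuous_mult square_integrable_fst
      square_integrable_snd continuous_intros)

text \<open>\<open>varM\<close> and \<open>varR\<close> are the gradients of the energy density with
  respect to the second and the first derivative of the curve: the moment and the (unintegrated)
  force of the variational problem.\<close>

definition varM :: "(real \<Rightarrow> real \<times> real) \<Rightarrow> real \<Rightarrow> real \<times> real" where
  "varM \<gamma> t = (2 * cross2 (d1 \<gamma> t) (d2 \<gamma> t) / norm (d1 \<gamma> t) ^ 5) *\<^sub>R (- snd (d1 \<gamma> t), fst (d1 \<gamma> t))"

definition varR :: "real \<Rightarrow> (real \<Rightarrow> real \<times> real) \<Rightarrow> real \<Rightarrow> real \<times> real" where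
  "varR lam \<gamma> t = (2 * cross2 (d1 \<gamma> t) (d2 \<gamma> t) / norm (d1 \<gamma> t) ^ 5) *\<^sub>R (snd (d2 \<gamma> t), - fst (d2 \<gamma> t))
     + (lam / norm (d1 \<gamma> t) - 5 * (cross2 (d1 \<gamma> t) (d2 \<gamma> t))^2 / norm (d1 \<gamma> t) ^ 7) *\<^sub>R d1 \<gamma> t"

text \<open>Along \<open>\<gamma> + x *\<^sub>R \<eta>\<close> the squared cross product is a
  polynomial of degree four in x with integrable coefficients, while the power of the speed is
  smooth in x. So the bending energy is a sum of x^i times integrals covered by
  \<open>leibniz_rule_weighted\<close>; at x = 0 only the derivative of the term i = 0 and the value
  of the term i = 1 survive.\<close>

lemma first_variation:
  assumes \<gamma>: "W22 \<gamma>" and nz: "\<And>t. t \<in> {0..1} \<Longrightarrow> d1 \<gamma> t \<noteq> 0" and \<eta>: "W22 \<eta>"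
  shows "((\<lambda>\<epsilon>. energy lam (\<lambda>t. \<gamma> t + \<epsilon> *\<^sub>R \<eta> t)) has_real_derivative
     integral {0..1} (\<lambda>t. varM \<gamma> t \<bullet> d2 \<eta> t + varR lam \<gamma> t \<bullet> d1 \<eta> t)) (at 0)"
proof -
  let ?g = "\<lambda>x. (\<lambda>t. \<gamma> t + x *\<^sub>R \<eta> t)"
  define p a u b where "p = d1 \<gamma>" and "a = d2 \<gamma>" and "u = d1 \<eta>" and "b = d2 \<eta>"
  note g = W22_derivatives[OF \<gamma>, folded p_def a_def]
  note h = W22_derivatives[OF \<eta>, folded u_def b_def]
  have cp: "continuous_on {0..1} p" and cu: "continuous_on {0..1} u"
    using ac_primitive_continuous g(2) h(2) by auto
  obtain N1 where N1: "negligible N1"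
    "\<And>t. t \<in> {0..1} - N1 \<Longrightarrow> (p has_vector_derivative a t) (at01 t)" using g(4) by blast
  obtain N2 where N2: "negligible N2"
    "\<And>t. t \<in> {0..1} - N2 \<Longrightarrow> (u has_vector_derivative b t) (at01 t)" using h(4) by blast
  have e1: "d1 (?g x) t = p t + x *\<^sub>R u t" if "t \<in> {0..1}" for x t
    using that by (intro has_vector_derivative_d1)
      (auto intro!: derivative_eq_intros g(1) h(1))
  have e2: "d2 (?g x) t = a t + x *\<^sub>R b t" if "t \<in> {0..1} - (N1 \<union> N2)" for x t
  proof (rule has_vector_derivative_d2)
    have "((\<lambda>t. p t + x *\<^sub>R u t) has_vector_derivative (a t + x *\<^sub>R b t)) (at01 t)"
      using that by (auto intro!: derivative_eq_intros N1 N2)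
    then show "(d1 (?g x) has_vector_derivative (a t + x *\<^sub>R b t)) (at01 t)"
      by (rule has_vector_derivative_transform[rotated 2]) (use that in \<open>auto intro: e1\<close>)
  qed (use that in auto)

  define r where "r x t = norm (p t + x *\<^sub>R u t)" for x t
  obtain m where m: "m > 0" "\<And>t. t \<in> {0..1} \<Longrightarrow> m \<le> norm (p t)"
  proof -
    have "\<exists>s\<in>{0..1}. \<forall>t\<in>{0..1}. norm (p s) \<le> norm (p t)"
      by (rule continuous_attains_inf) (auto intro: continuous_intros cp)
    then obtain s where "s \<in> {0..1}" "\<And>t. t \<in> {0..1} \<Longrightarrow> norm (p s) \<le> norm (p t)" by blast
    then show thesis using nz[of s] by (intro that[of "norm (p s)"]) (auto simp: p_def)
  qed
  obtain B where B: "B > 0" "\<And>t. t \<in> {0..1} \<Longrightarrow> norm (u t) \<le> B"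
  proof -
    have "bounded (u ` {0..1})"
      using cu compact_continuous_image compact_imp_bounded by blast
    then show thesis using that by (auto simp: bounded_pos)
  qed
  \<comment> \<open>With this bound on the parameter the varied speed stays above m/2, so every
    varied curve remains regular.\<close>
  define e0 where "e0 = m / (2 * B)"
  have e0: "e0 > 0" using m B by (simp add: e0_def)
  have rpos: "r x t > 0" if "x \<in> {-e0..e0}" "t \<in> {0..1}" for x t
  proof -
    have "\<bar>x\<bar> * norm (u t) \<le> e0 * B" using that B by (intro mult_mono) auto
    then have "norm (x *\<^sub>R u t) \<le> m / 2" using B by (simp add: e0_def)
    moreover have "norm (p t) \<le> norm (p t + x *\<^sub>R u t) + norm (x *\<^sub>R u t)"
      using norm_triangle_ineq4[of "p t + x *\<^sub>R u t" "x *\<^sub>R u t"] by simp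
    ultimately show ?thesis using m(1) m(2)[OF that(2)] unfolding r_def by linarith
  qed
  have der_r: "((\<lambda>x. r x t) has_real_derivative ((p t + x *\<^sub>R u t) \<bullet> u t) / r x t) (at x)"
    if "x \<in> {-e0..e0}" "t \<in> {0..1}" for x t
  proof -
    have eq: "r y t = sqrt (p t \<bullet> p t + 2 * y * (p t \<bullet> u t) + y^2 * (u t \<bullet> u t))" for y
      unfolding r_def norm_eq_sqrt_inner
      by (simp add: inner_add_left inner_add_right inner_commute power2_eq_square algebra_simps)
    have pos: "p t \<bullet> p t + 2 * x * (p t \<bullet> u t) + x^2 * (u t \<bullet> u t) > 0"
      using rpos[OF that] unfolding eq by simp
    have "((\<lambda>y. p t \<bullet> p t + 2 * y * (p t \<bullet> u t) + y^2 * (u t \<bullet> u t)) has_real_derivative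
        2 * (p t \<bullet> u t) + 2 * x * (u t \<bullet> u t)) (at x)"
      by (auto intro!: derivative_eq_intros)
    from DERIV_chain2[OF DERIV_real_sqrt[OF pos] this] show ?thesis unfolding eq
      by (rule DERIV_cong) (use pos in \<open>simp add: field_simps inner_add_left inner_add_right inner_commute\<close>)
  qed
  have cr: "continuous_on ({-e0..e0} \<times> {0..1}) (\<lambda>z. r (fst z) (snd z))"
    unfolding r_def
    by (intro continuous_intros continuous_on_compose2[OF cp] continuous_on_compose2[OF cu]) auto
  have cq: "continuous_on ({-e0..e0} \<times> {0..1}) (\<lambda>z. (p (snd z) + fst z *\<^sub>R u (snd z)) \<bullet> u (snd z))"
    by (intro continuous_intros continuous_on_compose2[OF cp] continuous_on_compose2[OF cu]) auto
  have crx: "continuous_on {0..1} (r x)" for x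
    unfolding r_def by (intro continuous_intros cp cu)
  have rnz: "r x t \<noteq> 0" if "x \<in> {-e0..e0}" "t \<in> {0..1}" for x t
    using rpos[OF that] by simp
  define \<rho> where "\<rho> x t = 1 / r x t ^ 5" for x t
  define \<rho>' where "\<rho>' x t = - 5 * ((p t + x *\<^sub>R u t) \<bullet> u t) / r x t ^ 7" for x t
  have der_\<rho>: "((\<lambda>x. \<rho> x t) has_real_derivative \<rho>' x t) (at x)"
    if "x \<in> {-e0..e0}" "t \<in> {0..1}" for x t
    unfolding \<rho>_def \<rho>'_def using rnz[OF that]
    by (auto intro!: derivative_eq_intros der_r[OF that] simp: field_simps eval_nat_numeral)
  have c\<rho>': "continuous_on ({-e0..e0} \<times> {0..1}) (\<lambda>(x,t). \<rho>' x t)"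
    unfolding \<rho>'_def case_prod_beta using rnz by (intro continuous_intros cr cq) auto
  have c\<rho>: "continuous_on {0..1} (\<rho> x)" if "x \<in> {-e0..e0}" for x
    unfolding \<rho>_def using rnz[OF that] by (intro continuous_intros crx) auto

  define C0 C1 C2 where "C0 t = cross2 (p t) (a t)" and "C1 t = cross2 (u t) (a t) + cross2 (p t) (b t)"
    and "C2 t = cross2 (u t) (b t)" for t
  have sqC: "square_integrable C0" "square_integrable C1" "square_integrable C2"
    unfolding C0_def C1_def C2_def
    by (intro square_integrable_add square_integrable_cross2 cp cu g(3) h(3))+
  \<comment> \<open>Coefficients of the square of \<open>C0 + x * C1 + x^2 * C2\<close>; each is a
    sum of products of two L^2 functions.\<close>
  define D where "D = [\<lambda>t. C0 t * C0 t, \<lambda>t. (2 * C0 t) * C1 t, \<lambda>t. (2 * C0 t) * C2 t + C1 t * C1 t,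
     \<lambda>t. (2 * C1 t) * C2 t, \<lambda>t. C2 t * C2 t]"
  have Dint: "D ! i absolutely_integrable_on {0..1}" if "i < 5" for i
  proof -
    have "list_all (\<lambda>f. f absolutely_integrable_on {0..1}) D"
      unfolding D_def by (auto intro!: square_integrable_mult square_integrable_cmult sqC set_integral_add(1))
    then show ?thesis using that by (simp add: list_all_length D_def)
  qed
  define I where "I i x = integral {0..1} (\<lambda>t. \<rho> x t * (D ! i) t)" for i x
  have derI: "(I i has_real_derivative integral {0..1} (\<lambda>t. \<rho>' 0 t * (D ! i) t)) (at 0)" if "i < 5" for i
    unfolding I_def by (rule leibniz_rule_weighted[OF Dint[OF that] e0 der_\<rho> c\<rho>' c\<rho>])
  have intI: "(\<lambda>t. \<rho> x t * (D ! i) t) integrable_on {0..1}" if "i < 5" "x \<in> {-e0..e0}" for i x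
    using integrable_continuous_times[OF c\<rho>[OF that(2)] Dint[OF that(1)]]
    by (auto simp: absolutely_integrable_on_def)
  let ?P = "\<lambda>x. I 0 x + x * I 1 x + x^2 * I 2 x + x^3 * I 3 x + x^4 * I 4 x"
  have bend: "bending (?g x) = ?P x"
    if x: "x \<in> {-e0..e0}" for x
  proof -
    let ?p = "\<lambda>t. \<rho> x t * (D ! 0) t + x * (\<rho> x t * (D ! 1) t) + x^2 * (\<rho> x t * (D ! 2) t)
        + x^3 * (\<rho> x t * (D ! 3) t) + x^4 * (\<rho> x t * (D ! 4) t)"
    have "bending (?g x) = integral {0..1}
      (\<lambda>t. ?p t)"
      unfolding bending_def
    proof (rule integral_spike[OF negligible_Un[OF N1(1) N2(1)]])
      fix t assume t: "t \<in> {0..1} - (N1 \<union> N2)"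
      then have "t \<in> {0..1}" by auto
      show "?p t =
        (cross2 (d1 (?g x) t) (d2 (?g x) t))^2 /
          norm (d1 (?g x) t) ^ 5"
        unfolding e1[OF \<open>t \<in> {0..1}\<close>] e2[OF t] cross2_affine r_def[symmetric]
          C0_def[symmetric] C1_def[symmetric] C2_def[symmetric]
        using rnz[OF x \<open>t \<in> {0..1}\<close>]
        by (simp add: D_def \<rho>_def field_simps power2_eq_square eval_nat_numeral)
    qed
    also have "\<dots> = ?P x"
      unfolding I_def using intI[OF _ x]
      by (simp add: integral_add integrable_add integrable_on_mult_right del: One_nat_def)
    finally show ?thesis .
  qed
  have "((\<lambda>x. ?P x) has_real_derivative
     integral {0..1} (\<lambda>t. \<rho>' 0 t * (D ! 0) t) + I 1 0) (at 0)"
    by (auto intro!: derivative_eq_intros derI)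
  then have dbend: "((\<lambda>x. bending (?g x)) has_real_derivative
     integral {0..1} (\<lambda>t. \<rho>' 0 t * (D ! 0) t) + I 1 0) (at 0)"
    by (rule has_field_derivative_transform_within[OF _ e0]) (auto simp: dist_real_def intro!: bend[symmetric] simp del: One_nat_def)
  have one: "(\<lambda>t. 1::real) absolutely_integrable_on {0..1::real}"
    by (intro absolutely_integrable_continuous_real continuous_intros)
  have cq': "continuous_on ({-e0..e0} \<times> {0..1}) (\<lambda>(x,t). ((p t + x *\<^sub>R u t) \<bullet> u t) / r x t)"
    unfolding case_prod_beta using rnz by (intro continuous_intros cr cq) auto
  have "((\<lambda>x. integral {0..1} (\<lambda>t. r x t * 1)) has_real_derivative
     integral {0..1} (\<lambda>t. ((p t + 0 *\<^sub>R u t) \<bullet> u t) / r 0 t * 1)) (at 0)"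
    by (rule leibniz_rule_weighted[OF one e0 der_r cq' crx])
  moreover have "curve_length (?g x) = integral {0..1} (\<lambda>t. r x t * 1)" for x
    unfolding curve_length_def
    by (rule hk_integral_cong) (simp add: e1 r_def)
  ultimately have dlen: "((\<lambda>x. curve_length (?g x)) has_real_derivative
     integral {0..1} (\<lambda>t. (p t \<bullet> u t) / r 0 t)) (at 0)" by simp
  have z: "0 \<in> {-e0..e0}" using e0 by auto
  have i1: "(\<lambda>t. \<rho>' 0 t * (D ! 0) t) integrable_on {0..1}"
  proof -
    have "continuous_on {0..1} (\<rho>' 0)"
      unfolding \<rho>'_def using rnz[OF z] by (intro continuous_intros crx cp cu) auto
    then show ?thesis
      using integrable_continuous_times[OF _ Dint[of 0]] by (auto simp: absolutely_integrable_on_def)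
  qed
  have i2: "(\<lambda>t. (p t \<bullet> u t) / r 0 t) integrable_on {0..1}"
    using rnz[OF z] by (intro integrable_continuous_real continuous_intros crx cp cu) auto
  have "((\<lambda>\<epsilon>. energy lam (\<lambda>t. \<gamma> t + \<epsilon> *\<^sub>R \<eta> t)) has_real_derivative
     integral {0..1} (\<lambda>t. \<rho>' 0 t * (D ! 0) t) + I 1 0 + lam * integral {0..1} (\<lambda>t. (p t \<bullet> u t) / r 0 t)) (at 0)"
    unfolding energy_def by (auto intro!: derivative_eq_intros dbend dlen)
  moreover have "integral {0..1} (\<lambda>t. \<rho>' 0 t * (D ! 0) t) + I 1 0 + lam * integral {0..1} (\<lambda>t. (p t \<bullet> u t) / r 0 t)
    = integral {0..1} (\<lambda>t. \<rho>' 0 t * (D ! 0) t + \<rho> 0 t * (D ! 1) t + lam * ((p t \<bullet> u t) / r 0 t))"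
    unfolding I_def using i1 i2 intI[OF _ z, of 1]
    by (simp add: integral_add integrable_add integrable_on_mult_right del: One_nat_def times_divide_eq_right)
  moreover have "\<dots> = integral {0..1} (\<lambda>t. varM \<gamma> t \<bullet> b t + varR lam \<gamma> t \<bullet> u t)"
  proof (rule hk_integral_cong)
    fix t :: real assume t: "t \<in> {0..1}"
    obtain p1 p2 where pe: "p t = (p1, p2)" by force
    obtain a1 a2 where ae: "a t = (a1, a2)" by force
    obtain u1 u2 where ue: "u t = (u1, u2)" by force
    obtain b1 b2 where be: "b t = (b1, b2)" by force
    have n: "r 0 t \<noteq> 0" "norm (p1, p2) = r 0 t" using rnz[OF z t] by (auto simp: r_def pe)
    show "\<rho>' 0 t * (D ! 0) t + \<rho> 0 t * (D ! 1) t + lam * ((p t \<bullet> u t) / r 0 t) =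
      varM \<gamma> t \<bullet> b t + varR lam \<gamma> t \<bullet> u t"
      unfolding varM_def varR_def p_def[symmetric] a_def[symmetric] \<rho>_def \<rho>'_def D_def C0_def C1_def pe ae ue be n(2)
      by (simp add: pe ae ue be cross2_def inner_prod_def divide_inverse power2_eq_square algebra_simps)
  qed
  ultimately show ?thesis by (simp add: u_def b_def)
qed

section \<open>The first integral of a pinned elastica\<close>

lemma ac_primitive_Pair:
  assumes "ac_primitive f df" "ac_primitive g dg"
  shows "ac_primitive (\<lambda>t. (f t, g t)) (\<lambda>t. (df t, dg t))"
proof -
  have "ac_primitive (\<lambda>t. (f t, 0) + (0, g t)) (\<lambda>t. (df t, 0) + (0, dg t))"
    by (intro ac_primitive_add ac_primitive_linear[OF assms(1), where h = "\<lambda>x. (x, 0)"]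
        ac_primitive_linear[OF assms(2), where h = "\<lambda>x. (0, x)"] bounded_linear_Pair
        bounded_linear_ident bounded_linear_zero)
  then show ?thesis by simp
qed

lemma square_integrable_Pair:
  assumes "square_integrable f" "square_integrable g"
  shows "square_integrable (\<lambda>t. (f t, g t))"
proof -
  have "square_integrable (\<lambda>t. (f t, 0) + (0, g t))"
    by (intro square_integrable_add square_integrable_linear[OF assms(1), where h = "\<lambda>x. (x, 0)"]
        square_integrable_linear[OF assms(2), where h = "\<lambda>x. (0, x)"] bounded_linear_Pair
        bounded_linear_ident bounded_linear_zero)
  then show ?thesis by simp
qed

lemma ac_primitive_inner:
  fixes f g :: "real \<Rightarrow> real \<times> real"
  assumes "ac_primitive f df" "ac_primitive g dg"
  shows "ac_primitive (\<lambda>t. f t \<bullet> g t) (\<lambda>t. df t \<bullet> g t + f t \<bullet> dg t)"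
proof -
  have "ac_primitive (\<lambda>t. fst (f t) * fst (g t) + snd (f t) * snd (g t))
    (\<lambda>t. (fst (df t) * fst (g t) + fst (f t) * fst (dg t)) + (snd (df t) * snd (g t) + snd (f t) * snd (dg t)))"
    by (intro ac_primitive_add ac_primitive_mult ac_primitive_fst ac_primitive_snd assms)
  then show ?thesis
    by (rule ac_primitive_cong[OF _ negligible_empty]) (auto simp: inner_prod_def)
qed

lemma ac_primitive_ident: "ac_primitive (\<lambda>t. t) (\<lambda>t. 1)"
  by (auto simp: ac_primitive_def)

lemma ac_primitive_const: "ac_primitive (\<lambda>t. c) (\<lambda>t. 0)"
  by (auto simp: ac_primitive_def)

lemma ac_primitive_zero_ae:
  assumes "ac_primitive f df" "negligible N" "\<And>t. t \<in> {0..1} - N \<Longrightarrow> df t = 0" "t \<in> {0..1}"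
  shows "f t = f 0"
proof -
  have "integral {0..t} df = integral {0..t} (\<lambda>t. 0)"
    by (rule integral_spike[OF assms(2)]) (use assms(3,4) in auto)
  then show ?thesis using assms(1,4) by (simp add: ac_primitive_def)
qed

lemma vector_derivative_unique_01:
  fixes f :: "real \<Rightarrow> 'a::euclidean_space"
  assumes "(f has_vector_derivative a) (at01 t)" "(f has_vector_derivative b) (at01 t)"
    and "t \<in> {0..1}"
  shows "a = b"
  using vector_derivative_within_closed_interval[of 0 1 t f a] vector_derivative_within_closed_interval[of 0 1 t f b]
    assms by simp

lemma ac_primitive_of_zero:
  assumes "ac_primitive f df" "continuous_on {0..1} df" "\<And>t. t \<in> {0..1} \<Longrightarrow> f t = 0" "t \<in> {0..1}"
  shows "df t = 0"
proof -
  have "(f has_vector_derivative df t) (at01 t)"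
    by (rule ac_primitive_has_derivative[OF assms(1,2,4)])
  moreover have "(f has_vector_derivative 0) (at01 t)"
    by (rule has_vector_derivative_transform[OF assms(4) _ has_vector_derivative_const[of 0]])
      (use assms(3) in auto)
  ultimately show ?thesis
    using vector_derivative_unique_01 assms(4) by blast
qed

text \<open>The zero function is a primitive of \<open>f\<close>, because \<open>f\<close> vanishes
  almost everywhere; continuity of \<open>f\<close> makes it the classical derivative of that
  primitive.\<close>

lemma continuous_zero_ae:
  fixes f :: "real \<Rightarrow> 'a::euclidean_space"
  assumes "continuous_on {0..1} f" "negligible N" "\<And>t. t \<in> {0..1} - N \<Longrightarrow> f t = 0" "t \<in> {0..1}"
  shows "f t = 0"
proof -
  have "ac_primitive (\<lambda>t. 0) f"
    by (rule ac_primitive_cong[OF ac_primitive_const assms(2)]) (use assms(3) in auto)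
  then show ?thesis by (rule ac_primitive_of_zero[OF _ assms(1) _ assms(4)]) auto
qed

lemma d2_ae:
  assumes "\<And>t. t \<in> {0..1} \<Longrightarrow> (\<gamma> has_vector_derivative p t) (at01 t)"
    and "ac_primitive p a"
  obtains N where "negligible N" "\<And>t. t \<in> {0..1} - N \<Longrightarrow> d2 \<gamma> t = a t"
proof -
  have "a integrable_on {0..1}" using assms(2) by (auto simp: ac_primitive_def absolutely_integrable_on_def)
  from indefinite_integral_has_derivative_ae[OF this] obtain N where N: "negligible N"
    "\<And>t. t \<in> {0..1} - N \<Longrightarrow> ((\<lambda>t. integral {0..t} a) has_vector_derivative a t) (at01 t)"
    by blast
  show thesis
  proof (rule that[OF N(1)])
    fix t assume t: "t \<in> {0..1} - N"
    have "((\<lambda>t. p 0 + integral {0..t} a) has_vector_derivative a t) (at01 t)"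
      using N(2)[OF t] by (auto intro!: derivative_eq_intros)
    then have "(d1 \<gamma> has_vector_derivative a t) (at01 t)"
    proof (rule has_vector_derivative_transform[rotated 2])
      fix s :: real assume s: "s \<in> {0..1}"
      have "d1 \<gamma> s = p s" by (rule has_vector_derivative_d1[OF assms(1)[OF s] s])
      then show "d1 \<gamma> s = p 0 + integral {0..s} a" using assms(2) s by (simp add: ac_primitive_def)
    qed (use t in auto)
    then show "d2 \<gamma> t = a t" using t by (intro has_vector_derivative_d2) auto
  qed
qed

lemma zero_ae_of_integral_norm_zero:
  fixes b :: "real \<Rightarrow> 'a::euclidean_space"
  assumes "square_integrable b" "integral {0..1} (\<lambda>t. (norm (b t))^2) = 0"
  obtains N where "negligible N" "\<And>t. t \<in> {0..1} - N \<Longrightarrow> b t = 0"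
proof -
  let ?h = "(\<lambda>t. (norm (b t))^2)"
  have i: "?h integrable_on {0..1}"
    using assms(1) by (simp add: square_integrable_def)
  obtain N where N: "negligible N" "\<And>t. t \<in> {0..1} - N \<Longrightarrow>
      ((\<lambda>t. integral {0..t} ?h) has_vector_derivative (norm (b t))^2) (at01 t)"
    using indefinite_integral_has_derivative_ae[OF i] by blast
  have z: "integral {0..t} ?h = 0" if "t \<in> {0..1}" for t
  proof -
    have it: "?h integrable_on {0..t}"
      by (rule integrable_subinterval_real[OF i]) (use that in auto)
    have "integral {0..t} ?h \<le> integral {0..1} ?h"
      by (rule integral_subset_le[OF _ it i]) (use that in auto)
    moreover have "0 \<le> integral {0..t} ?h"
      by (rule Henstock_Kurzweil_Integration.integral_nonneg[OF it]) auto
    ultimately show ?thesis using assms(2) by simp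
  qed
  show thesis
  proof (rule that[OF N(1)])
    fix t assume t: "t \<in> {0..1} - N"
    have "((\<lambda>t. integral {0..t} ?h) has_vector_derivative 0) (at01 t)"
      by (rule has_vector_derivative_transform[OF _ _ has_vector_derivative_const[of 0]]) (use t z in auto)
    then have "(norm (b t))^2 = 0"
      using vector_derivative_unique_01[OF N(2)[OF t]] t by auto
    then show "b t = 0" by simp
  qed
qed

text \<open>The du Bois-Reymond lemma, tested with \<open>\<eta>'' = M - Rh + t *\<^sub>R F\<close> itself.\<close>

lemma du_bois_reymond:
  fixes M R :: "real \<Rightarrow> real \<times> real"
  assumes M: "square_integrable M" and R: "R absolutely_integrable_on {0..1}"
    and crit: "\<And>\<eta>. \<lbrakk>W22 \<eta>; \<eta> 0 = 0; \<eta> 1 = 0\<rbrakk> \<Longrightarrow>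
      integral {0..1} (\<lambda>t. M t \<bullet> d2 \<eta> t + R t \<bullet> d1 \<eta> t) = 0"
  obtains N Mt F where "negligible N" "\<And>t. t \<in> {0..1} - N \<Longrightarrow> M t = Mt t"
    "ac_primitive Mt (\<lambda>t. R t - F)" "Mt 0 = 0" "Mt 1 = 0"
proof -
  define Rh where "Rh t = 0 + integral {0..t} R" for t
  have Rh: "ac_primitive Rh R" unfolding Rh_def by (rule ac_primitive_indefinite[OF R])
  \<comment> \<open>This value makes \<open>Rh t - t *\<^sub>R F\<close> vanish at both ends. These
    are the natural boundary conditions; they hold because the slopes of the test function are free
    at 0 and 1.\<close>
  define F where "F = Rh 1"
  define b where "b t = M t - (Rh t - t *\<^sub>R F)" for t
  have sqRh: "square_integrable (\<lambda>t. Rh t - t *\<^sub>R F)"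
    by (intro square_integrable_continuous continuous_intros ac_primitive_continuous[OF Rh])
  have sqb: "square_integrable b" unfolding b_def by (intro square_integrable_diff M sqRh)
  define B where "B t = 0 + integral {0..t} b" for t
  have B: "ac_primitive B b" unfolding B_def
    by (rule ac_primitive_indefinite[OF square_integrable_imp_abs[OF sqb]])
  \<comment> \<open>The free initial slope of the test function is spent on the condition
    \<open>\<eta> 1 = 0\<close>.\<close>
  define v where "v = - integral {0..1} B"
  define u where "u t = v + B t" for t
  have u: "ac_primitive u b" using ac_primitive_add[OF ac_primitive_const B, of v] by (simp add: u_def[abs_def])
  have cu: "continuous_on {0..1} u" using ac_primitive_continuous[OF u] .
  define \<eta> where "\<eta> t = integral {0..t} u" for t
  have der: "(\<eta> has_vector_derivative u t) (at01 t)" if "t \<in> {0..1}" for t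
    unfolding \<eta>_def by (rule integral_has_vector_derivative[OF cu that])
  have cB: "continuous_on {0..1} B" using ac_primitive_continuous[OF B] .
  have \<eta>01: "\<eta> 0 = 0" "\<eta> 1 = 0"
  proof -
    have "integral {0..1} u = integral {0..1::real} (\<lambda>t. v) + integral {0..1} B"
      unfolding u_def by (subst integral_add[symmetric]) (auto intro: integrable_continuous_real cB)
    then show "\<eta> 1 = 0" by (simp add: \<eta>_def v_def)
  qed (simp add: \<eta>_def)
  have W: "W22 \<eta>" by (rule W22_of_ac_primitive[OF der u sqb])
  obtain N where N: "negligible N" "\<And>t. t \<in> {0..1} - N \<Longrightarrow> d2 \<eta> t = b t"
    using d2_ae[OF der u] by blast
  have "0 = integral {0..1} (\<lambda>t. M t \<bullet> d2 \<eta> t + R t \<bullet> d1 \<eta> t)"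
    using crit[OF W \<eta>01] by simp
  also have "\<dots> = integral {0..1} (\<lambda>t. M t \<bullet> b t + R t \<bullet> u t)"
    by (rule integral_spike[OF N(1)]) (use N(2) has_vector_derivative_d1[OF der] in auto)
  finally have e0: "integral {0..1} (\<lambda>t. M t \<bullet> b t + R t \<bullet> u t) = 0" by simp
  have p1: "ac_primitive (\<lambda>t. Rh t \<bullet> u t) (\<lambda>t. R t \<bullet> u t + Rh t \<bullet> b t)"
    by (rule ac_primitive_inner[OF Rh u])
  have p2: "ac_primitive (\<lambda>t. (t *\<^sub>R F) \<bullet> u t) (\<lambda>t. F \<bullet> u t + (t *\<^sub>R F) \<bullet> b t)"
    using ac_primitive_inner[OF ac_primitive_linear[OF ac_primitive_ident bounded_linear_scaleR_left[of F]] u]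
    by simp
  have p3: "ac_primitive (\<lambda>t. F \<bullet> \<eta> t) (\<lambda>t. F \<bullet> u t)"
    by (rule ac_primitive_linear[OF ac_primitive_of_derivative[OF der cu] bounded_linear_inner_right])
  \<comment> \<open>The part of the tested identity other than the squared norm of \<open>b\<close>
    is an exact derivative. Its primitive vanishes at 0 and, as \<open>Rh 1 = F\<close> and
    \<open>\<eta> 1 = 0\<close>, also at 1.\<close>
  have p4: "ac_primitive (\<lambda>t. Rh t \<bullet> u t - (t *\<^sub>R F) \<bullet> u t + F \<bullet> \<eta> t)
     (\<lambda>t. R t \<bullet> u t + (Rh t - t *\<^sub>R F) \<bullet> b t)"
    by (rule ac_primitive_cong[OF ac_primitive_add[OF ac_primitive_diff[OF p1 p2] p3] negligible_empty])
      (auto simp: inner_diff_left)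
  have e1: "integral {0..1} (\<lambda>t. R t \<bullet> u t + (Rh t - t *\<^sub>R F) \<bullet> b t) = 0"
    using p4 \<eta>01 by (simp add: ac_primitive_def F_def Rh_def)
  have i1: "(\<lambda>t. R t \<bullet> u t + (Rh t - t *\<^sub>R F) \<bullet> b t) integrable_on {0..1}"
    using p4 by (simp add: ac_primitive_def absolutely_integrable_on_def)
  have i2: "(\<lambda>t. (norm (b t))^2) integrable_on {0..1}" using sqb by (simp add: square_integrable_def)
  have "(\<lambda>t. M t \<bullet> b t + R t \<bullet> u t) =
     (\<lambda>t. (norm (b t))^2 + (R t \<bullet> u t + (Rh t - t *\<^sub>R F) \<bullet> b t))"
    by (auto simp: b_def power2_norm_eq_inner inner_diff_left)
  then have "integral {0..1} (\<lambda>t. (norm (b t))^2) = 0"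
    using e0 e1 integral_add[OF i2 i1] by simp
  then obtain N' where N': "negligible N'" "\<And>t. t \<in> {0..1} - N' \<Longrightarrow> b t = 0"
    using zero_ae_of_integral_norm_zero[OF sqb] by blast
  show thesis
  proof (rule that[OF N'(1)])
    show "M t = Rh t - t *\<^sub>R F" if "t \<in> {0..1} - N'" for t
      using N'(2)[OF that] by (simp add: b_def)
    show "ac_primitive (\<lambda>t. Rh t - t *\<^sub>R F) (\<lambda>t. R t - F)"
      using ac_primitive_diff[OF Rh ac_primitive_linear[OF ac_primitive_ident bounded_linear_scaleR_left[of F]]]
      by simp
  qed (auto simp: Rh_def F_def)
qed

text \<open>\<open>varM\<close> is linear and \<open>varR\<close> quadratic in the second
  derivative, hence L^2 for the former but only L^1 for the latter.\<close>

lemma varM_varR_integrable: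
  assumes \<gamma>: "W22 \<gamma>" and nz: "\<And>t. t \<in> {0..1} \<Longrightarrow> d1 \<gamma> t \<noteq> 0"
  shows "square_integrable (varM \<gamma>)" "varR lam \<gamma> absolutely_integrable_on {0..1}"
proof -
  note g = W22_derivatives[OF \<gamma>]
  have cp: "continuous_on {0..1} (d1 \<gamma>)" by (rule ac_primitive_continuous[OF g(2)])
  have cn: "continuous_on {0..1} (\<lambda>t. norm (d1 \<gamma> t))" by (intro continuous_intros cp)
  let ?C = "\<lambda>t. cross2 (d1 \<gamma> t) (d2 \<gamma> t)"
  have sqC: "square_integrable ?C" by (rule square_integrable_cross2[OF cp g(3)])
  have "square_integrable (\<lambda>t. ((- 2 * snd (d1 \<gamma> t) / norm (d1 \<gamma> t) ^ 5) * ?C t,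
     (2 * fst (d1 \<gamma> t) / norm (d1 \<gamma> t) ^ 5) * ?C t))"
    using nz by (intro square_integrable_Pair square_integrable_continuous_mult sqC continuous_intros cn cp) auto
  then show "square_integrable (varM \<gamma>)"
    by (rule square_integrable_spike[OF _ negligible_empty]) (auto simp: varM_def)
  have a12: "square_integrable (\<lambda>t. fst (d2 \<gamma> t))" "square_integrable (\<lambda>t. snd (d2 \<gamma> t))"
    by (intro square_integrable_fst square_integrable_snd g(3))+
  have c1: "continuous_on {0..1} (\<lambda>t. c / norm (d1 \<gamma> t) ^ j)" for c :: real and j
    using nz by (intro continuous_intros cn) auto
  have R: "(\<lambda>t. (c / norm (d1 \<gamma> t) ^ 5) * (?C t * a t)
     + ((lam / norm (d1 \<gamma> t) ^ 1 * p t) - (5 * p t / norm (d1 \<gamma> t) ^ 7) * (?C t * ?C t)))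
     absolutely_integrable_on {0..1}"
    if "square_integrable a" "continuous_on {0..1} p" for a p and c :: real
    using nz that(2)
    by (intro set_integral_add(1)[OF integrable_continuous_times[OF c1 square_integrable_mult[OF sqC that(1)]]
          set_integral_diff(1)[OF absolutely_integrable_continuous_real
            integrable_continuous_times[OF _ square_integrable_mult[OF sqC sqC]]]] continuous_intros cn) auto
  note R1 = R[OF a12(2) continuous_on_fst[OF cp], of 2] and R2 = R[OF a12(1) continuous_on_snd[OF cp], of "- 2"]
  have "(\<lambda>t. (fst (varR lam \<gamma> t), snd (varR lam \<gamma> t))) absolutely_integrable_on {0..1}"
    using ac_primitive_Pair[OF ac_primitive_indefinite[OF R1, of 0] ac_primitive_indefinite[OF R2, of 0]]
    by (auto simp: ac_primitive_def varR_def power2_eq_square algebra_simps)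
  then show "varR lam \<gamma> absolutely_integrable_on {0..1}" by simp
qed

text \<open>Rotation invariance says that the moment \<open>p1 * M2 - p2 * M1\<close> plus the
  torque of \<open>F\<close> is constant, and this moment is twice the curvature. Reparametrization
  invariance says that the tangential part of the moment vector vanishes; differentiating that gives
  the speed identity. Integrating the speed identity over [0,1] yields the energy.\<close>

lemma pinned_elastica_first_integral:
  assumes pe: "pinned_elastica lam l \<gamma>" and lam: "lam > 0" and l: "l > 0"
  obtains F where "F \<noteq> 0"
    "\<And>t. t \<in> {0..1} \<Longrightarrow> F * fst (d1 \<gamma> t) = (lam - (F * snd (\<gamma> t) / 2)^2) * norm (d1 \<gamma> t)"
    "\<And>t. t \<in> {0..1} \<Longrightarrow> ((\<lambda>t. snd (d1 \<gamma> t) / norm (d1 \<gamma> t)) has_real_derivative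
        F * snd (\<gamma> t) / 2 * fst (d1 \<gamma> t)) (at01 t)"
    "energy lam \<gamma> = 2 * lam * curve_length \<gamma> - F * l"
proof -
  have W: "W22 \<gamma>" and nz: "\<And>t. t \<in> {0..1} \<Longrightarrow> d1 \<gamma> t \<noteq> 0" and bc: "\<gamma> 0 = (0,0)" "\<gamma> 1 = (l,0)"
    using pe by (auto simp: pinned_elastica_def admissible_def)
  note g = W22_derivatives[OF W]
  have crit: "integral {0..1} (\<lambda>t. varM \<gamma> t \<bullet> d2 \<eta> t + varR lam \<gamma> t \<bullet> d1 \<eta> t) = 0"
    if "W22 \<eta>" "\<eta> 0 = 0" "\<eta> 1 = 0" for \<eta>
    using DERIV_unique[OF first_variation[OF W nz that(1)]] pe that unfolding pinned_elastica_def by blast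
  obtain N Mt F where N: "negligible N" and MM: "\<And>t. t \<in> {0..1} - N \<Longrightarrow> varM \<gamma> t = Mt t"
    and Mt: "ac_primitive Mt (\<lambda>t. varR lam \<gamma> t - F)" and Mt01: "Mt 0 = 0" "Mt 1 = 0"
    using du_bois_reymond[OF varM_varR_integrable[OF W nz] crit] by blast
  define p1 p2 a1 a2 where "p1 t = fst (d1 \<gamma> t)" and "p2 t = snd (d1 \<gamma> t)"
    and "a1 t = fst (d2 \<gamma> t)" and "a2 t = snd (d2 \<gamma> t)" for t
  define n where "n t = norm (d1 \<gamma> t)" for t
  define x y where "x t = fst (\<gamma> t)" and "y t = snd (\<gamma> t)" for t
  define C where "C t = cross2 (d1 \<gamma> t) (d2 \<gamma> t)" for t
  have C: "C t = p1 t * a2 t - p2 t * a1 t" for t by (simp add: C_def cross2_def p1_def p2_def a1_def a2_def)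
  have n2: "(n t)^2 = (p1 t)^2 + (p2 t)^2" for t
    by (simp add: n_def p1_def p2_def norm_prod_def)
  have np: "n t > 0" if "t \<in> {0..1}" for t using nz[OF that] by (simp add: n_def)
  have ap1: "ac_primitive p1 a1" and ap2: "ac_primitive p2 a2"
    unfolding p1_def[abs_def] p2_def[abs_def] a1_def[abs_def] a2_def[abs_def]
    using ac_primitive_fst[OF g(2)] ac_primitive_snd[OF g(2)] by auto
  have cp1: "continuous_on {0..1} p1" and cp2: "continuous_on {0..1} p2"
    using ap1 ap2 ac_primitive_continuous by auto
  have cn: "continuous_on {0..1} n" unfolding n_def
    by (intro continuous_intros ac_primitive_continuous[OF g(2)])
  have ag: "ac_primitive \<gamma> (d1 \<gamma>)"
    by (rule ac_primitive_of_derivative[OF g(1) ac_primitive_continuous[OF g(2)]])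
  have ax: "ac_primitive x p1" and ay: "ac_primitive y p2"
    unfolding p1_def[abs_def] p2_def[abs_def] x_def[abs_def] y_def[abs_def]
    using ac_primitive_fst[OF ag] ac_primitive_snd[OF ag] by auto
  have cy: "continuous_on {0..1} y" using ac_primitive_continuous[OF ay] .
  define R1 R2 where "R1 t = fst (varR lam \<gamma> t)" and "R2 t = snd (varR lam \<gamma> t)" for t
  define M1 M2 F1 F2 where "M1 t = fst (Mt t)" and "M2 t = snd (Mt t)" and "F1 = fst F" and "F2 = snd F" for t
  have am1: "ac_primitive M1 (\<lambda>t. R1 t - F1)" and am2: "ac_primitive M2 (\<lambda>t. R2 t - F2)"
    unfolding M1_def[abs_def] M2_def[abs_def] F1_def F2_def R1_def R2_def
    using ac_primitive_fst[OF Mt] ac_primitive_snd[OF Mt] by auto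
  have m1: "M1 t = - 2 * C t * p2 t / n t ^ 5" and m2: "M2 t = 2 * C t * p1 t / n t ^ 5" if "t \<in> {0..1} - N" for t
    unfolding M1_def M2_def MM[OF that, symmetric] by (simp_all add: varM_def C_def n_def p1_def p2_def)
  have r1: "R1 t = 2 * C t * a2 t / n t ^ 5 + (lam / n t - 5 * (C t)^2 / n t ^ 7) * p1 t"
    and r2: "R2 t = - 2 * C t * a1 t / n t ^ 5 + (lam / n t - 5 * (C t)^2 / n t ^ 7) * p2 t" for t
    by (auto simp: R1_def R2_def varR_def C_def n_def p1_def p2_def a1_def a2_def)
  have bc': "x 0 = 0" "y 0 = 0" "x 1 = l" "y 1 = 0" "M1 0 = 0" "M2 0 = 0" "M1 1 = 0" "M2 1 = 0"
    using bc Mt01 by (auto simp: x_def y_def M1_def M2_def)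

  \<comment> \<open>Built from the primitive \<open>Mt\<close> instead of \<open>varM\<close>, this
    is a continuous representative of the curvature; \<open>CN\<close> below confirms it almost
    everywhere.\<close>
  define k where "k t = (p1 t * M2 t - p2 t * M1 t) / 2" for t
  have akx: "ac_primitive (\<lambda>t. (p1 t * M2 t - p2 t * M1 t) + (F2 * x t - F1 * y t))
     (\<lambda>t. ((a1 t * M2 t + p1 t * (R2 t - F2)) - (a2 t * M1 t + p2 t * (R1 t - F1)))
        + (F2 * p1 t - F1 * p2 t))"
    by (intro ac_primitive_add ac_primitive_diff ac_primitive_mult ac_primitive_cmult ap1 ap2 am1 am2 ax ay)
  have akx0: "(a1 t * M2 t + p1 t * (R2 t - F2)) - (a2 t * M1 t + p2 t * (R1 t - F1))
        + (F2 * p1 t - F1 * p2 t) = 0" if t: "t \<in> {0..1} - N" for t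
    unfolding m1[OF t] m2[OF t] r1 r2 by (simp add: algebra_simps)
  have kk: "k t = (F1 * y t - F2 * x t) / 2" if "t \<in> {0..1}" for t
    using ac_primitive_zero_ae[OF akx N akx0 that] by (simp add: k_def bc')
  \<comment> \<open>At t = 1 the moment and y vanish while x = l > 0, so the vertical force must
    vanish.\<close>
  have F2: "F2 = 0" using kk[of 1] l by (simp add: k_def bc')
  have ky: "k t = F1 * y t / 2" if "t \<in> {0..1}" for t using kk[OF that] F2 by simp
  have CN: "C t = k t * n t ^ 3" if t: "t \<in> {0..1} - N" for t
  proof -
    have n0: "n t \<noteq> 0" using np[of t] t by auto
    have "k t = C t * ((p1 t)^2 + (p2 t)^2) / n t ^ 5"
      unfolding k_def m1[OF t] m2[OF t] using n0 by (simp add: field_simps power2_eq_square)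
    then show ?thesis unfolding n2[symmetric] using n0 by (simp add: field_simps eval_nat_numeral)
  qed

  have "ac_primitive (\<lambda>t. p1 t * M1 t + p2 t * M2 t)
    (\<lambda>t. (a1 t * M1 t + p1 t * (R1 t - F1)) + (a2 t * M2 t + p2 t * (R2 t - F2)))"
    by (intro ac_primitive_add ac_primitive_mult ap1 ap2 am1 am2)
  then have pm: "ac_primitive (\<lambda>t. p1 t * M1 t + p2 t * M2 t) (\<lambda>t. (lam - (F1 * y t / 2)^2) * n t - F1 * p1 t)"
  proof (rule ac_primitive_cong[OF _ N])
    fix t assume t: "t \<in> {0..1} - N"
    have n0: "n t \<noteq> 0" using np[of t] t by auto
    have "(a1 t * M1 t + p1 t * (R1 t - F1)) + (a2 t * M2 t + p2 t * (R2 t - F2))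
      = 4 * (C t)^2 / n t ^ 5 + (lam / n t - 5 * (C t)^2 / n t ^ 7) * ((p1 t)^2 + (p2 t)^2) - F1 * p1 t"
      unfolding m1[OF t] m2[OF t] r1 r2 F2 using n0 by (simp add: C field_simps power2_eq_square)
    also have "\<dots> = (lam - (k t)^2) * n t - F1 * p1 t"
      unfolding n2[symmetric] CN[OF t] using n0 by (simp add: field_simps eval_nat_numeral)
    finally show "(lam - (F1 * y t / 2)^2) * n t - F1 * p1 t =
      (a1 t * M1 t + p1 t * (R1 t - F1)) + (a2 t * M2 t + p2 t * (R2 t - F2))"
      using t by (simp flip: ky)
  qed auto
  \<comment> \<open>\<open>varM\<close> is normal to the curve, so the tangential part is zero
    almost everywhere, hence everywhere by continuity, and its derivative found in \<open>pm\<close>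
    is zero as well.\<close>
  have pm0: "p1 t * M1 t + p2 t * M2 t = 0" if "t \<in> {0..1}" for t
    by (rule continuous_zero_ae[OF ac_primitive_continuous[OF pm] N _ that]) (simp add: m1 m2)
  have fx: "F1 * p1 t = (lam - (F1 * y t / 2)^2) * n t" if "t \<in> {0..1}" for t
  proof -
    have "continuous_on {0..1} (\<lambda>t. (lam - (F1 * y t / 2)^2) * n t - F1 * p1 t)"
      by (intro continuous_intros cy cn cp1) auto
    from ac_primitive_of_zero[OF pm this pm0 that] show ?thesis by simp
  qed
  have F1: "F1 \<noteq> 0"
    using fx[of 0] np[of 0] lam by auto

  have r: "ac_primitive (\<lambda>t. p1 t * p1 t + p2 t * p2 t) (\<lambda>t. (a1 t * p1 t + p1 t * a1 t) + (a2 t * p2 t + p2 t * a2 t))"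
    by (intro ac_primitive_add ac_primitive_mult ap1 ap2)
  have sq: "sqrt (p1 t * p1 t + p2 t * p2 t) = n t" for t
    using n2[of t] by (simp add: n_def real_sqrt_unique power2_eq_square[symmetric])
  have rp: "p1 t * p1 t + p2 t * p2 t > 0" if "t \<in> {0..1}" for t
    using np[OF that] n2[of t] by (simp add: power2_eq_square[symmetric]) (metis zero_less_power)
  have w: "ac_primitive (\<lambda>t. 1 / sqrt (p1 t * p1 t + p2 t * p2 t))
     (\<lambda>t. (- 1 / (2 * sqrt (p1 t * p1 t + p2 t * p2 t) ^ 3)) * ((a1 t * p1 t + p1 t * a1 t) + (a2 t * p2 t + p2 t * a2 t)))"
  proof (rule ac_primitive_chain[OF r, where F = "\<lambda>x. 1 / sqrt x" and F' = "\<lambda>x. - 1 / (2 * sqrt x ^ 3)"])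
    show "((\<lambda>x. 1 / sqrt x) has_real_derivative - 1 / (2 * sqrt (p1 t * p1 t + p2 t * p2 t) ^ 3))
       (at (p1 t * p1 t + p2 t * p2 t))" if "t \<in> {0..1}" for t
      using rp[OF that] by (auto intro!: derivative_eq_intros simp: field_simps eval_nat_numeral)
    show "continuous_on {0..1} (\<lambda>t. - 1 / (2 * sqrt (p1 t * p1 t + p2 t * p2 t) ^ 3))"
      unfolding sq using np by (intro continuous_intros cn) (auto simp: less_imp_neq[symmetric])
  qed
  \<comment> \<open>\<open>p2 t / n t\<close> is the sine of the tangent angle. Its derivative is
    the curvature times \<open>p1\<close>, which is continuous: from here on classical derivatives
    suffice.\<close>
  have T: "ac_primitive (\<lambda>t. p2 t / n t) (\<lambda>t. F1 * y t / 2 * p1 t)"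
  proof (rule ac_primitive_cong[OF ac_primitive_mult[OF ap2 w] N])
    fix t assume t: "t \<in> {0..1} - N"
    have n0: "n t \<noteq> 0" using np[of t] t by auto
    have "a2 t * (1 / sqrt (p1 t * p1 t + p2 t * p2 t)) + p2 t *
       ((- 1 / (2 * sqrt (p1 t * p1 t + p2 t * p2 t) ^ 3)) * ((a1 t * p1 t + p1 t * a1 t) + (a2 t * p2 t + p2 t * a2 t)))
      = (a2 t * (n t)^2 - p2 t * (a1 t * p1 t + a2 t * p2 t)) / n t ^ 3"
      unfolding sq using n0 by (simp add: field_simps eval_nat_numeral)
    also have "\<dots> = p1 t * C t / n t ^ 3"
      unfolding n2 by (simp add: C algebra_simps power2_eq_square)
    also have "\<dots> = p1 t * k t" using CN[OF t] n0 by simp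
    finally show "F1 * y t / 2 * p1 t = a2 t * (1 / sqrt (p1 t * p1 t + p2 t * p2 t)) + p2 t *
       ((- 1 / (2 * sqrt (p1 t * p1 t + p2 t * p2 t) ^ 3)) * ((a1 t * p1 t + p1 t * a1 t) + (a2 t * p2 t + p2 t * a2 t)))"
      using ky[of t] t by simp
  qed (simp add: sq)

  have "bending \<gamma> = integral {0..1} (\<lambda>t. lam * n t - F1 * p1 t)"
    unfolding bending_def
  proof (rule integral_spike[OF N])
    fix t assume t: "t \<in> {0..1} - N"
    then have n0: "n t \<noteq> 0" and tin: "t \<in> {0..1}" using np[of t] by auto
    have "(C t)^2 / n t ^ 5 = (k t)^2 * n t"
      unfolding CN[OF t] using n0 by (simp add: field_simps eval_nat_numeral)
    also have "\<dots> = lam * n t - F1 * p1 t" unfolding ky[OF tin] using fx[OF tin] by (simp add: algebra_simps)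
    finally show "lam * n t - F1 * p1 t = (cross2 (d1 \<gamma> t) (d2 \<gamma> t))^2 / norm (d1 \<gamma> t) ^ 5"
      by (simp add: C_def n_def)
  qed
  also have "\<dots> = lam * integral {0..1} n - F1 * integral {0..1} p1"
    by (subst integral_diff) (auto intro!: integrable_continuous_real continuous_intros cn cp1)
  also have "integral {0..1} p1 = l" using ax bc' by (simp add: ac_primitive_def)
  also have "integral {0..1} n = curve_length \<gamma>" by (simp add: curve_length_def n_def[abs_def])
  finally have en: "energy lam \<gamma> = 2 * lam * curve_length \<gamma> - F1 * l" by (simp add: energy_def)

  show thesis
  proof (rule that[OF F1 _ _ en])
    fix t :: real assume t: "t \<in> {0..1}"
    show "F1 * fst (d1 \<gamma> t) = (lam - (F1 * snd (\<gamma> t) / 2)^2) * norm (d1 \<gamma> t)"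
      using fx[OF t] by (simp add: p1_def n_def y_def)
    have "((\<lambda>t. p2 t / n t) has_vector_derivative F1 * y t / 2 * p1 t) (at01 t)"
      by (rule ac_primitive_has_derivative[OF T _ t]) (auto intro!: continuous_intros cy cp1)
    then show "((\<lambda>t. snd (d1 \<gamma> t) / norm (d1 \<gamma> t)) has_real_derivative
        F1 * snd (\<gamma> t) / 2 * fst (d1 \<gamma> t)) (at01 t)"
      by (simp add: has_real_derivative_iff_has_vector_derivative p1_def p2_def n_def y_def)
  qed
qed

section \<open>Elliptic integrals and the wavelike elastica\<close>

lemma oriented_integral_has_derivative:
  fixes h :: "real \<Rightarrow> real"
  assumes "continuous_on UNIV h"
  shows "((\<lambda>x. if 0 \<le> x then integral {0..x} h else - integral {x..0} h) has_real_derivative h x) (at x)"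
proof -
  define B where "B = \<bar>x\<bar> + 1"
  have ci: "continuous_on {a..b} h" for a b by (rule continuous_on_subset[OF assms]) simp
  have "((\<lambda>u. integral {-B..u} h) has_real_derivative h x) (at x within {-B..B})"
    by (rule integral_has_real_derivative[OF ci]) (auto simp: B_def)
  moreover have "x \<in> interior {-B..B}" by (auto simp: B_def)
  ultimately have "((\<lambda>u. integral {-B..u} h) has_real_derivative h x) (at x)"
    by (metis at_within_interior)
  then have "((\<lambda>u. integral {-B..u} h - integral {-B..0} h) has_real_derivative h x) (at x)"
    by (auto intro!: derivative_eq_intros)
  then show ?thesis
  proof (rule has_field_derivative_transform_within_open[where S = "{-B<..<B}"])
    fix y assume y: "y \<in> {-B<..<B}"
    show "integral {-B..y} h - integral {-B..0} h = (if 0 \<le> y then integral {0..y} h else - integral {y..0} h)"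
    proof (cases "0 \<le> y")
      case True
      have "integral {-B..0} h + integral {0..y} h = integral {-B..y} h"
        by (rule hk_integral_combine[OF _ _ integrable_continuous_real[OF ci]])
          (use y True in \<open>auto simp: B_def\<close>)
      then show ?thesis using True by simp
    next
      case False
      have "integral {-B..y} h + integral {y..0} h = integral {-B..0} h"
        by (rule hk_integral_combine[OF _ _ integrable_continuous_real[OF ci]])
          (use y False in \<open>auto simp: B_def\<close>)
      then show ?thesis using False by simp
    qed
  qed (auto simp: B_def)
qed

text \<open>Jacobi's Delta as a function of the amplitude: the integrand of \<open>ellE\<close> and
  the reciprocal of the integrand of \<open>ellF\<close>.\<close>

definition dlt :: "real \<Rightarrow> real \<Rightarrow> real" where
  "dlt q x = sqrt (1 - q^2 * (sin x)^2)"

definition modulus :: "real \<Rightarrow> bool" where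
  "modulus q \<longleftrightarrow> 0 < q \<and> q < 1"

lemma modulus_sq: "modulus q \<Longrightarrow> 0 < q^2" "modulus q \<Longrightarrow> q^2 < 1"
  by (auto simp: modulus_def power_less_one_iff abs_square_less_1)

lemma dlt_arg_bounds:
  assumes "modulus q"
  shows "1 - q^2 \<le> 1 - q^2 * (sin x)^2" "1 - q^2 * (sin x)^2 \<le> 1" "1 - q^2 * (sin x)^2 > 0"
proof -
  have "(sin x)^2 \<le> 1" by (simp add: abs_square_le_1)
  then have "q^2 * (sin x)^2 \<le> q^2 * 1" by (intro mult_left_mono) auto
  then show "1 - q^2 \<le> 1 - q^2 * (sin x)^2" by simp
  then show "1 - q^2 * (sin x)^2 > 0" using modulus_sq[OF assms] by linarith
qed simp

lemma dlt_pos: "modulus q \<Longrightarrow> dlt q x > 0"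
  using dlt_arg_bounds(3)[of q x] by (simp add: dlt_def)

lemma dlt_nz: "modulus q \<Longrightarrow> dlt q x \<noteq> 0"
  using dlt_pos[of q x] by simp

lemma dlt_le_1: "modulus q \<Longrightarrow> dlt q x \<le> 1"
  unfolding dlt_def using real_sqrt_le_mono[OF dlt_arg_bounds(2)] by simp

lemma dlt_sq: "modulus q \<Longrightarrow> (dlt q x)^2 = 1 - q^2 * (sin x)^2"
  unfolding dlt_def using dlt_arg_bounds(3)[of q x] by simp

lemma dlt_continuous: "continuous_on S (dlt q)"
  unfolding dlt_def by (intro continuous_intros)

lemma dlt_deriv: "modulus q \<Longrightarrow> (dlt q has_real_derivative - (q^2 * sin x * cos x / dlt q x)) (at x)"
  unfolding dlt_def using dlt_arg_bounds(3)[of q x]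
  by (auto intro!: derivative_eq_intros simp: field_simps)

lemma dlt_symm: "dlt q (x + pi) = dlt q x" "dlt q (- x) = dlt q x"
  by (auto simp: dlt_def)

lemma ellF_deriv: "modulus q \<Longrightarrow> ((\<lambda>x. ellF x q) has_real_derivative 1 / dlt q x) (at x)"
  unfolding ellF_def Let_def dlt_def[symmetric]
  by (intro oriented_integral_has_derivative continuous_intros dlt_continuous) (simp add: dlt_nz)

lemma ellE_deriv: "modulus q \<Longrightarrow> ((\<lambda>x. ellE x q) has_real_derivative dlt q x) (at x)"
  unfolding ellE_def Let_def dlt_def[symmetric]
  by (intro oriented_integral_has_derivative dlt_continuous)

section \<open>Quasi-periodicity of the elliptic integrals and the Jacobi amplitude\<close>

lemma ellF_0 [simp]: "ellF 0 q = 0" and ellE_0 [simp]: "ellE 0 q = 0"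
  by (auto simp: ellF_def ellE_def)

lemma quasi_periodic:
  fixes f f' :: "real \<Rightarrow> real"
  assumes d: "\<And>x. (f has_real_derivative f' x) (at x)" and p: "\<And>x. f' (x + pi) = f' x"
    and e: "\<And>x. f' (- x) = f' x" and z: "f 0 = 0"
  shows "f (x + pi) = f x + 2 * f (pi / 2)" "f (- x) = - f x"
proof -
  have "f x + f (- x) = f 0 + f (- 0)" for x
    by (rule DERIV_isconst_all[where f = "\<lambda>x. f x + f (- x)"])
      (auto intro!: derivative_eq_intros DERIV_chain2[OF d] d simp: e)
  then show odd: "f (- x) = - f x" for x using z by (simp add: eq_neg_iff_add_eq_0 add.commute)
  define c where "c = f (- (pi / 2) + pi) - f (- (pi / 2))"
  have c: "f (x + pi) - f x = c" for x
    unfolding c_def by (rule DERIV_isconst_all[where f = "\<lambda>x. f (x + pi) - f x"])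
      (auto intro!: derivative_eq_intros DERIV_chain2[OF d] d simp: p)
  have "c = 2 * f (pi / 2)" using odd[of "pi / 2"] by (simp add: c_def)
  then show "f (x + pi) = f x + 2 * f (pi / 2)" using c[of x] by simp
qed

lemma ellF_pi: "modulus q \<Longrightarrow> ellF (x + pi) q = ellF x q + 2 * compK q"
  and ellF_minus: "modulus q \<Longrightarrow> ellF (- x) q = - ellF x q"
  unfolding compK_def
  by (rule quasi_periodic[OF ellF_deriv]; simp add: dlt_symm)+

lemma ellE_pi: "modulus q \<Longrightarrow> ellE (x + pi) q = ellE x q + 2 * compE q"
  and ellE_minus: "modulus q \<Longrightarrow> ellE (- x) q = - ellE x q"
  unfolding compE_def
  by (rule quasi_periodic[OF ellE_deriv]; simp add: dlt_symm)+

text \<open>The integrand of \<open>ellF\<close> is at least 1. This single estimate gives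
  injectivity, surjectivity and the Lipschitz continuity of the inverse \<open>am\<close>.\<close>

lemma ellF_expanding:
  assumes "modulus q" "x \<le> y"
  shows "y - x \<le> ellF y q - ellF x q"
proof -
  have "ellF x q - x \<le> ellF y q - y"
  proof (rule DERIV_nonneg_imp_nondecreasing[OF assms(2)])
    fix z
    have "((\<lambda>x. ellF x q - x) has_real_derivative 1 / dlt q z - 1) (at z)"
      by (auto intro!: derivative_eq_intros ellF_deriv assms)
    moreover have "0 \<le> 1 / dlt q z - 1" using dlt_pos[OF assms(1), of z] dlt_le_1[OF assms(1), of z] by simp
    ultimately show "\<exists>y. ((\<lambda>x. ellF x q - x) has_real_derivative y) (at z) \<and> 0 \<le> y" by blast
  qed
  then show ?thesis by simp
qed

lemma ellF_inj:
  assumes q: "modulus q" and eq: "ellF x q = ellF y q"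
  shows "x = y"
proof (rule linorder_cases[of x y])
  assume "x < y"
  then show ?thesis using ellF_expanding[OF q, of x y] eq by linarith
next
  assume "y < x"
  then show ?thesis using ellF_expanding[OF q, of y x] eq by linarith
qed

lemma ellF_surj:
  assumes "modulus q"
  shows "\<exists>x. ellF x q = u"
proof -
  have "\<exists>x\<ge>-\<bar>u\<bar>. x \<le> \<bar>u\<bar> \<and> ellF x q = u"
  proof (rule IVT)
    show "ellF (- \<bar>u\<bar>) q \<le> u" using ellF_expanding[OF assms, of "-\<bar>u\<bar>" 0] by simp
    show "u \<le> ellF \<bar>u\<bar> q" using ellF_expanding[OF assms, of 0 "\<bar>u\<bar>"] by simp
    show "\<forall>x. - \<bar>u\<bar> \<le> x \<and> x \<le> \<bar>u\<bar> \<longrightarrow> isCont (\<lambda>x. ellF x q) x"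
      using ellF_deriv[OF assms] DERIV_isCont by blast
  qed simp
  then show ?thesis by blast
qed

lemma ellF_am:
  assumes "modulus q"
  shows "ellF (am u q) q = u"
proof -
  obtain x where "ellF x q = u" using ellF_surj[OF assms] by blast
  then show ?thesis unfolding am_def by (rule theI) (use ellF_inj[OF assms] \<open>ellF x q = u\<close> in blast)
qed

lemma am_ellF:
  assumes "modulus q"
  shows "am (ellF x q) q = x"
  by (rule ellF_inj[OF assms ellF_am[OF assms]])

lemma am_deriv:
  assumes "modulus q"
  shows "((\<lambda>u. am u q) has_real_derivative dlt q (am u q)) (at u)"
proof -
  have "isCont (\<lambda>u. am u q) u"
    unfolding continuous_at_eps_delta
  proof (intro allI impI)
    fix e :: real assume e: "0 < e"
    have "\<bar>am v q - am u q\<bar> \<le> \<bar>v - u\<bar>" for v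
      using ellF_expanding[OF assms, of "am v q" "am u q"] ellF_expanding[OF assms, of "am u q" "am v q"]
      by (cases "am v q \<le> am u q") (auto simp: ellF_am[OF assms])
    then show "\<exists>d>0. \<forall>x'. dist x' u < d \<longrightarrow> dist (am x' q) (am u q) < e"
      using e by (intro exI[of _ e]) (auto simp: dist_real_def intro: le_less_trans)
  qed
  then have "((\<lambda>u. am u q) has_real_derivative inverse (1 / dlt q (am u q))) (at u)"
    by (intro DERIV_inverse_function[where f = "\<lambda>x. ellF x q" and a = "u - 1" and b = "u + 1"] ellF_deriv assms)
      (use dlt_pos[OF assms, of "am u q"] in \<open>auto simp: ellF_am[OF assms]\<close>)
  then show ?thesis by simp
qed

lemma am_values:
  assumes "modulus q"
  shows "am 0 q = 0" "am (- compK q) q = - (pi / 2)" "am (- compK q + 2 * real n * compK q) q = - (pi / 2) + real n * pi"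
proof -
  show "am 0 q = 0" using am_ellF[OF assms, of 0] by simp
  have F: "ellF (- (pi / 2) + real n * pi) q = - compK q + 2 * real n * compK q" for n
  proof (induction n)
    case 0 show ?case using ellF_minus[OF assms, of "pi / 2"] by (simp add: compK_def)
  next
    case (Suc n)
    have "- (pi / 2) + real (Suc n) * pi = (- (pi / 2) + real n * pi) + pi" by (simp add: algebra_simps)
    then show ?case using ellF_pi[OF assms, of "- (pi / 2) + real n * pi"] Suc by (simp add: algebra_simps)
  qed
  show n: "am (- compK q + 2 * real n * compK q) q = - (pi / 2) + real n * pi" for n
    using am_ellF[OF assms, of "- (pi / 2) + real n * pi"] F[of n] by simp
  show "am (- compK q) q = - (pi / 2)" using n[of 0] by simp
qed

lemma ellE_multiples:
  assumes "modulus q"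
  shows "ellE (- (pi / 2) + real n * pi) q = - compE q + 2 * real n * compE q"
proof (induction n)
  case 0 show ?case using ellE_minus[OF assms, of "pi / 2"] by (simp add: compE_def)
next
  case (Suc n)
  have "- (pi / 2) + real (Suc n) * pi = (- (pi / 2) + real n * pi) + pi" by (simp add: algebra_simps)
  then show ?case using ellE_pi[OF assms, of "- (pi / 2) + real n * pi"] Suc by (simp add: algebra_simps)
qed

lemma compK_ge: "modulus q \<Longrightarrow> pi / 2 \<le> compK q"
  using ellF_expanding[of q 0 "pi / 2"] by (simp add: compK_def)

lemma compK_pos: "modulus q \<Longrightarrow> 0 < compK q"
  using compK_ge[of q] pi_gt_zero by linarith

lemma cn_zero:
  assumes "modulus q" "- compK q \<le> u" "cn u q = 0"
  obtains n where "u = - compK q + 2 * real n * compK q"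
proof -
  obtain i where i: "odd i" "am u q = of_int i * (pi / 2)"
    using assms(3) by (auto simp: cn_def cos_zero_iff_int)
  have "am u q \<ge> - (pi / 2)"
    using ellF_expanding[OF assms(1), of "am u q" "- (pi / 2)"] ellF_minus[OF assms(1), of "pi / 2"] assms(2)
    by (cases "am u q \<le> - (pi / 2)") (auto simp: ellF_am[OF assms(1)] compK_def)
  then have "- 1 * (pi / 2) \<le> of_int i * (pi / 2)" using i by simp
  then have "- 1 \<le> (of_int i :: real)" by (rule mult_right_le_imp_le) simp
  then have "i \<ge> - 1" by linarith
  moreover obtain j where "i = 2 * j + 1" using i(1) by (rule oddE)
  ultimately have "i = 2 * int (nat (j + 1)) - 1" by simp
  then obtain n where n: "i = 2 * int n - 1" by blast
  have "am u q = am (- compK q + 2 * real n * compK q) q"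
    unfolding i(2) n am_values(3)[OF assms(1)] by (simp add: algebra_simps)
  then have "u = - compK q + 2 * real n * compK q" by (metis ellF_am assms(1))
  then show thesis by (rule that)
qed

text \<open>The wavelike elastica in arclength, shrunk by the factor k. The shift by
  \<open>compK q\<close> puts s = 0 at amplitude -pi/2, an inflection point lying on the
  axis.\<close>

definition std_x :: "real \<Rightarrow> real \<Rightarrow> real \<Rightarrow> real" where
  "std_x q k s = (2 * ellE (am (k * s - compK q) q) q + 2 * compE q - k * s) / k"

definition std_y :: "real \<Rightarrow> real \<Rightarrow> real \<Rightarrow> real" where
  "std_y q k s = 2 * q * cn (k * s - compK q) q / k"

text \<open>Cosine (\<open>std_dx\<close>) and sine (\<open>std_dy\<close>) of the tangent angle of
  that curve.\<close>

definition std_dx :: "real \<Rightarrow> real \<Rightarrow> real \<Rightarrow> real" where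
  "std_dx q k s = 1 - 2 * q^2 * (sin (am (k * s - compK q) q))^2"

definition std_dy :: "real \<Rightarrow> real \<Rightarrow> real \<Rightarrow> real" where
  "std_dy q k s = - 2 * q * sin (am (k * s - compK q) q) * dlt q (am (k * s - compK q) q)"

lemma std_derivs:
  assumes q: "modulus q" and k: "k > 0"
  shows "(std_x q k has_real_derivative std_dx q k s) (at s)"
    and "(std_y q k has_real_derivative std_dy q k s) (at s)"
    and "(std_dy q k has_real_derivative - (k^2 * std_y q k s * std_dx q k s)) (at s)"
proof -
  define \<phi> where "\<phi> s = am (k * s - compK q) q" for s
  have d\<phi>: "(\<phi> has_real_derivative k * dlt q (\<phi> s)) (at s)" for s
    unfolding \<phi>_def
    by (rule DERIV_cong[OF DERIV_chain2[OF am_deriv[OF q]]]) (auto intro!: derivative_eq_intros)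
  note dc = DERIV_chain2[where g = \<phi>, OF _ d\<phi>]
  have p: "dlt q (\<phi> s) > 0" by (rule dlt_pos[OF q])
  show "(std_x q k has_real_derivative std_dx q k s) (at s)"
  proof -
    have "((\<lambda>s. (2 * ellE (\<phi> s) q + 2 * compE q - k * s) / k) has_real_derivative
        (2 * (dlt q (\<phi> s) * (k * dlt q (\<phi> s))) + 0 - k * 1) / k) (at s)"
      by (intro DERIV_cdivide DERIV_diff DERIV_add DERIV_cmult dc[OF ellE_deriv[OF q]] DERIV_const DERIV_ident)
    moreover have "(2 * (dlt q (\<phi> s) * (k * dlt q (\<phi> s))) + 0 - k * 1) / k = 2 * (dlt q (\<phi> s))^2 - 1"
      using k by (simp add: field_simps power2_eq_square)
    ultimately show ?thesis
      unfolding dlt_sq[OF q] std_x_def[abs_def] std_dx_def \<phi>_def by (simp add: mult.assoc)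
  qed
  show "(std_y q k has_real_derivative std_dy q k s) (at s)"
  proof -
    have "((\<lambda>s. 2 * q * cos (\<phi> s) / k) has_real_derivative
        2 * q * (- sin (\<phi> s) * (k * dlt q (\<phi> s))) / k) (at s)"
      by (intro DERIV_cdivide DERIV_cmult dc[OF DERIV_cos])
    then show ?thesis
      using k unfolding std_y_def[abs_def] std_dy_def cn_def \<phi>_def by (simp add: mult.assoc)
  qed
  have "- 2 * q * (cos (\<phi> s) * (k * dlt q (\<phi> s))) * dlt q (\<phi> s)
      + - (q^2 * sin (\<phi> s) * cos (\<phi> s) / dlt q (\<phi> s)) * (k * dlt q (\<phi> s)) * (- 2 * q * sin (\<phi> s))
     = - 2 * q * k * cos (\<phi> s) * ((dlt q (\<phi> s))^2 - q^2 * (sin (\<phi> s))^2)"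
    using p by (simp add: field_simps power2_eq_square)
  also have "\<dots> = - (k^2 * std_y q k s * std_dx q k s)"
    unfolding dlt_sq[OF q] std_y_def std_dx_def cn_def \<phi>_def[symmetric] using k
    by (simp add: field_simps power2_eq_square)
  finally show "(std_dy q k has_real_derivative - (k^2 * std_y q k s * std_dx q k s)) (at s)"
    unfolding std_dy_def[abs_def] \<phi>_def[symmetric]
    by (rule DERIV_cong[OF DERIV_mult[OF DERIV_cmult[OF dc[OF DERIV_sin]] dc[OF dlt_deriv[OF q]]]])
qed

text \<open>The second identity is the speed identity of an elastica for the explicit curve. Through
  it the equation for \<open>std_dy\<close> becomes an autonomous equation, cubic in
  \<open>std_y\<close>, to which the uniqueness argument applies.\<close>

lemma std_identities:
  assumes q: "modulus q" and k: "k > 0"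
  shows "(std_dx q k s)^2 + (std_dy q k s)^2 = 1"
    and "std_dx q k s = k^2 * (std_y q k s)^2 / 2 - (2 * q^2 - 1)"
proof -
  let ?\<phi> = "am (k * s - compK q) q"
  have "(std_dy q k s)^2 = 4 * q^2 * (sin ?\<phi>)^2 * (dlt q ?\<phi>)^2"
    by (simp add: std_dy_def power_mult_distrib)
  then show "(std_dx q k s)^2 + (std_dy q k s)^2 = 1"
    unfolding dlt_sq[OF q] std_dx_def by (simp add: power2_eq_square algebra_simps)
  have "k^2 * (std_y q k s)^2 = 4 * q^2 * (cos ?\<phi>)^2"
    using k by (simp add: std_y_def cn_def power_mult_distrib power_divide)
  then show "std_dx q k s = k^2 * (std_y q k s)^2 / 2 - (2 * q^2 - 1)"
    unfolding std_dx_def by (simp add: cos_squared_eq algebra_simps)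
qed

lemma std_initial:
  assumes "modulus q" "k > 0"
  shows "std_x q k 0 = 0" "std_y q k 0 = 0" "std_dx q k 0 = 1 - 2 * q^2"
    "std_dy q k 0 = 2 * q * sqrt (1 - q^2)"
proof -
  have a: "am (k * 0 - compK q) q = - (pi / 2)" using am_values(2)[OF assms(1)] by simp
  show "std_x q k 0 = 0"
    unfolding std_x_def a using ellE_multiples[OF assms(1), of 0] by simp
  show "std_y q k 0 = 0" unfolding std_y_def cn_def a by simp
  show "std_dx q k 0 = 1 - 2 * q^2" unfolding std_dx_def a by simp
  show "std_dy q k 0 = 2 * q * sqrt (1 - q^2)" unfolding std_dy_def a by (simp add: dlt_def)
qed

lemma std_at_multiples:
  assumes "modulus q" "k > 0"
  shows "std_x q k (2 * real n * compK q / k) = 2 * real n * (2 * compE q - compK q) / k"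
    and "std_y q k (2 * real n * compK q / k) = 0"
proof -
  have a: "am (k * (2 * real n * compK q / k) - compK q) q = - (pi / 2) + real n * pi"
    using am_values(3)[OF assms(1), of n] assms(2) by simp
  show "std_x q k (2 * real n * compK q / k) = 2 * real n * (2 * compE q - compK q) / k"
    unfolding std_x_def a ellE_multiples[OF assms(1)] using assms(2) by (simp add: field_simps)
  show "std_y q k (2 * real n * compK q / k) = 0"
    unfolding std_y_def cn_def a by (simp add: cos_diff)
qed

lemma std_y_zero:
  assumes "modulus q" "k > 0" "s > 0" "std_y q k s = 0"
  obtains n where "n \<ge> 1" "s = 2 * real n * compK q / k"
proof -
  have "cn (k * s - compK q) q = 0" using assms by (auto simp: std_y_def modulus_def)
  moreover have "- compK q \<le> k * s - compK q" using assms by simp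
  ultimately obtain n where n: "k * s - compK q = - compK q + 2 * real n * compK q"
    using cn_zero[OF assms(1)] by blast
  then have "s = 2 * real n * compK q / k" using assms(2) by (simp add: field_simps)
  moreover have "n \<noteq> 0"
  proof
    assume "n = 0"
    with n have "k * s = 0" by simp
    with assms(2,3) show False by simp
  qed
  ultimately show thesis by (intro that[of n]) auto
qed

section \<open>Complete elliptic integrals as functions of the modulus\<close>

lemma compE_def': "compE q = integral {0..pi/2} (dlt q)"
  unfolding compE_def ellE_def Let_def dlt_def by simp

lemma compK_def': "compK q = integral {0..pi/2} (\<lambda>x. 1 / dlt q x)"
  unfolding compK_def ellF_def Let_def dlt_def by simp

lemma integrable_01: "continuous_on {0..pi/2} f \<Longrightarrow> f integrable_on {0..pi/2::real}"
  for f :: "real \<Rightarrow> real"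
  by (rule integrable_continuous_real)

lemma compE_integral: "(dlt q has_integral compE q) {0..pi/2}"
  unfolding compE_def' by (intro integrable_integral integrable_01 dlt_continuous)

lemma compK_integral: "modulus q \<Longrightarrow> ((\<lambda>x. 1 / dlt q x) has_integral compK q) {0..pi/2}"
  unfolding compK_def' by (intro integrable_integral integrable_01 continuous_intros dlt_continuous)
    (simp add: dlt_nz)

text \<open>Both representations of \<open>E\<close> agree because \<open>q^2 sin x cos x / dlt\<close> is an antiderivative
  of the difference of the integrands and vanishes at both end points.\<close>

lemma compE_cubic:
  assumes q: "modulus q"
  shows "((\<lambda>x. 1 / dlt q x ^ 3) has_integral compE q / (1 - q^2)) {0..pi/2}"
proof -
  have d: "((\<lambda>x. q^2 * sin x * cos x / dlt q x) has_real_derivative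
      dlt q x - (1 - q^2) * (1 / dlt q x ^ 3)) (at x)" for x
  proof -
    have nz: "dlt q x \<noteq> 0" by (rule dlt_nz[OF q])
    define S C D where "S = sin x" and "C = cos x" and "D = dlt q x"
    note d = DERIV_divide[OF DERIV_mult[OF DERIV_cmult[OF DERIV_sin] DERIV_cos] dlt_deriv[OF q] nz,
        of "q^2", folded S_def C_def D_def]
    have C2: "C^2 = 1 - S^2" by (simp add: C_def S_def cos_squared_eq)
    have D2: "D^2 = 1 - q^2 * S^2" using dlt_sq[OF q] by (simp add: D_def S_def)
    have "((q^2 * C * C + - S * (q^2 * S)) * D - (q^2 * S * C) * - (q^2 * S * C / D)) / (D * D)
       = (q^2 * (C^2 - S^2) * D^2 + q^2 * q^2 * S^2 * C^2) / D ^ 3"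
      using nz by (simp add: D_def[symmetric] field_simps eval_nat_numeral)
    also have "q^2 * (C^2 - S^2) * D^2 + q^2 * q^2 * S^2 * C^2 = D^2 * D^2 - (1 - q^2)"
      unfolding C2 D2 by (simp add: algebra_simps)
    also have "(D^2 * D^2 - (1 - q^2)) / D ^ 3 = D - (1 - q^2) * (1 / D ^ 3)"
      using nz by (simp add: D_def[symmetric] field_simps eval_nat_numeral)
    finally show ?thesis using d unfolding D_def by simp
  qed
  have "((\<lambda>x. dlt q x - (1 - q^2) * (1 / dlt q x ^ 3)) has_integral
      q^2 * sin (pi/2) * cos (pi/2) / dlt q (pi/2) - q^2 * sin 0 * cos 0 / dlt q 0) {0..pi/2}"
  proof (rule fundamental_theorem_of_calculus)
    fix x show "((\<lambda>x. q^2 * sin x * cos x / dlt q x) has_vector_derivative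
      dlt q x - (1 - q^2) * (1 / dlt q x ^ 3)) (at x within {0..pi/2})"
      using has_field_derivative_at_within[OF d] by (simp only: has_real_derivative_iff_has_vector_derivative)
  qed simp
  then have "((\<lambda>x. dlt q x - (1 - q^2) * (1 / dlt q x ^ 3)) has_integral 0) {0..pi/2}" by simp
  moreover have "(dlt q has_integral compE q) {0..pi/2}"
    by (rule compE_integral)
  ultimately have "((\<lambda>x. dlt q x - (dlt q x - (1 - q^2) * (1 / dlt q x ^ 3))) has_integral compE q - 0) {0..pi/2}"
    by (intro has_integral_diff)
  then have "((\<lambda>x. (1 / (1 - q^2)) * ((1 - q^2) * (1 / dlt q x ^ 3))) has_integral (1 / (1 - q^2)) * compE q) {0..pi/2}"
    by (intro has_integral_mult_right) simp
  then show ?thesis using modulus_sq[OF q] by simp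
qed

lemma dlt_q_deriv: "modulus q \<Longrightarrow> ((\<lambda>q. dlt q x) has_real_derivative - (q * (sin x)^2 / dlt q x)) (at q)"
  unfolding dlt_def using dlt_arg_bounds(3)[of q x]
  by (auto intro!: derivative_eq_intros simp: field_simps)

lemma dlt_continuous2: "continuous_on S (\<lambda>z. dlt (fst z) (snd z))"
  unfolding dlt_def by (intro continuous_intros)

lemma parameter_deriv:
  fixes f f' :: "real \<Rightarrow> real \<Rightarrow> real"
  assumes "\<And>q x. modulus q \<Longrightarrow> ((\<lambda>q. f q x) has_real_derivative f' q x) (at q)"
    and "\<And>q. modulus q \<Longrightarrow> continuous_on {0..pi/2} (f q)"
    and "continuous_on ({q. modulus q} \<times> {0..pi/2}) (\<lambda>z. f' (fst z) (snd z))" and "modulus q"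
  shows "((\<lambda>q. integral {0..pi/2} (f q)) has_real_derivative integral {0..pi/2} (f' q)) (at q)"
proof -
  have "((\<lambda>q. integral (cbox 0 (pi/2)) (f q)) has_real_derivative integral (cbox 0 (pi/2)) (f' q)) (at q within {0<..<1})"
  proof (rule leibniz_rule_field_derivative)
    show "((\<lambda>q. f q x) has_real_derivative f' q x) (at q within {0<..<1})" if "q \<in> {0<..<1}" for q x
      using assms(1)[of q x] that by (auto simp: modulus_def intro: has_field_derivative_at_within)
    show "f q integrable_on cbox 0 (pi/2)" if "q \<in> {0<..<1}" for q
      using assms(2)[of q] that by (auto simp: modulus_def cbox_interval intro: integrable_01)
    have "{0<..<1} = {q. modulus q}" by (auto simp: modulus_def)
    then show "continuous_on ({0<..<1} \<times> cbox 0 (pi/2)) (\<lambda>(q, x). f' q x)"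
      using assms(3) by (simp add: case_prod_beta cbox_interval)
  qed (use assms(4) in \<open>auto simp: modulus_def\<close>)
  moreover have "at q within {0<..<1} = at q"
    using assms(4) by (intro at_within_open) (auto simp: modulus_def)
  ultimately show ?thesis by (simp add: cbox_interval)
qed

lemma compE_deriv:
  assumes q: "modulus q"
  shows "(compE has_real_derivative (compE q - compK q) / q) (at q)"
proof -
  have "((\<lambda>q. integral {0..pi/2} (dlt q)) has_real_derivative
      integral {0..pi/2} (\<lambda>x. - (q * (sin x)^2 / dlt q x))) (at q)"
    by (rule parameter_deriv[OF dlt_q_deriv _ _ q])
      (auto intro!: continuous_intros dlt_continuous dlt_continuous2 simp: dlt_nz)
  moreover have "integral {0..pi/2} (\<lambda>x. - (q * (sin x)^2 / dlt q x)) =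
      integral {0..pi/2} (\<lambda>x. (1 / q) * (dlt q x - 1 / dlt q x))"
    by (rule hk_integral_cong)
      (use q dlt_sq[OF q] dlt_nz[OF q] in \<open>auto simp: field_simps power2_eq_square modulus_def\<close>)
  moreover have "\<dots> = (1 / q) * (compE q - compK q)"
    unfolding compE_def' compK_def' integral_mult_right
    by (subst integral_diff) (auto intro!: integrable_01 continuous_intros dlt_continuous simp: dlt_nz[OF q])
  ultimately show ?thesis using q by (simp add: compE_def'[abs_def, symmetric] modulus_def)
qed

text \<open>Differentiating 1/Delta in the modulus brings in 1/Delta^3, whose integral is supplied
  by \<open>compE_cubic\<close>.\<close>

lemma compK_deriv:
  assumes q: "modulus q"
  shows "(compK has_real_derivative (compE q / (1 - q^2) - compK q) / q) (at q)"
proof -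
  have d: "((\<lambda>q. 1 / dlt q x) has_real_derivative q * (sin x)^2 / dlt q x ^ 3) (at q)" if "modulus q" for q x
    using dlt_nz[OF that, of x] dlt_pos[OF that, of x]
    by (auto intro!: derivative_eq_intros dlt_q_deriv that simp: field_simps eval_nat_numeral)
  have "((\<lambda>q. integral {0..pi/2} (\<lambda>x. 1 / dlt q x)) has_real_derivative
      integral {0..pi/2} (\<lambda>x. q * (sin x)^2 / dlt q x ^ 3)) (at q)"
    by (rule parameter_deriv[OF d _ _ q])
      (auto intro!: continuous_intros dlt_continuous dlt_continuous2 simp: dlt_nz)
  moreover have "integral {0..pi/2} (\<lambda>x. q * (sin x)^2 / dlt q x ^ 3) =
      integral {0..pi/2} (\<lambda>x. (1 / q) * (1 / dlt q x ^ 3 - 1 / dlt q x))"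
  proof (rule hk_integral_cong)
    fix x
    have "1 / dlt q x ^ 3 - 1 / dlt q x = (1 - (dlt q x)^2) / dlt q x ^ 3"
      using dlt_nz[OF q, of x] by (simp add: field_simps eval_nat_numeral)
    also have "\<dots> = q^2 * (sin x)^2 / dlt q x ^ 3" by (simp add: dlt_sq[OF q])
    finally show "q * (sin x)^2 / dlt q x ^ 3 = (1 / q) * (1 / dlt q x ^ 3 - 1 / dlt q x)"
      using q by (simp add: modulus_def power2_eq_square)
  qed
  moreover have "\<dots> = (1 / q) * (compE q / (1 - q^2) - compK q)"
    unfolding compK_def' integral_mult_right integral_unique[OF compE_cubic[OF q], symmetric]
    by (subst integral_diff) (auto intro!: integrable_01 continuous_intros dlt_continuous simp: dlt_nz[OF q])
  ultimately show ?thesis using q by (simp add: compK_def'[abs_def, symmetric] modulus_def)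
qed

text \<open>Minus the derivative of 2E - K, divided by q. It is isolated because it is the integral
  of a nonnegative function which increases pointwise with q, and this makes the monotonicity
  arguments below possible.\<close>

definition Spar :: "real \<Rightarrow> real" where
  "Spar q = ((2 * q^2 - 1) * compE q + (1 - q^2) * compK q) / (q^2 * (1 - q^2))"

lemma Spar_integral:
  assumes q: "modulus q"
  shows "((\<lambda>x. (sin x)^2 * (2 / dlt q x + 1 / dlt q x ^ 3)) has_integral Spar q) {0..pi/2}"
proof -
  note E = compE_integral[of q] and K = compK_integral[OF q]
  have "((\<lambda>x. (1 / q^2) * (1 / dlt q x ^ 3 + 1 / dlt q x - 2 * dlt q x)) has_integral
      (1 / q^2) * (compE q / (1 - q^2) + compK q - 2 * compE q)) {0..pi/2}"
    by (intro has_integral_mult_right has_integral_diff has_integral_add E K compE_cubic[OF q])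
  moreover have "(1 / q^2) * (compE q / (1 - q^2) + compK q - 2 * compE q) = Spar q"
    unfolding Spar_def using modulus_sq[OF q] by (simp add: field_simps)
  moreover have "(1 / q^2) * (1 / dlt q x ^ 3 + 1 / dlt q x - 2 * dlt q x) =
      (sin x)^2 * (2 / dlt q x + 1 / dlt q x ^ 3)" for x
  proof -
    define D where "D = dlt q x"
    have D: "D \<noteq> 0" "q^2 * (sin x)^2 = 1 - D^2" using dlt_nz[OF q] dlt_sq[OF q] by (auto simp: D_def)
    have "q^2 * ((sin x)^2 * (2 / D + 1 / D ^ 3)) = (1 - D^2) * (2 / D + 1 / D ^ 3)"
      unfolding D(2)[symmetric] by (simp add: mult.assoc)
    also have "\<dots> = 1 / D ^ 3 + 1 / D - 2 * D" using D(1) by (simp add: field_simps eval_nat_numeral)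
    finally show ?thesis using modulus_sq[OF q] unfolding D_def by (simp add: field_simps)
  qed
  ultimately show ?thesis by simp
qed

text \<open>Delta decreases as the modulus grows, so the integrand of \<open>Spar_integral\<close>
  grows pointwise.\<close>

lemma Spar_mono:
  assumes "modulus q" "modulus r" "q \<le> r"
  shows "Spar q \<le> Spar r"
proof (rule has_integral_le[OF Spar_integral[OF assms(1)] Spar_integral[OF assms(2)]])
  fix x
  have "q^2 \<le> r^2" using assms by (intro power_mono) (auto simp: modulus_def)
  then have "q^2 * (sin x)^2 \<le> r^2 * (sin x)^2" by (intro mult_right_mono) auto
  then have "dlt r x \<le> dlt q x" unfolding dlt_def by simp
  then show "(sin x)^2 * (2 / dlt q x + 1 / dlt q x ^ 3) \<le> (sin x)^2 * (2 / dlt r x + 1 / dlt r x ^ 3)"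
    using dlt_pos[OF assms(2), of x]
    by (intro mult_left_mono add_mono divide_left_mono power_mono) auto
qed

text \<open>By \<open>compE_cubic\<close>, E is the mean of the integrals of Delta and of (1 -
  q^2)/Delta^3. The inequality between arithmetic and geometric mean bounds the averaged integrand
  below by sqrt (1 - q^2)/Delta.\<close>

lemma compE_ge:
  assumes q: "modulus q"
  shows "sqrt (1 - q^2) * compK q \<le> compE q"
proof -
  note E = compE_integral[of q] and K = compK_integral[OF q]
  define c where "c = sqrt (1 - q^2)"
  have c: "c^2 = 1 - q^2" using modulus_sq[OF q] by (simp add: c_def)
  have "((\<lambda>x. (1/2) * (dlt q x + c^2 * (1 / dlt q x ^ 3))) has_integral (1/2) * (compE q + c^2 * (compE q / (1 - q^2)))) {0..pi/2}"
    by (intro has_integral_mult_right has_integral_add E compE_cubic[OF q])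
  moreover have "(1/2) * (compE q + c^2 * (compE q / (1 - q^2))) = compE q"
    unfolding c using modulus_sq[OF q] by simp
  ultimately have "((\<lambda>x. (1/2) * (dlt q x + c^2 * (1 / dlt q x ^ 3))) has_integral compE q) {0..pi/2}" by simp
  with has_integral_mult_right[OF K, of c] have "c * compK q \<le> compE q"
  proof (rule has_integral_le)
    fix x
    have p: "dlt q x > 0" by (rule dlt_pos[OF q])
    have "2 * (dlt q x)^2 * c \<le> (dlt q x)^2 * (dlt q x)^2 + c^2"
      using sum_squares_bound[of "(dlt q x)^2" c] by (simp add: power2_eq_square)
    then show "c * (1 / dlt q x) \<le> (1/2) * (dlt q x + c^2 * (1 / dlt q x ^ 3))"
      using p by (simp add: field_simps eval_nat_numeral)
  qed
  then show ?thesis by (simp add: c_def)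
qed

text \<open>\<open>dlt^2 - (1 - q^2/2) = (q^2/2) cos 2x\<close> integrates to zero,
  and \<open>1/dlt\<close> is larger where \<open>cos 2x\<close> is negative.\<close>

lemma compE_le:
  assumes q: "modulus q"
  shows "compE q \<le> (1 - q^2 / 2) * compK q"
proof -
  note E = compE_integral[of q] and K = compK_integral[OF q]
  define d where "d = sqrt (1 - q^2 / 2)"
  have q2: "0 < q^2" "q^2 < 1" using modulus_sq[OF q] by auto
  have d: "d > 0" "d^2 = 1 - q^2 / 2" using q2 by (auto simp: d_def)
  have "((\<lambda>x. dlt q x - d^2 * (1 / dlt q x)) has_integral compE q - d^2 * compK q) {0..pi/2}"
    by (intro has_integral_diff has_integral_mult_right E K)
  moreover have "((\<lambda>x. (1/d) * (q^2 / 2) * cos (2 * x)) has_integral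
     (1/d) * (q^2 / 2) * (sin (2 * (pi/2)) / 2) - (1/d) * (q^2 / 2) * (sin (2 * 0) / 2)) {0..pi/2}"
    using d by (intro fundamental_theorem_of_calculus)
      (auto intro!: derivative_eq_intros simp: has_real_derivative_iff_has_vector_derivative[symmetric])
  then have "((\<lambda>x. (1/d) * (q^2 / 2) * cos (2 * x)) has_integral 0) {0..pi/2}" by simp
  ultimately have "compE q - d^2 * compK q \<le> 0"
  proof (rule has_integral_le)
    fix x
    define D where "D = dlt q x"
    have D: "D > 0" using dlt_pos[OF q] by (simp add: D_def)
    have eq: "(q^2 / 2) * cos (2 * x) = D^2 - d^2"
      unfolding D_def dlt_sq[OF q] d(2) cos_double_sin by (simp add: field_simps)
    have "(D^2 - d^2) / D \<le> (D^2 - d^2) / d"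
    proof (cases "D \<le> d")
      case True
      then have "D^2 \<le> d^2" using D by (intro power_mono) auto
      then have "(d^2 - D^2) / d \<le> (d^2 - D^2) / D" using True D d by (intro divide_left_mono) auto
      then show ?thesis by (simp add: diff_divide_distrib)
    next
      case False
      then have "d^2 \<le> D^2" using d by (intro power_mono) auto
      then show ?thesis using False D d by (intro divide_left_mono) auto
    qed
    moreover have "(D^2 - d^2) / D = D - d^2 * (1 / D)" using D by (simp add: field_simps power2_eq_square)
    moreover have "(1/d) * (q^2 / 2) * cos (2 * x) = (D^2 - d^2) / d"
      unfolding eq[symmetric] by simp
    ultimately show "dlt q x - d^2 * (1 / dlt q x) \<le> (1/d) * (q^2 / 2) * cos (2 * x)"
      by (simp add: D_def)
  qed
  then show ?thesis by (simp add: d(2))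
qed

lemma compE_pos: "modulus q \<Longrightarrow> 0 < compE q"
  using compE_ge[of q] compK_pos[of q] modulus_sq[of q]
  by (smt (verit) mult_pos_pos real_sqrt_gt_zero)

lemma compE_le_half_pi:
  assumes q: "modulus q"
  shows "compE q \<le> pi / 2"
proof -
  have "(dlt q has_integral compE q) {0..pi/2}"
    by (rule compE_integral)
  moreover have "((\<lambda>x. 1::real) has_integral 1 * (pi/2 - 0)) {0..pi/2}"
    using has_integral_const_real[of "1::real" 0 "pi/2"] by simp
  ultimately have "compE q \<le> 1 * (pi/2 - 0)"
    by (rule has_integral_le) (rule dlt_le_1[OF q])
  then show ?thesis by simp
qed

text \<open>Delta^2 equals 1 - q^2 + q^2 cos^2 x, and cos x is at most pi/2 - x, so 1/Delta
  dominates a function with a logarithm as primitive. The purpose is that K tends to infinity at q =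
  1.\<close>

lemma compK_log_bound:
  assumes q: "modulus q"
  shows "ln (pi/2) - ln (1 - q^2) / 2 \<le> compK q"
proof -
  note K = compK_integral[OF q]
  define c where "c = sqrt (1 - q^2)"
  have q2: "0 < q^2" "q^2 < 1" using modulus_sq[OF q] by auto
  have c: "c > 0" "c^2 = 1 - q^2" using q2 by (auto simp: c_def)
  have "((\<lambda>x. 1 / (c + (pi/2 - x))) has_integral - ln (c + (pi/2 - pi/2)) - - ln (c + (pi/2 - 0))) {0..pi/2}"
    using c by (intro fundamental_theorem_of_calculus)
      (auto intro!: derivative_eq_intros simp: has_real_derivative_iff_has_vector_derivative[symmetric])
  then have "- ln (c + (pi/2 - pi/2)) - - ln (c + (pi/2 - 0)) \<le> compK q"
    using K
  proof (rule has_integral_le)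
    fix x assume x: "x \<in> {0..pi/2}"
    have "cos x = sin (pi/2 - x)" by (simp add: sin_diff)
    also have "\<bar>\<dots>\<bar> \<le> \<bar>pi/2 - x\<bar>" by (rule abs_sin_x_le_abs_x)
    finally have "(cos x)^2 \<le> (pi/2 - x)^2" by (simp add: abs_le_square_iff)
    moreover have "q^2 * (cos x)^2 \<le> 1 * (cos x)^2" using q2 by (intro mult_right_mono) auto
    moreover have "(dlt q x)^2 = c^2 + q^2 * (cos x)^2"
      unfolding dlt_sq[OF q] c(2) by (simp add: cos_squared_eq algebra_simps)
    moreover have "c^2 + (pi/2 - x)^2 \<le> (c + (pi/2 - x))^2" using c x by (simp add: power2_sum)
    ultimately have "(dlt q x)^2 \<le> (c + (pi/2 - x))^2" by linarith
    then have "dlt q x \<le> c + (pi/2 - x)" by (rule power2_le_imp_le) (use c x in auto)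
    then show "1 / (c + (pi/2 - x)) \<le> 1 / dlt q x"
      using dlt_pos[OF q, of x] by (intro divide_left_mono) auto
  qed
  then have "ln (c + pi/2) - ln c \<le> compK q" by simp
  moreover have "ln (pi/2) \<le> ln (c + pi/2)"
    using c pi_gt_zero by (intro ln_le_cancel_iff[THEN iffD2] add_pos_pos) auto
  moreover have "ln c = ln (1 - q^2) / 2" using q2 by (simp add: c_def ln_sqrt)
  ultimately show ?thesis by simp
qed

section \<open>Length and energy of an arch as functions of the modulus\<close>

text \<open>Minus the cosine of the tangent angle at the inflection points. A wavelike elastica of
  scale k is critical for \<open>lam = 2 * k^2 * wpar q\<close>, so \<open>lam > 0\<close> is what
  the inequality in \<open>wavelike\<close> below encodes.\<close>

definition wpar :: "real \<Rightarrow> real" where "wpar q = 2 * q^2 - 1"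
definition Npar :: "real \<Rightarrow> real" where "Npar q = 2 * compE q - compK q"

text \<open>One arch of modulus \<open>q\<close> has signed end-point distance \<open>ell_par q / sqrt lam\<close> and energy
  \<open>sqrt lam * en_par q\<close>; these are the functions called \<open>G\<close> and \<open>H\<close> in the introduction.\<close>

definition ell_par :: "real \<Rightarrow> real" where
  "ell_par q = 2 * sqrt 2 * (sqrt (wpar q) * Npar q)"

definition en_par :: "real \<Rightarrow> real" where
  "en_par q = 2 * sqrt 2 * (Npar q / sqrt (wpar q)) + 4 * sqrt 2 * (sqrt (wpar q) * compK q)"

definition wavelike :: "real \<Rightarrow> bool" where
  "wavelike q \<longleftrightarrow> modulus q \<and> 0 < wpar q"

lemma wavelikeD: "wavelike q \<Longrightarrow> modulus q" "wavelike q \<Longrightarrow> 0 < wpar q" "wavelike q \<Longrightarrow> 0 < q" "wavelike q \<Longrightarrow> q < 1"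
  by (auto simp: wavelike_def modulus_def)

text \<open>The square root is \<open>sqrt lam\<close> once \<open>lam = 2 * k^2 * wpar q\<close>;
  the right-hand side is the energy of one arch before k is eliminated. The same elimination is done
  for the distance in \<open>ell_par_scaled\<close>.\<close>

lemma en_par_scaled:
  assumes "wavelike q" "k > 0"
  shows "sqrt (2 * k^2 * wpar q) * en_par q = 4 * k * (2 * wpar q * compK q + Npar q)"
proof -
  define v where "v = sqrt (wpar q)"
  have v: "v > 0" "v * v = wpar q" using wavelikeD(2)[OF assms(1)] by (auto simp: v_def)
  have "sqrt (2 * k^2 * wpar q) * en_par q
    = (sqrt 2 * sqrt 2) * k * (2 * Npar q + 4 * (v * v) * compK q)"
    using v(1) assms(2) unfolding en_par_def v_def[symmetric]
    by (simp add: real_sqrt_mult v_def[symmetric] field_simps)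
  then show ?thesis by (simp add: v(2) algebra_simps)
qed

lemma ell_par_scaled:
  assumes "wavelike q" "k > 0"
  shows "k * \<bar>ell_par q\<bar> = sqrt (2 * k^2 * wpar q) * (2 * \<bar>Npar q\<bar>)"
  using wavelikeD(2)[OF assms(1)] assms(2) by (simp add: ell_par_def real_sqrt_mult abs_mult)

lemma wpar_mono: "0 < q \<Longrightarrow> q \<le> r \<Longrightarrow> wpar q \<le> wpar r"
  by (simp add: wpar_def power_mono)

lemma wpar_strict_mono: "0 < q \<Longrightarrow> q < r \<Longrightarrow> wpar q < wpar r"
  by (simp add: wpar_def power_strict_mono)

lemma wavelike_between: "wavelike q \<Longrightarrow> q \<le> r \<Longrightarrow> r < 1 \<Longrightarrow> wavelike r"
  using wpar_mono[of q r] by (auto simp: wavelike_def modulus_def)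

text \<open>Turns the equation \<open>gpar q = c\<close> into one for \<open>ell_par\<close>:
  \<open>q2\<close> solves it with value \<open>sqrt c\<close>, \<open>q3\<close> with value
  \<open>- sqrt c\<close>, on the two sides of the sign change at \<open>q_star\<close>.\<close>

lemma gpar_eq:
  assumes "0 \<le> wpar q"
  shows "gpar q = (ell_par q)^2"
  using assms by (simp add: gpar_def ell_par_def power_mult_distrib Npar_def wpar_def)

lemma Npar_deriv:
  assumes q: "modulus q"
  shows "(Npar has_real_derivative - (q * Spar q)) (at q)"
proof -
  have "(Npar has_real_derivative 2 * ((compE q - compK q) / q) - (compE q / (1 - q^2) - compK q) / q) (at q)"
    unfolding Npar_def[abs_def] by (intro DERIV_diff DERIV_cmult compE_deriv compK_deriv q)
  moreover have "2 * ((compE q - compK q) / q) - (compE q / (1 - q^2) - compK q) / q = - (q * Spar q)"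
  proof -
    have "q \<noteq> 0" "1 - q^2 \<noteq> 0" using q modulus_sq[OF q] by (auto simp: modulus_def)
    then show ?thesis unfolding Spar_def by (simp add: field_simps power2_eq_square)
  qed
  ultimately show ?thesis by simp
qed

lemma Spar_pos: "modulus q \<Longrightarrow> 0 \<le> wpar q \<Longrightarrow> 0 < Spar q"
  unfolding Spar_def wpar_def using modulus_sq[of q] compE_pos[of q] compK_pos[of q]
  by (intro divide_pos_pos add_nonneg_pos mult_pos_pos mult_nonneg_nonneg) auto

lemma sqrt_wpar_deriv:
  assumes "wavelike q"
  shows "((\<lambda>q. sqrt (wpar q)) has_real_derivative 2 * q / sqrt (wpar q)) (at q)"
proof -
  have "(wpar has_real_derivative 4 * q) (at q)"
    unfolding wpar_def[abs_def] by (auto intro!: derivative_eq_intros)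
  from DERIV_chain2[OF DERIV_real_sqrt[OF wavelikeD(2)[OF assms]] this]
  show ?thesis by (rule DERIV_cong) (simp add: field_simps)
qed

text \<open>The factor that carries the sign of the derivative of \<open>ell_par\<close>. By
  \<open>fpar_eq\<close> it has the sign of \<open>fpar\<close>, and it is manifestly decreasing:
  \<open>Npar\<close> falls while \<open>wpar\<close> and \<open>Spar\<close> grow.\<close>

definition Phi :: "real \<Rightarrow> real" where "Phi q = 2 * Npar q - wpar q * Spar q"

definition dell :: "real \<Rightarrow> real" where "dell q = 2 * sqrt 2 * (q * Phi q / sqrt (wpar q))"

lemma ell_par_deriv:
  assumes w: "wavelike q"
  shows "(ell_par has_real_derivative dell q) (at q)"
proof -
  have s: "sqrt (wpar q) > 0" "sqrt (wpar q) * sqrt (wpar q) = wpar q" using wavelikeD(2)[OF w] by auto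
  have "(ell_par has_real_derivative 2 * sqrt 2 * (2 * q / sqrt (wpar q) * Npar q + (- (q * Spar q)) * sqrt (wpar q))) (at q)"
    unfolding ell_par_def[abs_def]
    by (intro DERIV_cmult DERIV_mult sqrt_wpar_deriv Npar_deriv w wavelikeD(1)[OF w])
  moreover have "2 * q / sqrt (wpar q) * Npar q + (- (q * Spar q)) * sqrt (wpar q) = q * Phi q / sqrt (wpar q)"
    unfolding Phi_def using s by (simp add: field_simps)
  ultimately show ?thesis by (simp add: dell_def)
qed

text \<open>With force \<open>F = - 2 * e * k^2\<close> and \<open>lam = 2 * k^2 * wpar q\<close>,
  the slope \<open>- 1 / wpar q\<close> of energy against distance is \<open>e * F / lam\<close>,
  the rescaled end force.\<close>

lemma en_par_deriv:
  assumes w: "wavelike q"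
  shows "(en_par has_real_derivative - dell q / wpar q) (at q)"
proof -
  define s where "s = sqrt (wpar q)"
  have s: "s > 0" "wpar q = s * s" using wavelikeD(2)[OF w] by (auto simp: s_def)
  have q: "modulus q" "q > 0" "1 - q^2 \<noteq> 0" using wavelikeD[OF w] modulus_sq[of q] by auto
  \<comment> \<open>Writing the derivative of K by means of \<open>Spar\<close> lets all terms
    recombine into \<open>Phi\<close>.\<close>
  have "((compE q / (1 - q^2) - compK q) / q) * (s * s) = q * Spar q - 2 * q * compK q"
    unfolding s(2)[symmetric] wpar_def Spar_def using q by (simp add: field_simps power2_eq_square)
  then have K: "(compE q / (1 - q^2) - compK q) / q = (q * Spar q - 2 * q * compK q) / (s * s)"
    using s by (simp add: field_simps)
  have 1: "((\<lambda>q. Npar q / sqrt (wpar q)) has_real_derivative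
      (- (q * Spar q) * s - Npar q * (2 * q / s)) / (s * s)) (at q)"
    unfolding s_def by (rule DERIV_divide[OF Npar_deriv[OF q(1)] sqrt_wpar_deriv[OF w]])
      (use wavelikeD(2)[OF w] in simp)
  have 2: "((\<lambda>q. sqrt (wpar q) * compK q) has_real_derivative
      2 * q / s * compK q + (q * Spar q - 2 * q * compK q) / (s * s) * s) (at q)"
    unfolding K[symmetric] unfolding s_def by (rule DERIV_mult[OF sqrt_wpar_deriv[OF w] compK_deriv[OF q(1)]])
  have "(- (q * Spar q) * s - Npar q * (2 * q / s)) / (s * s)
      + 2 * (2 * q / s * compK q + (q * Spar q - 2 * q * compK q) / (s * s) * s)
      = - (q * Phi q / s) / (s * s)"
    unfolding Phi_def s(2) using s(1) by (simp add: field_simps)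
  note eq = arg_cong[OF this, of "\<lambda>z. 2 * sqrt 2 * z"]
  show ?thesis
    unfolding en_par_def[abs_def] dell_def s_def[symmetric] unfolding s(2)
    by (rule DERIV_cong[OF DERIV_add[OF DERIV_cmult[OF 1] DERIV_cmult[OF 2]]])
      (use eq in \<open>simp add: distrib_left mult.assoc\<close>)
qed

section \<open>Monotonicity of \<open>Npar\<close> and \<open>Phi\<close> in the modulus\<close>

lemma Npar_strict_antimono:
  assumes "modulus q" "0 \<le> wpar q" "q < r" "r < 1"
  shows "Npar r < Npar q"
proof (rule DERIV_neg_imp_decreasing[OF assms(3)])
  fix x assume x: "q \<le> x" "x \<le> r"
  then have m: "modulus x" "0 \<le> wpar x" using assms wpar_mono[of q x] by (auto simp: modulus_def)
  then show "\<exists>y. (Npar has_real_derivative y) (at x) \<and> y < 0"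
    using Npar_deriv[OF m(1)] Spar_pos[OF m] by (intro exI[of _ "- (x * Spar x)"]) (auto simp: modulus_def)
qed

lemma Phi_strict_antimono:
  assumes "modulus q" "0 \<le> wpar q" "q < r" "r < 1"
  shows "Phi r < Phi q"
proof -
  have r: "modulus r" using assms by (auto simp: modulus_def)
  have "wpar q * Spar q \<le> wpar r * Spar r"
    using assms wpar_mono[of q r] Spar_mono[OF assms(1) r] Spar_pos[OF assms(1,2)]
    by (intro mult_mono) (auto simp: modulus_def)
  then show ?thesis using Npar_strict_antimono[OF assms] by (simp add: Phi_def)
qed

lemma fpar_eq: "modulus q \<Longrightarrow> fpar q = q^2 * (1 - q^2) * Phi q"
proof -
  assume q: "modulus q"
  have n: "q^2 * (1 - q^2) \<noteq> 0" using modulus_sq[OF q] by auto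
  have dS: "q^2 * (1 - q^2) * Spar q = (2 * q^2 - 1) * compE q + (1 - q^2) * compK q"
    unfolding Spar_def using n by simp
  have "q^2 * (1 - q^2) * Phi q = 2 * q^2 * (1 - q^2) * Npar q - wpar q * (q^2 * (1 - q^2) * Spar q)"
    by (simp add: Phi_def algebra_simps)
  note this[unfolded dS]
  then show ?thesis
    unfolding fpar_def Npar_def wpar_def by (simp add: algebra_simps power2_eq_square eval_nat_numeral)
qed

text \<open>\<open>compE_ge\<close> gives E > K/2 as soon as sqrt (1 - q^2) > 1/2. This is the
  source of the bound \<open>1/2 \<le> wpar q_star\<close>.\<close>

lemma Npar_pos_small:
  assumes "modulus q" "q^2 < 3/4"
  shows "0 < Npar q"
proof -
  have "sqrt (1/4) < sqrt (1 - q^2)" using assms(2) by (intro real_sqrt_less_mono) simp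
  then have "1/2 < sqrt (1 - q^2)" by (simp add: real_sqrt_divide)
  then have "1/2 * compK q < sqrt (1 - q^2) * compK q"
    using compK_pos[OF assms(1)] by (intro mult_strict_right_mono)
  then show ?thesis using compE_ge[OF assms(1)] by (simp add: Npar_def)
qed

lemma Npar_unbounded:
  assumes a: "a < 1"
  obtains q where "modulus q" "a < q" "Npar q < C"
proof -
  \<comment> \<open>Chosen so that pi - (ln (pi/2) + D) = C - 1, where pi bounds 2E from
    above.\<close>
  define D where "D = pi - ln (pi/2) - C + 1"
  \<comment> \<open>The complement 1 - q^2. The exponential makes K large, the last entry puts q
    beyond a, and the halving makes the comparison with a strict.\<close>
  define e where "e = min (min (exp (- 2 * \<bar>D\<bar>)) (1/2)) (1 - (max a 0)^2) / 2"
  have a2: "(max a 0)^2 < 1" using a by (simp add: abs_square_less_1)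
  have e: "0 < e" "e < 1" "e \<le> exp (- 2 * \<bar>D\<bar>)" "e < 1 - (max a 0)^2"
    unfolding e_def using a2 by (auto simp: min_def field_simps)
  define q where "q = sqrt (1 - e)"
  have q2: "q^2 = 1 - e" using e by (simp add: q_def)
  have q: "modulus q" using e by (auto simp: modulus_def q_def)
  have "(max a 0)^2 < q^2" using e q2 by simp
  then have "max a 0 < q" by (rule power2_less_imp_less) (use q in \<open>simp add: modulus_def\<close>)
  then have aq: "a < q" by simp
  have "ln e \<le> ln (exp (- 2 * \<bar>D\<bar>))" using e by (intro ln_le_cancel_iff[THEN iffD2]) auto
  then have "ln e \<le> - 2 * \<bar>D\<bar>" by simp
  then have "ln (pi/2) + \<bar>D\<bar> \<le> compK q" using compK_log_bound[OF q] unfolding q2 by simp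
  then have "Npar q < C" using compE_le_half_pi[OF q] unfolding Npar_def D_def by linarith
  from that[OF q aq this] show thesis .
qed

lemma modulus_continuous:
  fixes f f' :: "real \<Rightarrow> real"
  assumes "\<And>q. modulus q \<Longrightarrow> (f has_real_derivative f' q) (at q)" "{a..b} \<subseteq> {q. modulus q}"
  shows "continuous_on {a..b} f"
proof (rule continuous_at_imp_continuous_on, rule ballI)
  fix x assume "x \<in> {a..b}"
  then have "modulus x" using assms(2) by auto
  then show "isCont f x" by (rule DERIV_isCont[OF assms(1)])
qed

lemma
  assumes "{a..b} \<subseteq> {q. modulus q}"
  shows Npar_continuous: "continuous_on {a..b} Npar"
    and compE_continuous: "continuous_on {a..b} compE"
    and compK_continuous: "continuous_on {a..b} compK"
  by (rule modulus_continuous[OF _ assms], erule Npar_deriv compE_deriv compK_deriv)+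

section \<open>The sign changes \<open>q_star\<close> and \<open>q_hat\<close>\<close>

lemma half_sqrt: "modulus (1 / sqrt 2)" "wpar (1 / sqrt 2) = 0"
  by (auto simp: modulus_def wpar_def power_divide)

lemma ge_half_sqrt_iff: "0 < q \<Longrightarrow> 1 / sqrt 2 \<le> q \<longleftrightarrow> 0 \<le> wpar q"
proof -
  assume q: "0 < q"
  have "1 / sqrt 2 \<le> q \<longleftrightarrow> (1 / sqrt 2)^2 \<le> q^2" using q by (simp add: abs_le_square_iff[symmetric])
  then show ?thesis by (simp add: wpar_def power_divide mult.commute)
qed

text \<open>Strict decrease of \<open>Npar\<close> is available only where \<open>wpar\<close> is
  nonnegative. For smaller moduli \<open>Npar_pos_small\<close> gives positivity directly, so the
  sign pattern holds on all of (0,1).\<close>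

lemma q_star_props:
  shows "modulus q_star" "Npar q_star = 0" "1/2 \<le> wpar q_star"
    "\<And>q. modulus q \<Longrightarrow> q < q_star \<Longrightarrow> 0 < Npar q" "\<And>q. q_star < q \<Longrightarrow> q < 1 \<Longrightarrow> Npar q < 0"
proof -
  obtain b where b: "modulus b" "1 / sqrt 2 < b" "Npar b < 0"
    using Npar_unbounded[of "1 / sqrt 2" 0] half_sqrt by (auto simp: modulus_def)
  have sub: "{1 / sqrt 2..b} \<subseteq> {q. modulus q}"
    using b(1) by (auto simp: modulus_def intro: less_le_trans[of 0 "1 / sqrt 2"])
  have p: "0 < Npar (1 / sqrt 2)" by (rule Npar_pos_small[OF half_sqrt(1)]) (simp add: power_divide)
  have "\<exists>x\<ge>1 / sqrt 2. x \<le> b \<and> Npar x = 0"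
    by (rule IVT2'[OF _ _ _ Npar_continuous[OF sub]]) (use b p in auto)
  then obtain x where x: "1 / sqrt 2 \<le> x" "x \<le> b" "Npar x = 0" by blast
  have mx: "modulus x" using x sub by auto
  have ge: "3/4 \<le> r^2" if "modulus r" "Npar r \<le> 0" for r
    using Npar_pos_small[OF that(1)] that(2) by force
  have wx: "1/2 \<le> wpar x" using ge[OF mx] x by (simp add: wpar_def)
  have neg: "Npar r < 0" if "x < r" "r < 1" for r
    using Npar_strict_antimono[OF mx _ that] wx x by simp
  have pos: "0 < Npar r" if "modulus r" "r < x" for r
  proof (rule ccontr)
    assume n: "\<not> 0 < Npar r"
    then have "0 \<le> wpar r" using ge[OF that(1)] by (simp add: wpar_def)
    then show False using Npar_strict_antimono[OF that(1) _ that(2)] mx x n by (simp add: modulus_def)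
  qed
  have "q_star = x"
    unfolding q_star_def
  proof (rule the_equality)
    show "0 < x \<and> x < 1 \<and> 2 * compE x - compK x = 0" using mx x by (auto simp: modulus_def Npar_def)
    fix r assume r: "0 < r \<and> r < 1 \<and> 2 * compE r - compK r = 0"
    then have "modulus r" "Npar r = 0" by (auto simp: modulus_def Npar_def)
    then show "r = x" using neg[of r] pos[of r] r by (cases r x rule: linorder_cases) auto
  qed
  then show "modulus q_star" "Npar q_star = 0" "1/2 \<le> wpar q_star"
    "\<And>q. modulus q \<Longrightarrow> q < q_star \<Longrightarrow> 0 < Npar q" "\<And>q. q_star < q \<Longrightarrow> q < 1 \<Longrightarrow> Npar q < 0"
    using mx x wx pos neg by auto
qed

lemma wavelike_q_star: "wavelike q_star"
  using q_star_props by (simp add: wavelike_def)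

text \<open>At 1/sqrt 2 the negative term of \<open>Phi\<close> vanishes because \<open>wpar\<close>
  does, at \<open>q_star\<close> the positive one because \<open>Npar\<close> does. Hence a sign
  change in between, unique by monotonicity.\<close>

lemma q_hat_props:
  shows "wavelike q_hat" "q_hat < q_star"
    "\<And>q. wavelike q \<Longrightarrow> q < q_hat \<Longrightarrow> 0 < Phi q" "\<And>q. q_hat < q \<Longrightarrow> q < 1 \<Longrightarrow> Phi q < 0"
proof -
  let ?a = "1 / sqrt 2 :: real"
  have le: "?a < q_star"
    using ge_half_sqrt_iff[of q_star] q_star_props(1,3) half_sqrt(2)
    by (cases "?a = q_star") (auto simp: modulus_def)
  have sub: "{?a..q_star} \<subseteq> {q. modulus q}"
    using q_star_props(1) by (auto simp: modulus_def intro: less_le_trans[of 0 "1 / sqrt 2"])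
  have nz: "q^2 * (1 - q^2) \<noteq> 0" if "q \<in> {?a..q_star}" for q
    using sub that modulus_sq[of q] by auto
  have c: "continuous_on {?a..q_star} Phi"
    unfolding Phi_def[abs_def] Spar_def wpar_def
    using nz by (intro continuous_intros Npar_continuous compE_continuous compK_continuous sub) auto
  have p: "0 < Phi ?a"
    using q_star_props(4)[OF half_sqrt(1) le] by (simp add: Phi_def half_sqrt(2))
  have n: "Phi q_star < 0"
    using q_star_props(2,3) Spar_pos[OF q_star_props(1)] by (simp add: Phi_def)
  have "\<exists>x\<ge>?a. x \<le> q_star \<and> Phi x = 0"
    by (rule IVT2'[OF _ _ _ c]) (use p n le in auto)
  then obtain x where x: "?a \<le> x" "x \<le> q_star" "Phi x = 0" by blast
  then have x': "?a < x" "x < q_star" using p n by (auto simp: less_le)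
  have mx: "modulus x" using sub x by auto
  have wx: "0 < wpar x" using wpar_strict_mono[OF _ x'(1)] half_sqrt by (simp add: modulus_def)
  have neg: "Phi r < 0" if "x < r" "r < 1" for r
    using Phi_strict_antimono[OF mx _ that] wx x by simp
  have pos: "0 < Phi r" if "modulus r" "0 \<le> wpar r" "r < x" for r
    using Phi_strict_antimono[OF that] mx x by (simp add: modulus_def)
  have "q_hat = x"
    unfolding q_hat_def
  proof (rule the_equality)
    show "?a \<le> x \<and> x < 1 \<and> fpar x = 0" using x mx fpar_eq[OF mx] by (auto simp: modulus_def)
    fix r assume r: "?a \<le> r \<and> r < 1 \<and> fpar r = 0"
    then have "0 < r" by (auto intro: less_le_trans[of 0 ?a])
    then have mr: "modulus r" "0 \<le> wpar r" using r ge_half_sqrt_iff[of r] by (auto simp: modulus_def)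
    then have "Phi r = 0" using r fpar_eq[OF mr(1)] modulus_sq[OF mr(1)] by auto
    then show "r = x" using neg[of r] pos[of r] r mr by (cases r x rule: linorder_cases) auto
  qed
  then show "wavelike q_hat" "q_hat < q_star"
    "\<And>q. wavelike q \<Longrightarrow> q < q_hat \<Longrightarrow> 0 < Phi q" "\<And>q. q_hat < q \<Longrightarrow> q < 1 \<Longrightarrow> Phi q < 0"
    using mx wx x' neg pos by (auto simp: wavelike_def)
qed

section \<open>Monotonicity of the end-point distance and of the energy\<close>

lemma wavelike_isCont: "wavelike q \<Longrightarrow> isCont ell_par q" "wavelike q \<Longrightarrow> isCont en_par q"
  using DERIV_isCont ell_par_deriv en_par_deriv by blast+

lemma ell_par_zero: "ell_par q_star = 0"
  by (simp add: ell_par_def q_star_props)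

lemma ell_par_pos: "wavelike q \<Longrightarrow> q < q_star \<Longrightarrow> 0 < ell_par q"
  using q_star_props(4)[of q] by (simp add: ell_par_def wavelike_def)

lemma ell_par_neg: "q_star < q \<Longrightarrow> q < 1 \<Longrightarrow> ell_par q < 0"
  using q_star_props(5)[of q] wavelikeD(2)[OF wavelike_between[OF wavelike_q_star, of q]]
  by (simp add: ell_par_def mult_pos_neg)

text \<open>Since \<open>en_par' = - ell_par' / wpar\<close>, the sum \<open>en_par + ell_par / wpar q0\<close> has derivative
  \<open>ell_par' * (1 / wpar q0 - 1 / wpar r)\<close>, whose sign is known on each side of \<open>q_hat\<close>.\<close>

lemma en_plus_deriv:
  assumes "wavelike r" "c > 0"
  shows "((\<lambda>r. en_par r + ell_par r / c) has_real_derivative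
     dell r * (1 / c - 1 / wpar r)) (at r)"
proof -
  have "((\<lambda>r. en_par r + ell_par r / c) has_real_derivative
     - dell r / wpar r + dell r / c) (at r)"
    by (intro DERIV_add DERIV_cdivide en_par_deriv ell_par_deriv assms)
  then show ?thesis by (rule DERIV_cong) (simp add: right_diff_distrib)
qed

lemma wavelike_antimono:
  fixes f f' :: "real \<Rightarrow> real"
  assumes "wavelike a" "a < b" "b < 1"
    and "\<And>q. wavelike q \<Longrightarrow> (f has_real_derivative f' q) (at q)"
    and "\<And>q. wavelike q \<Longrightarrow> a < q \<Longrightarrow> q < b \<Longrightarrow> f' q < 0"
  shows "f b < f a"
proof (rule DERIV_neg_imp_decreasing_open[OF assms(2)])
  fix x assume x: "a < x" "x < b"
  then have "wavelike x" using wavelike_between[OF assms(1), of x] assms(3) by simp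
  then show "\<exists>y. DERIV f x :> y \<and> y < 0" using assms(4,5) x by blast
next
  show "continuous_on {a..b} f"
  proof (rule continuous_at_imp_continuous_on, rule ballI)
    fix x assume "x \<in> {a..b}"
    then have "wavelike x" using wavelike_between[OF assms(1), of x] assms(3) by simp
    then show "isCont f x" by (rule DERIV_isCont[OF assms(4)])
  qed
qed

lemma dell_pos: "wavelike q \<Longrightarrow> q < q_hat \<Longrightarrow> 0 < dell q"
  using q_hat_props(3)[of q] wavelikeD[of q] by (simp add: dell_def)

lemma dell_neg: "q_hat < q \<Longrightarrow> q < 1 \<Longrightarrow> dell q < 0"
  using q_hat_props(4)[of q] wavelikeD[OF wavelike_between[OF q_hat_props(1), of q]]
  by (simp add: dell_def divide_neg_pos mult_pos_neg)

lemma wavelike_ge_hat: "q_hat \<le> q \<Longrightarrow> q < 1 \<Longrightarrow> wavelike q"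
  by (rule wavelike_between[OF q_hat_props(1)])

lemma ell_par_antimono: "q_hat \<le> a \<Longrightarrow> a < b \<Longrightarrow> b < 1 \<Longrightarrow> ell_par b < ell_par a"
  by (rule wavelike_antimono[OF _ _ _ ell_par_deriv]) (auto intro: wavelike_ge_hat dell_neg)

lemma ell_par_less_iff:
  assumes "q_hat \<le> a" "a < 1" "q_hat \<le> b" "b < 1"
  shows "ell_par a < ell_par b \<longleftrightarrow> b < a"
  using ell_par_antimono[OF assms(1) _ assms(4)] ell_par_antimono[OF assms(3) _ assms(2)]
  by (smt (verit, best))

lemma ell_par_inj:
  assumes "q_hat \<le> a" "a < 1" "q_hat \<le> b" "b < 1" "ell_par a = ell_par b"
  shows "a = b"
  using ell_par_less_iff[OF assms(1-4)] ell_par_less_iff[OF assms(3,4,1,2)] assms(5) by simp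

lemma ell_par_mono:
  assumes "wavelike a" "a < b" "b \<le> q_hat"
  shows "ell_par a < ell_par b"
proof -
  have "- ell_par b < - ell_par a"
    by (rule wavelike_antimono[OF assms(1,2) _ DERIV_minus[OF ell_par_deriv]])
      (use assms wavelikeD(4)[OF q_hat_props(1)] in \<open>auto intro: dell_pos\<close>)
  then show ?thesis by simp
qed

lemma en_par_mono:
  assumes "q_hat \<le> a" "a < b" "b < 1"
  shows "en_par a < en_par b"
proof -
  have "- en_par b < - en_par a"
  proof (rule wavelike_antimono[OF _ assms(2,3) DERIV_minus[OF en_par_deriv]])
    show "wavelike a" using assms by (intro wavelike_ge_hat) auto
    fix q assume q: "wavelike q" "a < q" "q < b"
    have "dell q / wpar q < 0"
      by (rule divide_neg_pos[OF dell_neg wavelikeD(2)[OF q(1)]]) (use q assms in auto)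
    then show "- (- dell q / wpar q) < 0" by simp
  qed auto
  then show ?thesis by simp
qed

text \<open>Tangent-line comparison with the weight frozen at a modulus to the left:
  \<open>dell\<close> is negative beyond \<open>q_hat\<close>, and the bracket of
  \<open>en_plus_deriv\<close> is positive.\<close>

lemma en_plus_antimono:
  assumes "q_hat \<le> r" "r \<le> a" "a < b" "b < 1"
  shows "en_par b + ell_par b / wpar r < en_par a + ell_par a / wpar r"
proof -
  have wr: "wavelike r" and wa: "wavelike a" using assms by (auto intro!: wavelike_ge_hat)
  show ?thesis
  proof (rule wavelike_antimono[OF wa assms(3,4) en_plus_deriv[OF _ wavelikeD(2)[OF wr]]])
    fix q assume q: "wavelike q" "a < q" "q < b"
    have "wpar r < wpar q" using wpar_strict_mono wavelikeD(3)[OF wr] q assms by simp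
    then have "0 < 1 / wpar r - 1 / wpar q" using wavelikeD(2)[OF wr] by (simp add: frac_less2)
    then show "dell q * (1 / wpar r - 1 / wpar q) < 0"
      using dell_neg[of q] q assms by (intro mult_neg_pos) auto
  qed auto
qed

text \<open>With the weight frozen at \<open>q_hat\<close>, both factors of the derivative change
  sign there, so the product stays negative across \<open>q_hat\<close>. This compares energies of
  equal distance on the two sides of the maximum of \<open>ell_par\<close>.\<close>

lemma en_plus_antimono_hat:
  assumes "wavelike a" "a < b" "b < 1"
  shows "en_par b + ell_par b / wpar q_hat < en_par a + ell_par a / wpar q_hat"
proof -
  let ?f = "\<lambda>q. en_par q + ell_par q / wpar q_hat"
  have w: "wpar q_hat > 0" by (rule wavelikeD(2)[OF q_hat_props(1)])
  have left: "?f b < ?f a" if "wavelike a" "a < b" "b \<le> q_hat" for a b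
  proof (rule wavelike_antimono[OF that(1,2) _ en_plus_deriv[OF _ w]])
    show "b < 1" using that wavelikeD(4)[OF q_hat_props(1)] by simp
    fix q assume q: "wavelike q" "a < q" "q < b"
    have "wpar q < wpar q_hat" using wpar_strict_mono wavelikeD(3)[OF q(1)] q that by simp
    then have "1 / wpar q_hat - 1 / wpar q < 0" using wavelikeD(2)[OF q(1)] by (simp add: frac_less2)
    then show "dell q * (1 / wpar q_hat - 1 / wpar q) < 0"
      using dell_pos[of q] q that by (intro mult_pos_neg) auto
  qed
  note right = en_plus_antimono[OF order_refl]
  consider "b \<le> q_hat" | "q_hat \<le> a" | "a < q_hat" "q_hat < b" by linarith
  then show ?thesis
  proof cases
    case 3
    then have "?f q_hat < ?f a" "?f b < ?f q_hat" using left[OF assms(1)] right assms by auto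
    then show ?thesis by linarith
  qed (use left right assms in auto)
qed

text \<open>This is the Legendre transform of the energy in the distance. The derivative of
  \<open>ell_par\<close> cancels and the sign is that of \<open>- ell_par\<close>, so the transform
  has its minimum exactly at \<open>q_star\<close>.\<close>

lemma en_legendre_deriv:
  assumes w: "wavelike q"
  shows "((\<lambda>q. en_par q + ell_par q / wpar q) has_real_derivative - (4 * q * ell_par q / (wpar q)^2)) (at q)"
proof -
  have p: "wpar q > 0" by (rule wavelikeD(2)[OF w])
  have dw: "(wpar has_real_derivative 4 * q) (at q)"
    unfolding wpar_def[abs_def] by (auto intro!: derivative_eq_intros)
  have "((\<lambda>q. en_par q + ell_par q / wpar q) has_real_derivative
     - dell q / wpar q
     + (dell q * wpar q - ell_par q * (4 * q)) / (wpar q * wpar q)) (at q)"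
    by (rule DERIV_add[OF en_par_deriv[OF w] DERIV_divide[OF ell_par_deriv[OF w] dw]]) (use p in simp)
  then show ?thesis by (rule DERIV_cong) (use p in \<open>simp add: field_simps power2_eq_square\<close>)
qed

lemma en_legendre_less:
  assumes "wavelike q" "q < q_star"
  shows "en_par q_star < en_par q + ell_par q / wpar q"
proof -
  have "en_par q_star + ell_par q_star / wpar q_star < en_par q + ell_par q / wpar q"
  proof (rule wavelike_antimono[OF assms(1,2) _ en_legendre_deriv])
    show "q_star < 1" using q_star_props(1) by (simp add: modulus_def)
    fix r assume r: "wavelike r" "q < r" "r < q_star"
    then show "- (4 * r * ell_par r / (wpar r)^2) < 0"
      using ell_par_pos[of r] wavelikeD[OF r(1)] by simp
  qed auto
  then show ?thesis by (simp add: ell_par_zero)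
qed

lemma en_legendre_greater:
  assumes "q_star < q" "q < 1"
  shows "en_par q_star < en_par q + ell_par q / wpar q"
proof -
  have "- (en_par q + ell_par q / wpar q) < - (en_par q_star + ell_par q_star / wpar q_star)"
  proof (rule wavelike_antimono[OF wavelike_q_star assms DERIV_minus[OF en_legendre_deriv]])
    fix r assume r: "wavelike r" "q_star < r" "r < q"
    then show "- (- (4 * r * ell_par r / (wpar r)^2)) < 0"
      using ell_par_neg[of r] wavelikeD[OF r(1)] by (auto intro!: divide_neg_pos mult_pos_neg)
  qed auto
  then show ?thesis by (simp add: ell_par_zero)
qed

text \<open>The energy identity \<open>2 * lam * L - F * l\<close> for a single arch: the right-hand
  side is \<open>2 * sqrt lam\<close> times the length of the arch.\<close>

lemma en_minus:
  assumes "wavelike q"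
  shows "en_par q - ell_par q / wpar q = 4 * sqrt 2 * (sqrt (wpar q) * compK q)"
proof -
  have "ell_par q / wpar q = 2 * sqrt 2 * (Npar q / sqrt (wpar q))"
    using wavelikeD(2)[OF assms] by (simp add: ell_par_def real_div_sqrt field_simps)
  then show ?thesis by (simp add: en_par_def)
qed

lemma en_minus_pos: "wavelike q \<Longrightarrow> 0 < en_par q - ell_par q / wpar q"
  by (simp add: en_minus compK_pos wavelikeD)

lemma en_star_pos: "0 < en_par q_star"
  using en_minus_pos[OF wavelike_q_star] by (simp add: ell_par_zero)

text \<open>This rests on \<open>wpar q_star * K \<ge> K/2 \<ge> 2E - K\<close> for \<open>q^2 \<ge> 1/2\<close>.\<close>

lemma en_twice:
  assumes w: "wavelike q" and "q < q_star"
  shows "en_par q_star < 2 * (en_par q - ell_par q / wpar q_star)"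
proof -
  have ws: "1/2 \<le> wpar q_star" by (rule q_star_props)
  have K: "compK q > 0" by (rule compK_pos[OF wavelikeD(1)[OF w]])
  have "Npar q \<le> (1 - q^2) * compK q"
    using compE_le[OF wavelikeD(1)[OF w]] by (simp add: Npar_def algebra_simps)
  also have "\<dots> \<le> 1/2 * compK q"
    using wavelikeD(2)[OF w] K by (intro mult_right_mono) (auto simp: wpar_def)
  also have "\<dots> \<le> wpar q_star * compK q" using ws K by (intro mult_right_mono) auto
  finally have "Npar q / wpar q_star \<le> compK q" using ws by (simp add: field_simps)
  then have "2 * sqrt 2 * (sqrt (wpar q) * (Npar q / wpar q_star)) \<le> 2 * sqrt 2 * (sqrt (wpar q) * compK q)"
    using wavelikeD(2)[OF w] by (intro mult_left_mono) auto
  then have "2 * (ell_par q / wpar q_star) \<le> en_par q - ell_par q / wpar q"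
    unfolding en_minus[OF w] by (simp add: ell_par_def)
  \<comment> \<open>Adding this to \<open>en_legendre_less\<close> eliminates
    \<open>ell_par q / wpar q\<close>.\<close>
  then show ?thesis using en_legendre_less[OF assms] by simp
qed

section \<open>The solution branches and the minimization under the distance constraint\<close>

lemma q2_props:
  assumes "0 < c" "c \<le> lambda_hat"
  shows "q_hat \<le> q2 c" "q2 c < q_star" "ell_par (q2 c) = sqrt c"
proof -
  note s1 = wavelikeD(4)[OF wavelike_q_star]
  have wl: "wavelike q" if "q_hat \<le> q" "q \<le> q_star" for q
    using that s1 by (intro wavelike_ge_hat) auto
  have lh: "sqrt c \<le> ell_par q_hat"
  proof -
    have "c \<le> (ell_par q_hat)^2"
      using assms(2) gpar_eq[of q_hat] wavelikeD(2)[OF q_hat_props(1)] by (simp add: lambda_hat_def)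
    then show ?thesis using ell_par_pos[OF q_hat_props(1,2)] by (intro real_le_lsqrt) auto
  qed
  have "\<exists>x\<ge>q_hat. x \<le> q_star \<and> ell_par x = sqrt c"
  proof (rule IVT2)
    show "ell_par q_star \<le> sqrt c" using assms(1) by (simp add: ell_par_zero)
    show "\<forall>x. q_hat \<le> x \<and> x \<le> q_star \<longrightarrow> isCont ell_par x" using wavelike_isCont(1) wl by blast
  qed (use lh q_hat_props(2) in auto)
  then obtain x where x: "q_hat \<le> x" "x \<le> q_star" "ell_par x = sqrt c" by blast
  have xs: "x < q_star" using x assms(1) ell_par_zero by (cases "x = q_star") auto
  have "q2 c = x"
    unfolding q2_def
  proof (rule the_equality)
    show "q_hat \<le> x \<and> x < q_star \<and> gpar x = c"
      using x xs assms(1) gpar_eq[of x] wavelikeD(2)[OF wl[OF x(1,2)]] by simp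
    fix r assume r: "q_hat \<le> r \<and> r < q_star \<and> gpar r = c"
    then have wr: "wavelike r" using wl by simp
    have "(ell_par r)^2 = c" using r gpar_eq[of r] wavelikeD(2)[OF wr] by simp
    then have er: "ell_par r = sqrt c" using ell_par_pos[OF wr] r by (simp add: real_sqrt_unique)
    show "r = x"
      by (rule ell_par_inj) (use er x r s1 xs in auto)
  qed
  then show "q_hat \<le> q2 c" "q2 c < q_star" "ell_par (q2 c) = sqrt c" using x xs by auto
qed

lemma q3_props:
  assumes "0 < c"
  shows "q_star < q3 c" "q3 c < 1" "ell_par (q3 c) = - sqrt c"
proof -
  note s1 = wavelikeD(4)[OF wavelike_q_star]
  have wl: "wavelike q" if "q_star \<le> q" "q < 1" for q
    using wavelike_between[OF wavelike_q_star that] .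
  \<comment> \<open>Half of \<open>sqrt c\<close> is enough: \<open>wpar b \<ge> 1/2\<close> makes
    the prefactor of \<open>Npar b\<close> in \<open>ell_par b\<close> at least 2.\<close>
  obtain b where b: "modulus b" "q_star < b" "Npar b < - sqrt c / 2"
    using Npar_unbounded[OF s1, of "- sqrt c / 2"] by blast
  have b1: "b < 1" using b(1) by (simp add: modulus_def)
  have "ell_par b \<le> - sqrt c"
  proof -
    have wb: "1/2 \<le> wpar b" using q_star_props(1,3) wpar_mono[of q_star b] b by (simp add: modulus_def)
    have "sqrt (1/2) \<le> sqrt (wpar b)" using wb by simp
    then have "sqrt 2 * sqrt (1/2) \<le> sqrt 2 * sqrt (wpar b)" by (intro mult_left_mono) auto
    then have "1 \<le> sqrt 2 * sqrt (wpar b)" by (simp add: real_sqrt_mult[symmetric])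
    moreover have "Npar b \<le> 0" using b(3) real_sqrt_gt_zero[OF assms] by linarith
    ultimately have "sqrt 2 * sqrt (wpar b) * Npar b \<le> 1 * Npar b" by (intro mult_right_mono_neg)
    then show ?thesis using b(3) by (simp add: ell_par_def)
  qed
  have "\<exists>x\<ge>q_star. x \<le> b \<and> ell_par x = - sqrt c"
  proof (rule IVT2)
    show "\<forall>x. q_star \<le> x \<and> x \<le> b \<longrightarrow> isCont ell_par x" using wavelike_isCont(1) wl b1 by auto
  qed (use \<open>ell_par b \<le> - sqrt c\<close> assms b ell_par_zero in auto)
  then obtain x where x: "q_star \<le> x" "x \<le> b" "ell_par x = - sqrt c" by blast
  have xs: "q_star < x" using x assms(1) ell_par_zero by (cases "x = q_star") auto
  have x1: "x < 1" using x b1 by simp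
  have qs: "q_hat \<le> q_star" using q_hat_props(2) by simp
  have "q3 c = x"
    unfolding q3_def
  proof (rule the_equality)
    show "q_star < x \<and> x < 1 \<and> gpar x = c"
      using x xs x1 assms(1) gpar_eq[of x] wavelikeD(2)[OF wl[OF x(1) x1]] by simp
    fix r assume r: "q_star < r \<and> r < 1 \<and> gpar r = c"
    then have wr: "wavelike r" using wl by simp
    have "(- ell_par r)^2 = c" using r gpar_eq[of r] wavelikeD(2)[OF wr] by simp
    then have er: "sqrt c = - ell_par r"
      by (rule real_sqrt_unique) (use ell_par_neg[of r] r in auto)
    show "r = x"
      by (rule ell_par_inj) (use er x r x1 xs qs in auto)
  qed
  then show "q_star < q3 c" "q3 c < 1" "ell_par (q3 c) = - sqrt c" using x xs x1 by auto
qed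

text \<open>The value \<open>en_par q_star\<close> is a barrier. \<open>q2 c\<close> lies below it
  because the energy increases beyond \<open>q_hat\<close>, and loops lie above it for the same
  reason. Two or more arcs lie above it because 2H is the sum of H + G/w, which exceeds the barrier,
  and H - G/w, which is positive. A single arc left of \<open>q_hat\<close> with the same distance
  loses by \<open>en_plus_antimono_hat\<close>.\<close>

lemma larc_minimal:
  assumes c: "0 < c" "c \<le> lambda_hat" and q: "wavelike q" and n: "1 \<le> n"
    and eq: "real n * \<bar>ell_par q\<bar> = sqrt c"
  shows "en_par (q2 c) < real n * en_par q \<or> (n = 1 \<and> q = q2 c)"
proof -
  note q2 = q2_props[OF c]
  have q1: "q < 1" by (rule wavelikeD(4)[OF q])
  note s1 = wavelikeD(4)[OF wavelike_q_star]
  have lt: "en_par (q2 c) < en_par q_star" by (rule en_par_mono[OF q2(1,2) s1])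
  consider "q_star < q" | "q = q_star" | "q < q_star" by linarith
  then show ?thesis
  proof cases
    case 1
    have "en_par q_star < en_par q" using en_par_mono[OF _ 1 q1] q_hat_props(2) by simp
    moreover have "1 * en_par q \<le> real n * en_par q"
      using n calculation en_star_pos by (intro mult_right_mono) auto
    ultimately show ?thesis using lt by linarith
  next
    case 2
    then show ?thesis using eq c(1) ell_par_zero by simp
  next
    case 3
    have p: "0 < ell_par q" by (rule ell_par_pos[OF q 3])
    show ?thesis
    proof (cases "n = 1")
      case True
      then have e: "ell_par q = ell_par (q2 c)" using eq p q2(3) by simp
      show ?thesis
      proof (cases "q_hat \<le> q")
        case True
        have "q = q2 c"
          by (rule ell_par_inj[OF True q1 q2(1) _ e]) (use q2(2) s1 in simp)
        then show ?thesis using \<open>n = 1\<close> by simp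
      next
        case False
        then have "en_par (q2 c) < en_par q"
          using en_plus_antimono_hat[OF q, of "q2 c"] q2 s1 e by simp
        then show ?thesis using \<open>n = 1\<close> by simp
      qed
    next
      case False
      have "0 < en_par q" using en_minus_pos[OF q] p wavelikeD(2)[OF q] divide_pos_pos[of "ell_par q" "wpar q"] by linarith
      then have "2 * en_par q \<le> real n * en_par q" using n False by (intro mult_right_mono) auto
      moreover have "en_par q_star < 2 * en_par q"
        using en_legendre_less[OF q 3] en_minus_pos[OF q] by linarith
      ultimately show ?thesis using lt by linarith
    qed
  qed
qed

text \<open>A single arc cannot span the distance. Several loops of modulus q are compared with the
  big loop by the tangent line at q; the gain per loop is H + G/w, which is positive. Several arcs
  are compared by the tangent line at \<open>q_star\<close>; \<open>en_twice\<close> covers two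
  arcs, and each further one adds a positive amount.\<close>

lemma loop_minimal:
  assumes c: "0 < c" "lambda_hat < c" and q: "wavelike q" and n: "1 \<le> n"
    and eq: "real n * \<bar>ell_par q\<bar> = sqrt c"
  shows "en_par (q3 c) < real n * en_par q \<or> (n = 1 \<and> q = q3 c)"
proof -
  note q3 = q3_props[OF c(1)]
  have q1: "q < 1" by (rule wavelikeD(4)[OF q])
  have hs: "q_hat \<le> q_star" using q_hat_props(2) by simp
  have lh: "ell_par q_hat < sqrt c"
  proof -
    have "(ell_par q_hat)^2 < c"
      using c(2) gpar_eq[of q_hat] wavelikeD(2)[OF q_hat_props(1)] by (simp add: lambda_hat_def)
    then show ?thesis by (rule real_less_rsqrt)
  qed
  consider "q_star < q" | "q = q_star" | "q < q_star" by linarith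
  then show ?thesis
  proof cases
    case 1
    have m: "ell_par q < 0" by (rule ell_par_neg[OF 1 q1])
    have hq: "q_hat \<le> q" using hs 1 by simp
    have eq': "ell_par (q3 c) = real n * ell_par q" using eq m q3(3) by simp
    show ?thesis
    proof (cases "n = 1")
      case True
      then have e: "ell_par (q3 c) = ell_par q" using eq' by simp
      have "q = q3 c"
        by (rule ell_par_inj[OF hq q1 _ q3(2) e[symmetric]]) (use hs q3(1) in simp)
      then show ?thesis using True by simp
    next
      case False
      then have n2: "real n \<ge> 2" using n by simp
      have "ell_par (q3 c) < ell_par q" unfolding eq' using n2 m by (simp add: mult_less_cancel_right)
      then have "q < q3 c"
        using ell_par_less_iff[OF _ q3(2) hq q1] hs q3(1) by simp
      then have "en_par (q3 c) + ell_par (q3 c) / wpar q < en_par q + ell_par q / wpar q"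
        using en_plus_antimono[OF hq order_refl _ q3(2)] by simp
      then have "en_par (q3 c) < en_par q - (real n - 1) * (ell_par q / wpar q)"
        unfolding eq' by (simp add: left_diff_distrib diff_divide_distrib)
      moreover have "0 \<le> (real n - 1) * (en_par q + ell_par q / wpar q)"
        using n2 en_legendre_greater[OF 1 q1] en_star_pos by (intro mult_nonneg_nonneg) auto
      ultimately have "en_par (q3 c) < real n * en_par q" by (simp add: algebra_simps)
      then show ?thesis by simp
    qed
  next
    case 2
    then show ?thesis using eq c(1) ell_par_zero by simp
  next
    case 3
    have p: "0 < ell_par q" by (rule ell_par_pos[OF q 3])
    have "ell_par q \<le> ell_par q_hat"
      using ell_par_mono[OF q, of q_hat] ell_par_antimono[of q_hat q] q1 by fastforce
    then have "n \<noteq> 1" using lh eq p by auto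
    then have n2: "real n \<ge> 2" using n by simp
    have "en_par (q3 c) + ell_par (q3 c) / wpar q_star < en_par q_star"
      using en_plus_antimono[OF hs order_refl q3(1,2)] by (simp add: ell_par_zero)
    moreover have "ell_par (q3 c) = - (real n * ell_par q)" using eq p q3(3) by simp
    ultimately have "en_par (q3 c) < en_par q_star + real n * (ell_par q / wpar q_star)" by simp
    also have "\<dots> \<le> 2 * (en_par q - ell_par q / wpar q_star) + real n * (ell_par q / wpar q_star)"
      using en_twice[OF q 3] by simp
    also have "\<dots> \<le> real n * (en_par q - ell_par q / wpar q_star) + real n * (ell_par q / wpar q_star)"
      using n2 en_twice[OF q 3] en_star_pos by (intro add_right_mono mult_right_mono) auto
    finally show ?thesis by (simp add: algebra_simps)
  qed
qed

section \<open>Classification of pinned elasticae\<close>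

lemma derivative_interior_01:
  assumes "(f has_real_derivative y) (at01 t)" "0 < t" "t < (1::real)"
  shows "(f has_real_derivative y) (at t)"
  using assms at_within_interior[of t "{0..1}"] by simp

lemma derivative_01_continuous:
  fixes f :: "real \<Rightarrow> real"
  assumes "\<And>t. t \<in> {0..1} \<Longrightarrow> (f has_real_derivative f' t) (at01 t)"
  shows "continuous_on {0..1} f"
  by (rule DERIV_continuous_on[OF assms])

text \<open>Gronwall applied to the squared distance of two solutions of \<open>y' = n s\<close>, \<open>s' = n y (A - B y^2)\<close>.\<close>

lemma elastica_ode_unique:
  fixes n y1 s1 y2 s2 :: "real \<Rightarrow> real"
  assumes cn: "continuous_on {0..1} n"
    and y1: "\<And>t. t \<in> {0..1} \<Longrightarrow> (y1 has_real_derivative n t * s1 t) (at01 t)"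
    and s1: "\<And>t. t \<in> {0..1} \<Longrightarrow> (s1 has_real_derivative n t * y1 t * (A - B * (y1 t)^2)) (at01 t)"
    and y2: "\<And>t. t \<in> {0..1} \<Longrightarrow> (y2 has_real_derivative n t * s2 t) (at01 t)"
    and s2: "\<And>t. t \<in> {0..1} \<Longrightarrow> (s2 has_real_derivative n t * y2 t * (A - B * (y2 t)^2)) (at01 t)"
    and init: "y1 0 = y2 0" "s1 0 = s2 0" and t: "t \<in> {0..1}"
  shows "y1 t = y2 t" "s1 t = s2 t"
proof -
  \<comment> \<open>The difference of the cubic terms contains the factor y1 - y2; \<open>G\<close>
    collects what is left, so that D' = 2 G dy ds, which is at most C D in absolute value.\<close>
  define dy ds G D where "dy t = y1 t - y2 t" and "ds t = s1 t - s2 t"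
    and "G t = n t * (1 + A - B * ((y1 t)^2 + y1 t * y2 t + (y2 t)^2))"
    and "D t = (dy t)^2 + (ds t)^2" for t
  have cy: "continuous_on {0..1} y1" "continuous_on {0..1} y2"
    by (rule derivative_01_continuous, erule y1 y2)+
  have "continuous_on {0..1} G" unfolding G_def by (intro continuous_intros cn cy)
  then have "bounded (G ` {0..1})" using compact_continuous_image compact_imp_bounded by blast
  then obtain C where C: "\<And>t. t \<in> {0..1} \<Longrightarrow> \<bar>G t\<bar> \<le> C"
    unfolding bounded_iff real_norm_def by (metis imageI)
  have ddy: "(dy has_real_derivative n t * ds t) (at01 t)" if "t \<in> {0..1}" for t
    unfolding dy_def[abs_def] ds_def by (rule DERIV_cong[OF DERIV_diff[OF y1[OF that] y2[OF that]]]) (simp add: algebra_simps)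
  have dds: "(ds has_real_derivative n t * y1 t * (A - B * (y1 t)^2) - n t * y2 t * (A - B * (y2 t)^2)) (at01 t)"
    if "t \<in> {0..1}" for t
    unfolding ds_def[abs_def] by (rule DERIV_diff[OF s1[OF that] s2[OF that]])
  have dD: "(D has_real_derivative 2 * G t * dy t * ds t) (at01 t)" if "t \<in> {0..1}" for t
  proof -
    have "(D has_real_derivative (n t * ds t * dy t + n t * ds t * dy t)
      + ((n t * y1 t * (A - B * (y1 t)^2) - n t * y2 t * (A - B * (y2 t)^2)) * ds t
        + (n t * y1 t * (A - B * (y1 t)^2) - n t * y2 t * (A - B * (y2 t)^2)) * ds t)) (at01 t)"
      unfolding D_def[abs_def] power2_eq_square
      using DERIV_add[OF DERIV_mult[OF ddy[OF that] ddy[OF that]] DERIV_mult[OF dds[OF that] dds[OF that]]]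
      by (simp add: power2_eq_square)
    then show ?thesis
      by (rule DERIV_cong) (simp add: G_def dy_def ds_def algebra_simps power2_eq_square)
  qed
  have dE: "((\<lambda>t. D t * exp (- C * t)) has_real_derivative (2 * G t * dy t * ds t - C * D t) * exp (- C * t)) (at01 t)"
    if "t \<in> {0..1}" for t
    by (rule DERIV_cong[OF DERIV_mult[OF dD[OF that], of "\<lambda>t. exp (- C * t)" "- C * exp (- C * t)"]])
      (auto intro!: derivative_eq_intros simp: algebra_simps)
  have "D t * exp (- C * t) \<le> D 0 * exp (- C * 0)"
  proof (cases "t = 0")
    case False
    then have t0: "0 < t" using t by simp
    show ?thesis
    proof (rule DERIV_nonpos_imp_decreasing_open[of 0 t "\<lambda>t. D t * exp (- C * t)"])
      fix x assume x: "0 < x" "x < t"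
      then have x01: "x \<in> {0..1}" using t by simp
      have "2 * \<bar>dy x\<bar> * \<bar>ds x\<bar> \<le> D x"
        unfolding D_def using sum_squares_bound[of "\<bar>dy x\<bar>" "\<bar>ds x\<bar>"] by simp
      then have "\<bar>G x\<bar> * (2 * \<bar>dy x\<bar> * \<bar>ds x\<bar>) \<le> C * D x"
        using C[OF x01] by (intro mult_mono) auto
      moreover have "2 * G x * dy x * ds x \<le> \<bar>G x\<bar> * (2 * \<bar>dy x\<bar> * \<bar>ds x\<bar>)"
        using abs_ge_self[of "2 * G x * dy x * ds x"] by (simp add: abs_mult algebra_simps)
      ultimately have "(2 * G x * dy x * ds x - C * D x) * exp (- C * x) \<le> 0"
        by (intro mult_nonpos_nonneg) auto
      moreover have "((\<lambda>t. D t * exp (- C * t)) has_real_derivative (2 * G x * dy x * ds x - C * D x) * exp (- C * x)) (at x)"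
        by (rule derivative_interior_01[OF dE[OF x01]]) (use x t in auto)
      ultimately show "\<exists>y. ((\<lambda>t. D t * exp (- C * t)) has_real_derivative y) (at x) \<and> y \<le> 0" by blast
    next
      show "continuous_on {0..t} (\<lambda>t. D t * exp (- C * t))"
        by (rule continuous_on_subset[OF derivative_01_continuous[OF dE]]) (use t in auto)
    qed (use t0 in simp)
  qed simp
  also have "\<dots> = 0" using init by (simp add: D_def dy_def ds_def)
  finally have "D t \<le> 0" by (simp add: mult_le_0_iff)
  moreover have "0 \<le> (dy t)^2" "0 \<le> (ds t)^2" by auto
  ultimately have "(dy t)^2 = 0" "(ds t)^2 = 0" unfolding D_def by linarith+
  then show "y1 t = y2 t" "s1 t = s2 t" by (auto simp: dy_def ds_def)
qed

lemma real_derivative_fst_snd: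
  assumes "(\<gamma> has_vector_derivative v) (at t within S)"
  shows "((\<lambda>t. fst (\<gamma> t)) has_real_derivative fst v) (at t within S)"
    and "((\<lambda>t. snd (\<gamma> t)) has_real_derivative snd v) (at t within S)"
  using bounded_linear.has_vector_derivative[OF bounded_linear_fst assms]
    bounded_linear.has_vector_derivative[OF bounded_linear_snd assms]
  by (auto simp: has_real_derivative_iff_has_vector_derivative)

text \<open>The first integral determines the initial value problem completely: |F| fixes the scale
  k, lam/|F| the modulus, the sign of F the sign \<open>e\<close> (arc or loop), and the sign of the
  initial slope the reflection \<open>sg\<close>. The function \<open>al\<close> is the
  arclength.\<close>

lemma elastica_classification:
  assumes pe: "pinned_elastica lam l \<gamma>" and nt: "nontrivial l \<gamma>" and lam: "lam > 0" and l: "l > 0"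
  obtains e sg q k n al where
    "e = 1 \<or> e = - 1" "sg = 1 \<or> sg = - 1" "wavelike q" "k > 0" "n \<ge> 1" "0 < e * Npar q"
    "k = 2 * real n * (e * Npar q) / l" "continuous_on {0..1} al" "strict_mono_on {0..1} al" "al 0 = 0"
    "al 1 = 2 * real n * compK q / k"
    "\<And>t. t \<in> {0..1} \<Longrightarrow> \<gamma> t = (e * std_x q k (al t), sg * std_y q k (al t))"
    "energy lam \<gamma> = sqrt lam * (real n * en_par q)"
    "real n * \<bar>ell_par q\<bar> = sqrt (lam * l^2)"
proof -
  have W: "W22 \<gamma>" and nz: "\<And>t. t \<in> {0..1} \<Longrightarrow> d1 \<gamma> t \<noteq> 0" and bc: "\<gamma> 0 = (0,0)" "\<gamma> 1 = (l,0)"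
    using pe by (auto simp: pinned_elastica_def admissible_def)
  note g = W22_derivatives[OF W]
  obtain F where F: "F \<noteq> 0"
    and fx: "\<And>t. t \<in> {0..1} \<Longrightarrow> F * fst (d1 \<gamma> t) = (lam - (F * snd (\<gamma> t) / 2)^2) * norm (d1 \<gamma> t)"
    and ds: "\<And>t. t \<in> {0..1} \<Longrightarrow> ((\<lambda>t. snd (d1 \<gamma> t) / norm (d1 \<gamma> t)) has_real_derivative
        F * snd (\<gamma> t) / 2 * fst (d1 \<gamma> t)) (at01 t)"
    and en: "energy lam \<gamma> = 2 * lam * curve_length \<gamma> - F * l"
    using pinned_elastica_first_integral[OF pe lam l] by blast
  define n where "n t = norm (d1 \<gamma> t)" for t
  define x y s where "x t = fst (\<gamma> t)" and "y t = snd (\<gamma> t)" and "s t = snd (d1 \<gamma> t) / n t" for t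
  define A B where "A = lam / 2" and "B = F^2 / 8"
  have np: "n t > 0" if "t \<in> {0..1}" for t using nz[OF that] by (simp add: n_def)
  have cn: "continuous_on {0..1} n" unfolding n_def
    by (intro continuous_intros ac_primitive_continuous[OF g(2)])
  have p1: "fst (d1 \<gamma> t) = n t * ((lam - (F * y t / 2)^2) / F)" if "t \<in> {0..1}" for t
    using fx[OF that] F by (simp add: n_def y_def field_simps)
  have p2: "snd (d1 \<gamma> t) = n t * s t" if "t \<in> {0..1}" for t using np[OF that] by (simp add: s_def)
  have unit: "((lam - (F * y t / 2)^2) / F)^2 + (s t)^2 = 1" if "t \<in> {0..1}" for t
  proof -
    have "(n t)^2 = (fst (d1 \<gamma> t))^2 + (snd (d1 \<gamma> t))^2" by (simp add: n_def norm_prod_def)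
    also have "\<dots> = (n t)^2 * (((lam - (F * y t / 2)^2) / F)^2 + (s t)^2)"
      unfolding p1[OF that] p2[OF that] by (simp only: power_mult_distrib distrib_left)
    finally show ?thesis using np[OF that] by simp
  qed
  have dx: "(x has_real_derivative n t * ((lam - (F * y t / 2)^2) / F)) (at01 t)"
    and dy: "(y has_real_derivative n t * s t) (at01 t)" if "t \<in> {0..1}" for t
    using real_derivative_fst_snd[OF g(1)[OF that]] unfolding p1[OF that] p2[OF that] x_def[abs_def] y_def[abs_def] by auto
  have dsn: "(s has_real_derivative n t * y t * (A - B * (y t)^2)) (at01 t)" if "t \<in> {0..1}" for t
  proof -
    have "(s has_real_derivative F * y t / 2 * fst (d1 \<gamma> t)) (at01 t)"
      using ds[OF that] by (simp add: s_def[abs_def] n_def y_def)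
    then show ?thesis
      by (rule DERIV_cong) (use F in \<open>simp add: p1[OF that] A_def B_def field_simps power2_eq_square\<close>)
  qed
  have bc': "x 0 = 0" "y 0 = 0" "x 1 = l" "y 1 = 0" using bc by (auto simp: x_def y_def)

  define al where "al t = integral {0..t} n" for t
  have dal: "(al has_real_derivative n t) (at01 t)" if "t \<in> {0..1}" for t
    unfolding al_def by (rule integral_has_real_derivative[OF cn that])
  have cal: "continuous_on {0..1} al" by (rule derivative_01_continuous[OF dal])
  have al0: "al 0 = 0" by (simp add: al_def)
  have almono: "strict_mono_on {0..1} al"
  proof (rule strict_mono_onI)
    fix a b :: real assume ab: "a \<in> {0..1}" "b \<in> {0..1}" "a < b"
    show "al a < al b"
    proof (rule DERIV_pos_imp_increasing_open[OF ab(3)])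
      fix t assume "a < t" "t < b"
      then show "\<exists>y. (al has_real_derivative y) (at t) \<and> 0 < y"
        using derivative_interior_01[OF dal, of t] np[of t] ab by (intro exI[of _ "n t"]) auto
    qed (rule continuous_on_subset[OF cal], use ab in auto)
  qed
  have al1: "al 1 > 0" using strict_mono_onD[OF almono, of 0 1] al0 by simp
  have len: "curve_length \<gamma> = al 1" by (simp add: curve_length_def al_def n_def[abs_def])

  \<comment> \<open>A horizontal start makes zero the solution for y, hence a straight line. As l >
    0 it is traversed from left to right, which \<open>nontrivial\<close> excludes.\<close>
  have s0: "s 0 \<noteq> 0"
  proof
    assume s0: "s 0 = 0"
    have y0: "y t = 0" if "t \<in> {0..1}" for t
      by (rule elastica_ode_unique(1)[OF cn dy dsn, where ?y2.0 = "\<lambda>t. 0" and ?s2.0 = "\<lambda>t. 0"])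
        (use bc' s0 that in auto)
    have "(lam / F)^2 = 1" using unit[of 0] s0 bc' by simp
    then have lF: "lam / F = 1 \<or> lam / F = - 1" by (simp add: power2_eq_1_iff)
    have xs: "x t = lam / F * al t" if t: "t \<in> {0..1}" for t
    proof -
      have "ac_primitive (\<lambda>t. x t - lam / F * al t) (\<lambda>t. 0)"
      proof (rule ac_primitive_of_derivative)
        fix t :: real assume t: "t \<in> {0..1}"
        have "((\<lambda>t. x t - lam / F * al t) has_real_derivative n t * ((lam - (F * y t / 2)^2) / F) - lam / F * n t) (at01 t)"
          by (intro DERIV_diff DERIV_cmult dx dal t)
        then show "((\<lambda>t. x t - lam / F * al t) has_vector_derivative 0) (at01 t)"
          using y0[OF t] by (simp add: has_real_derivative_iff_has_vector_derivative)
      qed auto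
      from ac_primitive_zero_ae[OF this negligible_empty _ t] show ?thesis using bc' al0 by simp
    qed
    have lF1: "lam / F = 1"
    proof (rule ccontr)
      assume "lam / F \<noteq> 1"
      then have r: "lam / F = - 1" using lF by blast
      have "l = - 1 * al 1" using xs[of 1, unfolded r] bc' by simp
      then show False using l al1 by simp
    qed
    have "reparam_of \<gamma> (segment_curve l)"
      unfolding reparam_of_def
    proof (intro exI[of _ "\<lambda>t. al t / l"] conjI ballI)
      show "continuous_on {0..1} (\<lambda>t. al t / l)" using l by (intro continuous_intros cal) auto
      show "strict_mono_on {0..1} (\<lambda>t. al t / l)"
        using strict_mono_onD[OF almono] l by (intro strict_mono_onI divide_strict_right_mono) auto
      show "al 0 / l = 0" using al0 by simp
      show "al 1 / l = 1" using xs[of 1] lF1 bc' l by simp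
      fix t :: real assume t: "t \<in> {0..1}"
      show "\<gamma> t = segment_curve l (al t / l)"
        using xs[OF t] y0[OF t] lF1 l by (simp add: segment_curve_def x_def y_def prod_eq_iff)
    qed
    then show False using nt by (simp add: nontrivial_def)
  qed

  \<comment> \<open>Matching with the standard curve: its initial cosine is -w, and its curvature
    -k^2 y (up to the sign e) has to equal F y/2. The modulus then solves w = 2 q^2 - 1.\<close>
  define w where "w = lam / \<bar>F\<bar>"
  define q where "q = sqrt ((1 + w) / 2)"
  define k where "k = sqrt (\<bar>F\<bar> / 2)"
  define e where "e = - sgn F"
  define sg where "sg = sgn (s 0)"
  have e: "e = 1 \<or> e = - 1" "e * e = 1" and sg: "sg = 1 \<or> sg = - 1" "sg * sg = 1"
    using F s0 by (auto simp: e_def sg_def sgn_if)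
  have k: "k > 0" "k^2 = \<bar>F\<bar> / 2" using F by (auto simp: k_def)
  have Fe: "F = - 2 * e * k^2" using F by (simp add: e_def k(2) sgn_mult_abs)
  have s02: "(s 0)^2 = 1 - w^2"
    using unit[of 0] bc' by (simp add: w_def power_divide)
  have w: "0 < w" "w < 1"
  proof -
    show "0 < w" using lam F by (simp add: w_def)
    have "w^2 < 1" using s02 s0 by (smt (verit) zero_less_power2)
    then show "w < 1" using \<open>0 < w\<close> by (simp add: abs_square_less_1)
  qed
  have q2: "q^2 = (1 + w) / 2" using w by (simp add: q_def)
  have wq: "wpar q = w" by (simp add: wpar_def q2 field_simps)
  have wave: "wavelike q"
    using w wq by (auto simp: wavelike_def modulus_def q_def)
  note mq = wavelikeD(1)[OF wave]
  have lamw: "lam = 2 * k^2 * w" using F by (simp add: k(2) w_def)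
  have AB: "A = k^2 * w" "B = k^2 * k^2 / 2"
  proof -
    have "F^2 = \<bar>F\<bar>^2" by simp
    also have "\<bar>F\<bar> = 2 * k^2" using k(2) by simp
    finally show "B = k^2 * k^2 / 2" by (simp add: B_def power2_eq_square)
  qed (simp add: A_def lamw)
  have w2: "2 * q^2 - 1 = w" using wq by (simp add: wpar_def)
  have sg2: "(sg * Z)^2 = Z^2" for Z using sg by auto
  note dc = DERIV_chain2[OF _ dal]
  have std1: "((\<lambda>t. sg * std_y q k (al t)) has_real_derivative n t * (sg * std_dy q k (al t))) (at01 t)"
    if "t \<in> {0..1}" for t
    by (rule DERIV_cong[OF DERIV_cmult[OF dc[OF std_derivs(2)[OF mq k(1)] that]]]) simp
  have std2: "((\<lambda>t. sg * std_dy q k (al t)) has_real_derivative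
       n t * (sg * std_y q k (al t)) * (A - B * (sg * std_y q k (al t))^2)) (at01 t)"
    if "t \<in> {0..1}" for t
  proof -
    have "A - B * (sg * std_y q k (al t))^2 = - (k^2 * std_dx q k (al t))"
      unfolding std_identities(2)[OF mq k(1)] AB w2 sg2 by (simp add: algebra_simps)
    then show ?thesis
      by (intro DERIV_cong[OF DERIV_cmult[OF dc[OF std_derivs(3)[OF mq k(1)] that]]]) simp
  qed
  have std3: "((\<lambda>t. e * std_x q k (al t)) has_real_derivative n t * (e * std_dx q k (al t))) (at01 t)"
    if "t \<in> {0..1}" for t
    by (rule DERIV_cong[OF DERIV_cmult[OF dc[OF std_derivs(1)[OF mq k(1)] that]]]) simp
  have init: "sg * std_dy q k (al 0) = s 0"
  proof -
    have "std_dy q k (al 0) = \<bar>s 0\<bar>"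
    proof (rule power2_eq_imp_eq)
      have "(std_dy q k (al 0))^2 = 4 * q^2 * (1 - q^2)"
        unfolding al0 std_initial(4)[OF mq k(1)] using modulus_sq[OF mq] by (simp add: power_mult_distrib)
      also have "\<dots> = 1 - w^2" unfolding q2 by (simp add: field_simps power2_eq_square)
      finally show "(std_dy q k (al 0))^2 = \<bar>s 0\<bar>^2" by (simp add: s02)
      show "0 \<le> std_dy q k (al 0)"
        unfolding al0 std_initial(4)[OF mq k(1)] using wavelikeD(3)[OF wave] modulus_sq[OF mq] by simp
    qed simp
    then show ?thesis by (simp add: sg_def sgn_mult_abs)
  qed
  have ysol: "y t = sg * std_y q k (al t)" if "t \<in> {0..1}" for t
    by (rule elastica_ode_unique(1)[OF cn dy dsn std1 std2 _ init[symmetric] that])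
      (simp_all add: bc' al0 std_initial[OF mq k(1)])
  \<comment> \<open>x is not part of the differential system: its derivative is a function of y, so
    it is found by one integration.\<close>
  have xsol: "x t = e * std_x q k (al t)" if t: "t \<in> {0..1}" for t
  proof -
    have "ac_primitive (\<lambda>t. x t - e * std_x q k (al t)) (\<lambda>t. 0)"
    proof (rule ac_primitive_of_derivative)
      fix t :: real assume t: "t \<in> {0..1}"
      have y2: "(y t)^2 = (std_y q k (al t))^2" using ysol[OF t] sg by auto
      have "(lam - (F * y t / 2)^2) / F = e * std_dx q k (al t)"
      proof -
        have "(F * y t / 2)^2 = k^2 * k^2 * (y t)^2"
          unfolding Fe using e by (auto simp: power2_eq_square)
        then have "lam - (F * y t / 2)^2 = F * (e * std_dx q k (al t))"
          unfolding std_identities(2)[OF mq k(1)] Fe lamw y2 using e wq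
          by (auto simp: wpar_def algebra_simps)
        then show ?thesis using F by simp
      qed
      then have "((\<lambda>t. x t - e * std_x q k (al t)) has_real_derivative 0) (at01 t)"
        using DERIV_diff[OF dx[OF t] std3[OF t]] by simp
      then show "((\<lambda>t. x t - e * std_x q k (al t)) has_vector_derivative 0) (at01 t)"
        by (simp add: has_real_derivative_iff_has_vector_derivative)
    qed auto
    from ac_primitive_zero_ae[OF this negligible_empty _ t] show ?thesis
      using bc' al0 std_initial[OF mq k(1)] by simp
  qed
  \<comment> \<open>The far end lies on the axis again, so the length is a whole number of
    half-periods.\<close>
  have "std_y q k (al 1) = 0" using ysol[of 1] bc' sg by auto
  then obtain N where N: "N \<ge> 1" "al 1 = 2 * real N * compK q / k"
    using std_y_zero[OF mq k(1) al1] by blast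
  have leq: "l = 2 * real N * (e * Npar q) / k"
    using xsol[of 1] bc' unfolding N(2) std_at_multiples[OF mq k(1)] by (simp add: Npar_def)
  have eN: "0 < e * Npar q"
    using l k(1) N(1) unfolding leq by (auto simp: zero_less_divide_iff zero_less_mult_iff)
  have keq: "k = 2 * real N * (e * Npar q) / l"
    using leq k(1) l by (simp add: field_simps)
  have energy: "energy lam \<gamma> = sqrt lam * (real N * en_par q)"
  proof -
    have "F * l = - (2 * k^2) * (2 * real N * ((e * e) * Npar q) / k)"
      unfolding Fe leq by (simp add: algebra_simps)
    then have "F * l = - (4 * real N * k * Npar q)"
      unfolding e(2) using k(1) by (simp add: power2_eq_square)
    then have "energy lam \<gamma> = 8 * k * w * real N * compK q + 4 * real N * k * Npar q"
      unfolding en len N(2) unfolding lamw using k(1) by (simp add: power2_eq_square)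
    also have "\<dots> = sqrt lam * (real N * en_par q)"
      using en_par_scaled[OF wave k(1)] by (simp add: lamw wq algebra_simps)
    finally show ?thesis .
  qed
  have ell: "real N * \<bar>ell_par q\<bar> = sqrt (lam * l^2)"
  proof -
    have "\<bar>Npar q\<bar> = e * Npar q" using e eN by auto
    then have "k * (real N * \<bar>ell_par q\<bar>) = real N * (sqrt (2 * k^2 * wpar q) * (2 * (e * Npar q)))"
      using ell_par_scaled[OF wave k(1)] by (simp add: algebra_simps)
    also have "\<dots> = k * (sqrt lam * l)"
      unfolding leq lamw wq using k(1) by simp
    finally have "real N * \<bar>ell_par q\<bar> = sqrt lam * l" using k(1) by simp
    then show ?thesis using l by (simp add: real_sqrt_mult)
  qed
  show thesis
    by (rule that[OF e(1) sg(1) wave k(1) N(1) eN keq cal almono al0 N(2) _ energy ell])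
      (use xsol ysol in \<open>simp add: x_def y_def prod_eq_iff\<close>)
qed

section \<open>Criticality of the explicit curves and the minimizer\<close>

text \<open>A single arch, of arclength \<open>2 * compK q / k\<close>, scaled to [0,1]. The sign e
  = 1 belongs to \<open>larc\<close> and e = -1 to \<open>loop\<close>, where the factor compensates
  for \<open>Npar q < 0\<close>.\<close>

definition std_curve :: "real \<Rightarrow> real \<Rightarrow> real \<Rightarrow> real \<Rightarrow> real \<times> real" where
  "std_curve e q k t = (e * std_x q k (t * (2 * compK q / k)), std_y q k (t * (2 * compK q / k)))"

text \<open>The moment of the explicit curve is a classical primitive of its force density minus a
  constant and vanishes at both ends, since y does. Criticality is then one integration by parts
  against an arbitrary test function.\<close>

lemma std_curve_pinned:
  assumes e: "e = 1 \<or> e = - 1" and wave: "wavelike q" and eN: "0 < e * Npar q" and l: "l > 0"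
    and keq: "k = 2 * (e * Npar q) / l" and lamw: "lam = 2 * k^2 * wpar q"
  shows "pinned_elastica lam l (std_curve e q k)" "nontrivial l (std_curve e q k)"
    "energy lam (std_curve e q k) = sqrt lam * en_par q"
proof -
  have k: "k > 0" unfolding keq using eN l by simp
  note mq = wavelikeD(1)[OF wave]
  define T where "T = 2 * compK q / k"
  have T: "T > 0" using compK_pos[OF mq] k by (simp add: T_def)
  have ee: "e * e = 1" using e by auto
  define X Y dX dY where "X t = std_x q k (t * T)" and "Y t = std_y q k (t * T)"
    and "dX t = std_dx q k (t * T)" and "dY t = std_dy q k (t * T)" for t
  have unit: "(dX t)^2 + (dY t)^2 = 1" for t
    unfolding dX_def dY_def by (rule std_identities(1)[OF mq k])
  have dXe: "2 * k^2 * dX t = k^2 * k^2 * (Y t)^2 - lam" for t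
    unfolding dX_def Y_def std_identities(2)[OF mq k] lamw wpar_def by (simp add: algebra_simps)
  have dT: "((\<lambda>t. t * T) has_real_derivative T) (at t)" for t
    by (auto intro!: derivative_eq_intros)
  note dc = DERIV_chain2[OF _ dT]
  have DX: "(X has_real_derivative T * dX t) (at t)" and DY: "(Y has_real_derivative T * dY t) (at t)"
    and DdY: "(dY has_real_derivative - T * (k^2 * Y t * dX t)) (at t)" for t
    unfolding X_def[abs_def] Y_def[abs_def] dY_def[abs_def] dX_def
    by (rule DERIV_cong[OF dc[OF std_derivs(1)[OF mq k]]], simp,
        rule DERIV_cong[OF dc[OF std_derivs(2)[OF mq k]]], simp,
        rule DERIV_cong[OF dc[OF std_derivs(3)[OF mq k]]], simp)
  have DdX: "(dX has_real_derivative T * (k^2 * Y t * dY t)) (at t)" for t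
  proof -
    have eq: "dX = (\<lambda>t. k^2 * (Y t * Y t) / 2 - (2 * q^2 - 1))"
      unfolding dX_def[abs_def] Y_def std_identities(2)[OF mq k] by (simp add: power2_eq_square)
    have "((\<lambda>t. k^2 * (Y t * Y t) / 2 - (2 * q^2 - 1)) has_real_derivative
       k^2 * (T * dY t * Y t + T * dY t * Y t) / 2 - 0) (at t)"
      by (intro DERIV_diff DERIV_cdivide DERIV_cmult DERIV_mult DY DERIV_const)
    then show ?thesis unfolding eq by (rule DERIV_cong) (simp add: algebra_simps)
  qed
  have cont: "continuous_on {0..1} Y" "continuous_on {0..1} dX" "continuous_on {0..1} dY"
    by (rule continuous_at_imp_continuous_on, rule ballI, rule DERIV_isCont, rule DY DdX DdY)+
  define \<gamma> where "\<gamma> = std_curve e q k"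
  have \<gamma>: "\<gamma> t = (e * X t, Y t)" for t by (simp add: \<gamma>_def std_curve_def X_def Y_def T_def)
  define p a where "p t = (e * (T * dX t), T * dY t)"
    and "a t = (e * (T * (T * (k^2 * Y t * dY t))), T * (- T * (k^2 * Y t * dX t)))" for t
  have D\<gamma>: "(\<gamma> has_vector_derivative p t) (at t within S)" for t S
    unfolding \<gamma>[abs_def] p_def
    by (intro has_vector_derivative_Pair has_field_derivative_at_within[THEN
          has_real_derivative_iff_has_vector_derivative[THEN iffD1]] DERIV_cmult DX DY)
  have Dp: "(p has_vector_derivative a t) (at t within S)" for t S
    unfolding p_def[abs_def] a_def
    by (intro has_vector_derivative_Pair has_field_derivative_at_within[THEN
          has_real_derivative_iff_has_vector_derivative[THEN iffD1]] DERIV_cmult DdX DdY)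
  have ca: "continuous_on {0..1} a" unfolding a_def[abs_def] by (intro continuous_intros cont)
  have ap: "ac_primitive p a" by (rule ac_primitive_of_derivative[OF Dp ca])
  have W: "W22 \<gamma>" by (rule W22_of_ac_primitive[OF D\<gamma> ap square_integrable_continuous[OF ca]])
  have d1: "d1 \<gamma> t = p t" if "t \<in> {0..1}" for t by (rule has_vector_derivative_d1[OF D\<gamma> that])
  have d2: "d2 \<gamma> t = a t" if t: "t \<in> {0..1}" for t
  proof (rule has_vector_derivative_d2[OF _ t])
    show "(d1 \<gamma> has_vector_derivative a t) (at01 t)"
      by (rule has_vector_derivative_transform[OF t d1 Dp])
  qed
  have np: "norm (p t) = T" for t
  proof -
    have "(norm (p t))^2 = (e * e) * T^2 * (dX t)^2 + T^2 * (dY t)^2"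
      by (simp add: p_def norm_prod_def power_mult_distrib power2_eq_square)
    also have "\<dots> = T^2 * ((dX t)^2 + (dY t)^2)" unfolding ee by (simp add: distrib_left)
    also have "\<dots> = T^2" unfolding unit by simp
    finally show ?thesis using T by (simp add: power2_eq_iff_nonneg)
  qed
  have nz: "d1 \<gamma> t \<noteq> 0" if "t \<in> {0..1}" for t
    using d1[OF that] np[of t] T by auto
  have ends: "\<gamma> 0 = (0, 0)" "\<gamma> 1 = (l, 0)" "Y 0 = 0" "Y 1 = 0"
  proof -
    note s1 = std_at_multiples[OF mq k, of 1]
    show "Y 0 = 0" "\<gamma> 0 = (0, 0)" using std_initial[OF mq k] by (simp_all add: \<gamma> X_def Y_def)
    show "Y 1 = 0" using s1(2) by (simp add: Y_def T_def)
    have "X 1 = 2 * Npar q / k" using s1(1) by (simp add: X_def T_def Npar_def)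
    then have "e * X 1 = 2 * (e * Npar q) / k" by simp
    also have "2 * (e * Npar q) = k * l" using keq l by simp
    finally have "e * X 1 = l" using k by simp
    then show "\<gamma> 1 = (l, 0)" using \<open>Y 1 = 0\<close> by (simp add: \<gamma>)
  qed
  have adm: "admissible l \<gamma>" using W nz ends by (simp add: admissible_def)

  \<comment> \<open>Closed forms of \<open>varM\<close> and \<open>varR\<close> along the curve,
    obtained from the curvature -e k^2 y; F is the constant force of the first integral.\<close>
  define M where "M t = (2 * e * k^2 / T * (Y t * dY t), - 2 * k^2 / T * (Y t * dX t))" for t
  define R where "R t = (e * ((lam - 3 * k^2 * k^2 * (Y t)^2) * dX t), (lam - 3 * k^2 * k^2 * (Y t)^2) * dY t)" for t
  define F :: "real \<times> real" where "F = (- 2 * e * k^2, 0)"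
  have C0: "cross2 (p t) (a t) = - e * k^2 * T ^ 3 * Y t" for t
  proof -
    have "cross2 (p t) (a t) = - e * k^2 * T ^ 3 * Y t * ((dX t)^2 + (dY t)^2)"
      by (simp add: cross2_def p_def a_def algebra_simps power2_eq_square power3_eq_cube)
    then show ?thesis unfolding unit by simp
  qed
  have M: "varM \<gamma> t = M t" if "t \<in> {0..1}" for t
    unfolding varM_def d1[OF that] d2[OF that] np C0 M_def
    using T e by (auto simp: p_def field_simps eval_nat_numeral)
  have R: "varR lam \<gamma> t = R t" if "t \<in> {0..1}" for t
    unfolding varR_def d1[OF that] d2[OF that] np C0 R_def
    using T e by (auto simp: p_def a_def field_simps eval_nat_numeral)
  have DM: "(M has_vector_derivative R t - F) (at t within S)" for t S
  proof -
    have dY2: "dY t * dY t = 1 - dX t * dX t" using unit[of t] by (simp add: power2_eq_square)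
    have "2 * e * k^2 / T * (T * dY t * dY t + - T * (k^2 * Y t * dX t) * Y t)
       = e * (2 * k^2 * (dY t * dY t) - 2 * k^2 * k^2 * (Y t)^2 * dX t)"
      using T by (simp add: field_simps power2_eq_square)
    also have "\<dots> = e * (2 * k^2 - (2 * k^2 * dX t) * dX t - 2 * k^2 * k^2 * (Y t)^2 * dX t)"
      unfolding dY2 by (simp add: algebra_simps)
    also have "\<dots> = fst (R t - F)"
      unfolding dXe by (simp add: R_def F_def algebra_simps)
    finally have 1: "((\<lambda>t. 2 * e * k^2 / T * (Y t * dY t)) has_real_derivative fst (R t - F)) (at t)"
      by (rule DERIV_cong[OF DERIV_cmult[OF DERIV_mult[OF DY DdY]]])
    have "- 2 * k^2 / T * (T * dY t * dX t + T * (k^2 * Y t * dY t) * Y t)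
       = - ((2 * k^2 * dX t) * dY t) - 2 * k^2 * k^2 * (Y t)^2 * dY t"
      using T by (simp add: field_simps power2_eq_square)
    also have "\<dots> = snd (R t - F)"
      unfolding dXe by (simp add: R_def F_def algebra_simps)
    finally have 2: "((\<lambda>t. - 2 * k^2 / T * (Y t * dX t)) has_real_derivative snd (R t - F)) (at t)"
      by (rule DERIV_cong[OF DERIV_cmult[OF DERIV_mult[OF DY DdX]]])
    have "(M has_vector_derivative (fst (R t - F), snd (R t - F))) (at t within S)"
      unfolding M_def[abs_def] using 1 2
      by (intro has_vector_derivative_Pair has_field_derivative_at_within[THEN
          has_real_derivative_iff_has_vector_derivative[THEN iffD1]])
    then show ?thesis by (simp only: prod.collapse)
  qed
  have cR: "continuous_on {0..1} R" unfolding R_def[abs_def] by (intro continuous_intros cont)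
  have aM: "ac_primitive M (\<lambda>t. R t - F)"
    by (rule ac_primitive_of_derivative[OF DM]) (intro continuous_intros cR)
  have crit: "integral {0..1} (\<lambda>t. varM \<gamma> t \<bullet> d2 \<eta> t + varR lam \<gamma> t \<bullet> d1 \<eta> t) = 0"
    if \<eta>: "W22 \<eta>" "\<eta> 0 = 0" "\<eta> 1 = 0" for \<eta>
  proof -
    note h = W22_derivatives[OF \<eta>(1)]
    have "ac_primitive (\<lambda>t. M t \<bullet> d1 \<eta> t) (\<lambda>t. (R t - F) \<bullet> d1 \<eta> t + M t \<bullet> d2 \<eta> t)"
      by (rule ac_primitive_inner[OF aM h(2)])
    moreover have "ac_primitive (\<lambda>t. F \<bullet> \<eta> t) (\<lambda>t. F \<bullet> d1 \<eta> t)"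
      by (rule ac_primitive_linear[OF ac_primitive_of_derivative[OF h(1) ac_primitive_continuous[OF h(2)]]
            bounded_linear_inner_right])
    ultimately have "ac_primitive (\<lambda>t. M t \<bullet> d1 \<eta> t + F \<bullet> \<eta> t)
       (\<lambda>t. ((R t - F) \<bullet> d1 \<eta> t + M t \<bullet> d2 \<eta> t) + F \<bullet> d1 \<eta> t)"
      by (rule ac_primitive_add)
    then have "ac_primitive (\<lambda>t. M t \<bullet> d1 \<eta> t + F \<bullet> \<eta> t) (\<lambda>t. varM \<gamma> t \<bullet> d2 \<eta> t + varR lam \<gamma> t \<bullet> d1 \<eta> t)"
      by (rule ac_primitive_cong[OF _ negligible_empty]) (auto simp: M R inner_diff_left)
    moreover have "M 0 = 0" "M 1 = 0" using ends by (auto simp: M_def zero_prod_def)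
    ultimately show ?thesis using \<eta> by (simp add: ac_primitive_def)
  qed
  have pe: "pinned_elastica lam l \<gamma>"
    unfolding pinned_elastica_def
  proof (intro conjI adm allI impI)
    fix \<eta> assume \<eta>: "W22 \<eta> \<and> \<eta> 0 = 0 \<and> \<eta> 1 = 0"
    show "((\<lambda>sg. energy lam (\<lambda>t. \<gamma> t + sg *\<^sub>R \<eta> t)) has_real_derivative 0) (at 0)"
      using first_variation[OF W nz, of \<eta> lam] crit[of \<eta>] \<eta> by simp
  qed
  then show "pinned_elastica lam l (std_curve e q k)" by (simp add: \<gamma>_def)

  have "\<not> reparam_of \<gamma> (segment_curve l)"
  proof
    assume "reparam_of \<gamma> (segment_curve l)"
    then obtain \<phi> where "\<And>t. t \<in> {0..1} \<Longrightarrow> \<gamma> t = segment_curve l (\<phi> t)"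
      unfolding reparam_of_def by blast
    \<comment> \<open>The parameter 1/2 corresponds to amplitude 0, the apex of the arch.\<close>
    from this[of "1/2"] have "Y (1/2) = 0" by (simp add: \<gamma> segment_curve_def)
    moreover have "Y (1/2) = 2 * q / k"
      using k am_values(1)[OF mq] by (simp add: Y_def T_def std_y_def cn_def)
    ultimately show False using k wavelikeD(3)[OF wave] by simp
  qed
  then show "nontrivial l (std_curve e q k)" by (simp add: nontrivial_def \<gamma>_def)

  have lam: "lam > 0" unfolding lamw using k wavelikeD(2)[OF wave] by simp
  \<comment> \<open>The first integral provides some force \<open>F'\<close> together with the
    energy formula. Evaluating its speed identity at t = 0, where y = 0, identifies
    \<open>F'\<close> with \<open>- 2 * e * k^2\<close>.\<close>
  obtain F' where F': "\<And>t. t \<in> {0..1} \<Longrightarrow> F' * fst (d1 \<gamma> t) = (lam - (F' * snd (\<gamma> t) / 2)^2) * norm (d1 \<gamma> t)"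
    "energy lam \<gamma> = 2 * lam * curve_length \<gamma> - F' * l"
    using pinned_elastica_first_integral[OF pe lam l] by metis
  have "F' * (e * (T * dX 0)) = lam * T"
    using F'(1)[of 0] d1[of 0] np[of 0] ends by (simp add: p_def)
  then have "F' * e * dX 0 = lam" using T by simp
  moreover have "dX 0 = - wpar q" using std_initial(3)[OF mq k] by (simp add: dX_def wpar_def)
  ultimately have "(F' * e + 2 * k^2) * wpar q = 0" by (simp add: lamw algebra_simps)
  then have "F' * e = - (2 * k^2)" using wavelikeD(2)[OF wave] by (simp add: eq_neg_iff_add_eq_0)
  then have "F' = - (2 * k^2) * e" using e by auto
  moreover have "e * l = 2 * Npar q / k"
    using keq k l e by (auto simp: field_simps)
  ultimately have Fl: "F' * l = - (4 * k * Npar q)"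
    using k by (simp add: mult.assoc power2_eq_square)
  have len: "curve_length \<gamma> = T"
  proof -
    have "curve_length \<gamma> = integral {0..1::real} (\<lambda>t. T)"
      unfolding curve_length_def by (rule hk_integral_cong) (simp add: d1 np)
    then show ?thesis by simp
  qed
  have "energy lam \<gamma> = 8 * k * wpar q * compK q + 4 * k * Npar q"
    unfolding F'(2) Fl len T_def unfolding lamw using k by (simp add: power2_eq_square)
  also have "\<dots> = sqrt lam * en_par q"
    using en_par_scaled[OF wave k] by (simp add: lamw algebra_simps)
  finally show "energy lam (std_curve e q k) = sqrt lam * en_par q" by (simp add: \<gamma>_def)
qed

lemma reparam_std_curve:
  assumes wave: "wavelike q" and k: "k > 0" and sg: "sg = 1 \<or> sg = - 1"
    and al: "continuous_on {0..1} al" "strict_mono_on {0..1} al" "al 0 = 0" "al 1 = 2 * compK q / k"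
    and \<gamma>: "\<And>t. t \<in> {0..1} \<Longrightarrow> \<gamma> t = (e * std_x q k (al t), sg * std_y q k (al t))"
  shows "reparam_of \<gamma> (std_curve e q k) \<or> reparam_of \<gamma> (reflect_x \<circ> std_curve e q k)"
proof -
  define T where "T = 2 * compK q / k"
  have T: "T > 0" using compK_pos[OF wavelikeD(1)[OF wave]] k by (simp add: T_def)
  have c: "continuous_on {0..1} (\<lambda>t. al t / T)" using T by (intro continuous_intros al(1)) auto
  have m: "strict_mono_on {0..1} (\<lambda>t. al t / T)"
    using strict_mono_onD[OF al(2)] T by (intro strict_mono_onI divide_strict_right_mono) auto
  have sc: "std_curve e q k (al t / T) = (e * std_x q k (al t), std_y q k (al t))" for t
    using T unfolding std_curve_def T_def[symmetric] by simp
  from sg show ?thesis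
  proof
    assume "sg = 1"
    then have "reparam_of \<gamma> (std_curve e q k)"
      unfolding reparam_of_def using c m al T \<gamma>
      by (intro exI[of _ "\<lambda>t. al t / T"]) (simp add: sc T_def[symmetric])
    then show ?thesis ..
  next
    assume "sg = - 1"
    then have "reparam_of \<gamma> (reflect_x \<circ> std_curve e q k)"
      unfolding reparam_of_def using c m al T \<gamma>
      by (intro exI[of _ "\<lambda>t. al t / T"]) (simp add: sc T_def[symmetric] reflect_x_def)
    then show ?thesis ..
  qed
qed

text \<open>Reduces both cases of the theorem to the one-variable inequality \<open>min\<close>. Its
  strict alternative also yields uniqueness, since equal energies leave only n = 1 and q = q0, and
  the distance then fixes the scale.\<close>

lemma unique_min_std_curve:
  assumes lam: "lam > 0" and l: "l > 0" and e: "e = 1 \<or> e = - 1" and wave: "wavelike q0"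
    and ell: "e * ell_par q0 = sqrt (lam * l^2)" and keq: "k = 2 * (e * Npar q0) / l"
    and min: "\<And>q n. \<lbrakk>wavelike q; 1 \<le> n; real n * \<bar>ell_par q\<bar> = sqrt (lam * l^2)\<rbrakk> \<Longrightarrow>
      en_par q0 < real n * en_par q \<or> (n = 1 \<and> q = q0)"
  shows "unique_min_nontrivial lam l (std_curve e q0 k)"
proof -
  have w: "wpar q0 > 0" by (rule wavelikeD(2)[OF wave])
  have c: "lam * l^2 > 0" using lam l by simp
  have eN: "0 < e * Npar q0"
  proof -
    have "e * ell_par q0 = 2 * sqrt 2 * sqrt (wpar q0) * (e * Npar q0)" by (simp add: ell_par_def)
    moreover have "0 < e * ell_par q0" unfolding ell using c by simp
    ultimately have "0 < (2 * sqrt 2 * sqrt (wpar q0)) * (e * Npar q0)" by (simp only:)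
    then show ?thesis by (rule zero_less_mult_pos) (use w in simp)
  qed
  have k: "k > 0" using eN l by (simp add: keq)
  have lamw: "lam = 2 * k^2 * wpar q0"
  proof -
    have "(e * ell_par q0)^2 = lam * l^2" unfolding ell using c by simp
    then have "8 * wpar q0 * (e * Npar q0)^2 = lam * l^2"
      using w by (simp add: ell_par_def power_mult_distrib ac_simps)
    then show ?thesis using l by (simp add: keq power_divide power_mult_distrib field_simps)
  qed
  note std = std_curve_pinned[OF e wave eN l keq lamw]
  have claim: "energy lam (std_curve e q0 k) \<le> energy lam \<gamma> \<and>
      (energy lam \<gamma> = energy lam (std_curve e q0 k) \<longrightarrow>
        reparam_of \<gamma> (std_curve e q0 k) \<or> reparam_of \<gamma> (reflect_x \<circ> std_curve e q0 k))"
    if "pinned_elastica lam l \<gamma>" "nontrivial l \<gamma>" for \<gamma>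
  proof (rule elastica_classification[OF that lam l])
    fix e' sg q k' :: real and n :: nat and al :: "real \<Rightarrow> real"
    assume e': "e' = 1 \<or> e' = - 1" and sg: "sg = 1 \<or> sg = - 1" and wq: "wavelike q"
      and "k' > 0" and n: "n \<ge> 1" and eN': "0 < e' * Npar q" and keq': "k' = 2 * real n * (e' * Npar q) / l"
      and al: "continuous_on {0..1} al" "strict_mono_on {0..1} al" "al 0 = 0" "al 1 = 2 * real n * compK q / k'"
      and sol: "\<And>t. t \<in> {0..1} \<Longrightarrow> \<gamma> t = (e' * std_x q k' (al t), sg * std_y q k' (al t))"
      and en: "energy lam \<gamma> = sqrt lam * (real n * en_par q)"
      and el: "real n * \<bar>ell_par q\<bar> = sqrt (lam * l^2)"
    have dich: "en_par q0 < real n * en_par q \<or> (n = 1 \<and> q = q0)" by (rule min[OF wq n el])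
    then have "en_par q0 \<le> real n * en_par q" by auto
    then have le: "energy lam (std_curve e q0 k) \<le> energy lam \<gamma>"
      unfolding std(3) en using lam by (intro mult_left_mono) auto
    have "reparam_of \<gamma> (std_curve e q0 k) \<or> reparam_of \<gamma> (reflect_x \<circ> std_curve e q0 k)"
      if "energy lam \<gamma> = energy lam (std_curve e q0 k)"
    proof -
      have "real n * en_par q = en_par q0" using that lam unfolding std(3) en by simp
      then have nq: "n = 1" "q = q0" using dich by auto
      \<comment> \<open>Both signs make the same nonzero number \<open>Npar q0\<close>
        positive.\<close>
      have ee: "e' = e" using e e' eN eN' nq(2) by auto
      have aa: "k' = k" using keq keq' nq ee by simp
      show ?thesis
        by (rule reparam_std_curve[OF wave k sg al(1,2,3)]) (use al(4) sol nq ee aa in auto)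
    qed
    with le show ?thesis by blast
  qed
  show ?thesis
    unfolding unique_min_nontrivial_def using std(1,2) claim by blast
qed

theorem theorem1p3:
  fixes lam l :: real
  assumes "lam > 0" and "l > 0"
  shows "(lam * l\<^sup>2 \<le> lambda_hat \<longrightarrow> unique_min_nontrivial lam l (larc lam l)) \<and>
         (lam * l\<^sup>2 > lambda_hat \<longrightarrow> unique_min_nontrivial lam l (loop lam l))"
proof (intro conjI impI)
  define c where "c = lam * l^2"
  have c: "c > 0" using assms by (simp add: c_def)
  {
    assume h: "lam * l^2 \<le> lambda_hat"
    note q2 = q2_props[OF c h[folded c_def]]
    have w: "wavelike (q2 c)"
      using q2(1,2) wavelikeD(4)[OF wavelike_q_star] by (intro wavelike_ge_hat) auto
    have "unique_min_nontrivial lam l (std_curve 1 (q2 c) (2 * (1 * Npar (q2 c)) / l))"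
      by (rule unique_min_std_curve[OF assms _ w _ refl])
        (use q2 larc_minimal[OF c h[folded c_def]] in \<open>auto simp: c_def\<close>)
    moreover have "larc lam l = std_curve 1 (q2 c) (2 * (1 * Npar (q2 c)) / l)"
      by (auto simp: fun_eq_iff larc_def larc_arcl_def std_curve_def std_x_def std_y_def Let_def c_def Npar_def)
    ultimately show "unique_min_nontrivial lam l (larc lam l)" by simp
  }
  {
    assume h: "lambda_hat < lam * l^2"
    note q3 = q3_props[OF c]
    have w: "wavelike (q3 c)"
      using wavelike_between[OF wavelike_q_star _ q3(2)] q3(1) by simp
    \<comment> \<open>\<open>Npar\<close> is negative at \<open>q3 c\<close>, beyond
      \<open>q_star\<close>, so the sign -1 makes the distance positive.\<close>
    have "unique_min_nontrivial lam l (std_curve (- 1) (q3 c) (2 * (- 1 * Npar (q3 c)) / l))"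
      by (rule unique_min_std_curve[OF assms _ w _ refl])
        (use q3 loop_minimal[OF c h[folded c_def]] in \<open>auto simp: c_def\<close>)
    moreover have "loop lam l = std_curve (- 1) (q3 c) (2 * (- 1 * Npar (q3 c)) / l)"
      by (auto simp: fun_eq_iff loop_def loop_arcl_def std_curve_def std_x_def std_y_def Let_def c_def Npar_def
          diff_divide_distrib add_divide_distrib)
    ultimately show "unique_min_nontrivial lam l (loop lam l)" by simp
  }
qed

end
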